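(* Let $(S)$ be an SDSE with $I=\{1,\ldots,N\}$, associated to non-constant series $F_i=\sum_{(p_1,\ldots,p_N)}a^{(i)}_{(p_1,\ldots,p_N)}h_1^{p_1}\cdots h_N^{p_N}$ with $F_i(0,\ldots,0)=1$. Let $a^{(i)}_j$ be the coefficient of $h_j$ in $F_i$. Then $(S)$ is Hopf if and only if there exist scalars $\lambda_n^{(i,j)}\in K$ ($i,j\in I$, $n\ge1$) satisfying the two following conditions: 1. For all $i,j\in I$ and all $(p_1,\ldots,p_N)\in\mathbb N^N$: $$a^{(i)}_{(p_1,\ldots,p_j+1,\ldots,p_N)}=\frac1{p_j+1}\Big(\lambda^{(i,j)}_{p_1+\cdots+p_N+1}-\sum_{l\in I}p_la^{(l)}_j\Big)a^{(i)}_{(p_1,\ldots,p_N)}.$$ 2. For all $p\ge1$ and all $i,j,d_1,\ldots,d_p\in I$ such that $a^{(i)}_{(p_1,\ldots,p_N)}\ne0$, where $p_k$ is the number of indices $q\in\{1,\ldots,p\}$ with $d_q=k$, and for all $n_1,\ldots,n_p\ge1$: $$\lambda^{(i,j)}_{n_1+\cdots+n_p+1}-a^{(i)}_j=\lambda^{(i,j)}_{p+1}-a^{(i)}_j+\sum_{l=1}^p\Big(\lambda^{(d_l,j)}_{n_l}-a^{(d_l)}_j\Big).$$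
   Context: $K$ is a field of characteristic zero and $I$ a finite non-empty set. $\mathcal{H}_I$ is the (Connes-Kreimer) polynomial algebra generated by the set of (isomorphism classes of non-planar) rooted trees whose vertices are decorated by elements of $I$; monomials are forests; it is graded by the number of vertices, and $\widehat{\mathcal H_I}=\prod_n\mathcal H_I(n)$ is its completion. The coproduct is the algebra morphism with $\Delta(t)=t\otimes1+1\otimes t+\sum_cP^c(t)\otimes R^c(t)$ for each tree $t$, where $c$ runs over non-empty sets of edges of $t$ such that every path from the root to a leaf meets at most one edge of $c$; after deleting the edges of $c$, $R^c(t)$ is the component containing the root and $P^c(t)$ is the product of the other components. This makes $\mathcal H_I$ a Hopf algebra. $B_i^+$ is the linear (continuous) operator sending a forest to the tree obtained by grafting its trees on a common root decorated by $i$. The SDSE $(S)$ associated to non-constant series $(F_i)_{i\in I}$, $F_i\in K[[h_j,j\in I]]$, is the system $X_i=B_i^+(F_i(X_j,j\in I))$, $i\in I$; it has a unique solution $(X_i)_{i\in I}\in\widehat{\mathcal H_I}^{\,I}$. $X_i(n)$ is the homogeneous component of degree $n$ of $X_i$, and $\mathcal H_{(S)}$ is the subalgebra of $\mathcal H_I$ generated by all the $X_i(n)$. $(S)$ is Hopf if $\mathcal H_{(S)}$ is a Hopf subalgebra of $\mathcal H_I$. *)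

theory Defs
  imports
    "HOL-Library.Multiset"
    "HOL-Library.Poly_Mapping"
    "HOL-Library.Product_Plus"
    "HOL-Computational_Algebra.Formal_Power_Series"
begin

section \<open>Decorated rooted trees\<close>

text \<open>
  Isomorphism classes of non-planar rooted trees decorated by \<^typ>\<open>'i\<close>: a root together with
  the multiset of its subtrees.
\<close>

datatype 'i rtree = Node 'i "'i rtree multiset"

type_synonym 'i forest = "'i rtree multiset"

primrec vertices :: "'i rtree \<Rightarrow> nat" where
  "vertices (Node i f) = Suc (sum_mset (image_mset vertices f))"

definition degree :: "'i forest \<Rightarrow> nat" where
  "degree f = sum_mset (image_mset vertices f)"

text \<open>
  In a multiset of subtrees individual edges cannot be named, so sets of edges are taken in a
  planar representative, i.e. with the subtrees of each vertex listed in some order.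
\<close>

datatype 'i ptree = PNode (root: 'i) "'i ptree list"

primrec shape :: "'i ptree \<Rightarrow> 'i rtree" where
  "shape (PNode i ts) = Node i (mset (map shape ts))"

lemma shape_surj: "\<exists>p. shape p = t"
proof (induction t)
  case (Node i f)
  then obtain g where g: "\<And>t. t \<in># f \<Longrightarrow> shape (g t) = t"
    by metis
  obtain ts where ts: "mset ts = f"
    using ex_mset by blast
  have "map (\<lambda>t. shape (g t)) ts = ts"
    using g ts by (intro map_idI) auto
  then have "shape (PNode i (map g ts)) = Node i f"
    using ts by (simp add: comp_def flip: mset_map)
  then show ?case by blast
qed

text \<open>
  Each edge is identified with its lower end, a non-root vertex. A set of edges of \<open>p\<close> is
  encoded by a tree over \<^typ>\<open>'i \<times> bool\<close> which is \<open>p\<close> once the flags are forgotten: the flag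
  of a non-root vertex says whether the edge above it belongs to the set, and the flag of the
  root is \<^const>\<open>False\<close>.
\<close>

fun root_leaf_paths :: "'i ptree \<Rightarrow> 'i list set" where
  "root_leaf_paths (PNode a ts) =
     (if ts = [] then {[a]} else (\<Union>s\<in>set ts. (#) a ` root_leaf_paths s))"

definition admissible_cuts :: "'i ptree \<Rightarrow> ('i \<times> bool) ptree set" where
  "admissible_cuts p =
     {c. map_ptree fst c = p \<and> \<not> snd (root c) \<and>
         (\<exists>v\<in>set_ptree c. snd v) \<and>
         (\<forall>w\<in>root_leaf_paths c. length (filter snd w) \<le> 1)}"

text \<open>
  After deletion of the flagged edges: the component of the root, and the product (a forest) of
  all the other components.
\<close>

fun root_component :: "('i \<times> bool) ptree \<Rightarrow> 'i rtree" where
  "root_component (PNode a ts) =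
     Node (fst a) (mset (map root_component (filter (\<lambda>s. \<not> snd (root s)) ts)))"

fun other_components :: "('i \<times> bool) ptree \<Rightarrow> 'i forest" where
  "other_components (PNode a ts) =
     sum_list (map (\<lambda>s. (if snd (root s) then {#root_component s#} else {#}) + other_components s) ts)"

lemma finite_admissible_cuts:
  fixes p :: "'i ptree"
  shows "finite (admissible_cuts p)"
proof -
  have fin: "finite {c :: ('i \<times> bool) ptree. map_ptree fst c = p}" for p :: "'i ptree"
  proof (induction p)
    case (PNode i ts)
    let ?C = "\<Union>s\<in>set ts. {c :: ('i \<times> bool) ptree. map_ptree fst c = s}"
    let ?L = "{cs. set cs \<subseteq> ?C \<and> length cs = length ts}"
    have "finite ?L"
      using PNode by (intro finite_lists_length_eq) auto
    then have "finite ((\<lambda>(b, cs). PNode (i, b) cs) ` (UNIV \<times> ?L))"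
      by (intro finite_imageI finite_cartesian_product) auto
    moreover have "{c. map_ptree fst c = PNode i ts} \<subseteq> (\<lambda>(b, cs). PNode (i, b) cs) ` (UNIV \<times> ?L)"
    proof
      fix c :: "('i \<times> bool) ptree"
      assume "c \<in> {c. map_ptree fst c = PNode i ts}"
      then obtain b cs where c: "c = PNode (i, b) cs" "map (map_ptree fst) cs = ts"
        by (cases c) auto
      then have "cs \<in> ?L" by auto
      then show "c \<in> (\<lambda>(b, cs). PNode (i, b) cs) ` (UNIV \<times> ?L)"
        using c by force
    qed
    ultimately show ?case by (rule rev_finite_subset)
  qed
  show ?thesis
    unfolding admissible_cuts_def by (rule finite_subset [OF _ fin [of p]]) auto
qed


section \<open>The Hopf algebra of decorated rooted trees\<close>

text \<open>
  The polynomial algebra generated by the trees is the monoid algebra of the free commutative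
  monoid of forests. The forests form a basis of it, hence the pairs of forests form a basis of its
  tensor square, which is the monoid algebra of pairs of forests.
\<close>

type_synonym ('i, 'k) tree_alg = "'i forest \<Rightarrow>\<^sub>0 'k"
type_synonym ('i, 'k) tree_alg2 = "('i forest \<times> 'i forest) \<Rightarrow>\<^sub>0 'k"

definition scale :: "'k::field \<Rightarrow> ('a \<Rightarrow>\<^sub>0 'k) \<Rightarrow> ('a \<Rightarrow>\<^sub>0 'k)" where
  "scale c x = Poly_Mapping.map ((*) c) x"

lemma lookup_scale [simp]: "Poly_Mapping.lookup (scale c x) a = c * Poly_Mapping.lookup x a"
  by (simp add: scale_def Poly_Mapping.map.rep_eq when_def)

interpretation scale: vector_space "scale :: 'k::field \<Rightarrow> ('a \<Rightarrow>\<^sub>0 'k) \<Rightarrow> ('a \<Rightarrow>\<^sub>0 'k)"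
  by standard (auto intro!: poly_mapping_eqI simp: lookup_add algebra_simps)

definition basis :: "'a \<Rightarrow> ('a \<Rightarrow>\<^sub>0 'k::field)" where
  "basis a = Poly_Mapping.single a 1"

definition linear_extension :: "('a \<Rightarrow> ('b \<Rightarrow>\<^sub>0 'k::field)) \<Rightarrow> ('a \<Rightarrow>\<^sub>0 'k) \<Rightarrow> ('b \<Rightarrow>\<^sub>0 'k)" where
  "linear_extension \<phi> x = (\<Sum>a\<in>Poly_Mapping.keys x. scale (Poly_Mapping.lookup x a) (\<phi> a))"

definition tensor :: "('i, 'k::field) tree_alg \<Rightarrow> ('i, 'k) tree_alg \<Rightarrow> ('i, 'k) tree_alg2" where
  "tensor x y = linear_extension (\<lambda>f. linear_extension (\<lambda>g. basis (f, g)) y) x"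

definition coprod_tree :: "'i rtree \<Rightarrow> ('i, 'k::field) tree_alg2" where
  "coprod_tree t =
     tensor (basis {#t#}) 1 + tensor 1 (basis {#t#}) +
     (\<Sum>c\<in>admissible_cuts (SOME p. shape p = t).
        tensor (basis (other_components c)) (basis {#root_component c#}))"

definition coprod :: "('i, 'k::field) tree_alg \<Rightarrow> ('i, 'k) tree_alg2" where
  "coprod = linear_extension (\<lambda>f. prod_mset (image_mset coprod_tree f))"

definition counit :: "('i, 'k::field) tree_alg \<Rightarrow> 'k" where
  "counit x = Poly_Mapping.lookup x {#}"

definition convolution ::
  "(('i, 'k::field) tree_alg \<Rightarrow> ('i, 'k) tree_alg) \<Rightarrow> (('i, 'k) tree_alg \<Rightarrow> ('i, 'k) tree_alg) \<Rightarrow>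
   ('i, 'k) tree_alg \<Rightarrow> ('i, 'k) tree_alg" where
  "convolution S T x = linear_extension (\<lambda>(f, g). S (basis f) * T (basis g)) (coprod x)"

definition is_antipode :: "(('i, 'k::field) tree_alg \<Rightarrow> ('i, 'k) tree_alg) \<Rightarrow> bool" where
  "is_antipode S \<longleftrightarrow>
     Vector_Spaces.linear scale scale S \<and>
     (\<forall>x. convolution S id x = scale (counit x) 1) \<and>
     (\<forall>x. convolution id S x = scale (counit x) 1)"

definition subalgebra :: "('i, 'k::field) tree_alg set \<Rightarrow> bool" where
  "subalgebra A \<longleftrightarrow> scale.subspace A \<and> 1 \<in> A \<and> (\<forall>x\<in>A. \<forall>y\<in>A. x * y \<in> A)"

text \<open>The antipode is unique, so the existential quantifier below only names it.\<close>

definition hopf_subalgebra :: "('i, 'k::field) tree_alg set \<Rightarrow> bool" where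
  "hopf_subalgebra A \<longleftrightarrow>
     subalgebra A \<and>
     coprod ` A \<subseteq> scale.span {tensor x y | x y. x \<in> A \<and> y \<in> A} \<and>
     (\<exists>S. is_antipode S \<and> S ` A \<subseteq> A)"


section \<open>Systems of Dyson-Schwinger equations\<close>

text \<open>
  An element of the completion is the sequence of its homogeneous components. With its Cauchy
  product the completion is thus the following subalgebra of the formal power series over the tree
  algebra.
\<close>

definition completion :: "('i, 'k::field) tree_alg fps set" where
  "completion = {x. \<forall>n. \<forall>f\<in>Poly_Mapping.keys (fps_nth x n). degree f = n}"

definition graft :: "'i \<Rightarrow> ('i, 'k::field) tree_alg \<Rightarrow> ('i, 'k) tree_alg" where
  "graft i = linear_extension (\<lambda>f. basis {#Node i f#})"

definition graft_completion :: "'i \<Rightarrow> ('i, 'k::field) tree_alg fps \<Rightarrow> ('i, 'k) tree_alg fps" where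
  "graft_completion i x =
     Abs_fps (\<lambda>n. case n of 0 \<Rightarrow> 0 | Suc m \<Rightarrow> graft i (fps_nth x m))"

text \<open>
  A series in the variables \<open>h\<^sub>j\<close> is given by its coefficients, indexed by
  exponents \<^typ>\<open>'i \<Rightarrow> nat\<close>. It is substituted degree by degree; when the \<open>X j\<close> have no constant
  term, as for the solutions below, only exponents of total degree at most \<open>n\<close> contribute
  to the component of degree \<open>n\<close>, so the sum is finite.
\<close>

type_synonym ('i, 'k) series = "('i \<Rightarrow> nat) \<Rightarrow> 'k"

definition substitute ::
  "('i::finite, 'k::field) series \<Rightarrow> ('i \<Rightarrow> ('i, 'k) tree_alg fps) \<Rightarrow> ('i, 'k) tree_alg fps" where
  "substitute F X =
     Abs_fps (\<lambda>n. Sum_any (\<lambda>p. scale (F p) (fps_nth (\<Prod>j\<in>UNIV. X j ^ p j) n)))"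

definition is_sdse_solution ::
  "('i::finite \<Rightarrow> ('i, 'k::field) series) \<Rightarrow> ('i \<Rightarrow> ('i, 'k) tree_alg fps) \<Rightarrow> bool" where
  "is_sdse_solution F X \<longleftrightarrow>
     (\<forall>i. X i \<in> completion) \<and> (\<forall>i. X i = graft_completion i (substitute (F i) X))"

definition sdse_solution ::
  "('i::finite \<Rightarrow> ('i, 'k::field) series) \<Rightarrow> 'i \<Rightarrow> ('i, 'k) tree_alg fps" where
  "sdse_solution F = (THE X. is_sdse_solution F X)"

definition sdse_subalgebra ::
  "('i::finite \<Rightarrow> ('i, 'k::field) series) \<Rightarrow> ('i, 'k) tree_alg set" where
  "sdse_subalgebra F = subalgebra hull {fps_nth (sdse_solution F i) n | i n. True}"

definition hopf_sdse :: "('i::finite \<Rightarrow> ('i, 'k::field) series) \<Rightarrow> bool" where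
  "hopf_sdse F \<longleftrightarrow> hopf_subalgebra (sdse_subalgebra F)"

definition nonconstant :: "('i, 'k::zero) series \<Rightarrow> bool" where
  "nonconstant F \<longleftrightarrow> (\<exists>p. p \<noteq> (\<lambda>_. 0) \<and> F p \<noteq> 0)"

definition lin_coeff :: "('i, 'k) series \<Rightarrow> 'i \<Rightarrow> 'k" where
  "lin_coeff F j = F ((\<lambda>_. 0)(j := 1))"

end

theory Submission
  imports Defs
begin

text \<open>
  For a tree \<open>s\<close> with root \<open>i\<close> let \<open>Y\<^sub>s\<close> be the coefficient of \<open>_ \<otimes> s\<close> in \<open>\<Delta>(X\<^sub>i)\<close>. For a tree \<open>t\<close>
  obtained by grafting trees \<open>s\<close> on a root \<open>i\<close>, the cocycle property
  \<open>\<Delta>(B\<^sub>i x) = B\<^sub>i x \<otimes> 1 + (id \<otimes> B\<^sub>i) \<Delta>(x)\<close> and Taylor's formula give, up to a symmetry factor,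
  \<open>Y\<^sub>t = (\<Prod>\<^sub>s Y\<^sub>s) \<cdot> (\<partial>\<^sup>P F\<^sub>i)(X)\<close>, where the multi-index \<open>P\<close> counts the roots of the trees \<open>s\<close>.

  Necessity: in a Hopf subalgebra the coefficient of the single vertex \<open>j\<close> in \<open>Y\<^sub>t\<close> is \<open>\<lambda>\<^sub>n\<close> times the
  coefficient of \<open>t\<close> in \<open>X\<^sub>i\<close>, with \<open>n\<close> the number of vertices of \<open>t\<close>. Comparing these coefficients in
  the formula for \<open>Y\<^sub>t\<close> gives the first condition when all the \<open>s\<close> are single vertices, and the
  second one in general.

  Sufficiency: by the two conditions \<open>Y\<^sub>s\<close> is a series in the \<open>X\<^sub>j\<close> whose coefficients satisfy a
  linear recursion that only depends on the root and the number of vertices of \<open>s\<close>. Hence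
  \<open>\<Delta>(X\<^sub>i(n)) = X\<^sub>i(n) \<otimes> 1 + (\<Sum>\<^sub>m W\<^sub>m \<otimes> X\<^sub>i(m))\<close> with \<open>W\<^sub>m\<close> in the subalgebra generated by the \<open>X\<^sub>j(k)\<close>,
  \<open>k < n\<close>. Stability under the antipode follows by induction on \<open>n\<close>.
\<close>

section \<open>Linear maps between monoid algebras\<close>

text \<open>Taylor's formula is obtained by treating trees as polynomial variables: the coefficient
  of a forest in the right factor comes from differentiating with respect to its trees, and only the
  unknown with the matching root depends on a given tree. The symmetry factors are then positive
  integers, which can be cancelled in characteristic zero. Necessity can work with single vertices
  because reading off the coefficient of one tree is a derivation relative to the counit: in the
  subalgebra, coefficients on trees of fixed root and size stay proportional to those of the
  solution. Non-constancy gives every root a nonzero linear coefficient, hence test trees of every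
  size. The obstacle in sufficiency is that the second condition is available only over nonzero
  coefficients. The product formula for \<open>Y\<close> is therefore built one factor at a time,
  recording which weights really occur. Each factor raises one entry \<open>n_l\<close> of the
  second condition from 1 to its actual weight; entries equal to 1 cost nothing, because the first
  condition at the origin says that \<open>\<lambda>_1\<close> is the linear coefficient.\<close>

abbreviation lin :: "(('a \<Rightarrow>\<^sub>0 'k::field) \<Rightarrow> ('b \<Rightarrow>\<^sub>0 'k)) \<Rightarrow> bool" where
  "lin \<equiv> Vector_Spaces.linear scale scale"

lemma lookup_sum: "Poly_Mapping.lookup (sum f A) a = (\<Sum>x\<in>A. Poly_Mapping.lookup (f x) a)"
  by (induction A rule: infinite_finite_induct) (simp_all add: lookup_add)

lemma lin_iff: "lin T \<longleftrightarrow> (\<forall>x y. T (x + y) = T x + T y) \<and> (\<forall>c x. T (scale c x) = scale c (T x))"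
  by (simp add: Vector_Spaces.linear_iff scale.vector_space_axioms)

lemma linI:
  assumes "\<And>x y. T (x + y) = T x + T y" "\<And>c x. T (scale c x) = scale c (T x)"
  shows "lin T"
  using assms by (simp add: lin_iff)

lemma lin_add: "lin T \<Longrightarrow> T (x + y) = T x + T y"
  and lin_scale: "lin T \<Longrightarrow> T (scale c x) = scale c (T x)"
  by (simp_all add: lin_iff)

lemma lin_zero: "lin T \<Longrightarrow> T 0 = 0"
  using lin_scale[of T 0 0] by simp

lemma lin_diff: "lin T \<Longrightarrow> T (x - y) = T x - T y"
  using lin_add[of T "x - y" y] by (simp add: algebra_simps)

lemma lin_uminus: "lin T \<Longrightarrow> T (- x) = - T x"
  using lin_diff[of T 0 x] by (simp add: lin_zero)

lemma lin_sum: "lin T \<Longrightarrow> T (sum f A) = (\<Sum>x\<in>A. T (f x))"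
  by (induction A rule: infinite_finite_induct) (simp_all add: lin_zero lin_add)

lemma lin_comp: "lin S \<Longrightarrow> lin T \<Longrightarrow> lin (\<lambda>x. S (T x))"
  by (simp add: lin_iff)

lemma lin_plus: "lin S \<Longrightarrow> lin T \<Longrightarrow> lin (\<lambda>x. S x + T x)"
  by (simp add: lin_iff algebra_simps scale.scale_right_distrib)

lemma lin_minus: "lin S \<Longrightarrow> lin T \<Longrightarrow> lin (\<lambda>x. S x - T x)"
  by (simp add: lin_iff algebra_simps scale.scale_right_diff_distrib)

lemma lin_id: "lin (\<lambda>x. x)"
  by (simp add: lin_iff)

lemma basis_expansion: "x = (\<Sum>a\<in>Poly_Mapping.keys x. scale (Poly_Mapping.lookup x a) (basis a))"
proof (rule poly_mapping_eqI)
  fix b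
  have "(\<Sum>a\<in>Poly_Mapping.keys x. Poly_Mapping.lookup x a * Poly_Mapping.lookup (basis a) b) =
        (\<Sum>a\<in>Poly_Mapping.keys x. if a = b then Poly_Mapping.lookup x a else 0)"
    by (intro sum.cong) (auto simp: basis_def lookup_single when_def)
  then show "Poly_Mapping.lookup x b =
      Poly_Mapping.lookup (\<Sum>a\<in>Poly_Mapping.keys x. scale (Poly_Mapping.lookup x a) (basis a)) b"
    by (simp add: lookup_sum in_keys_iff)
qed

lemma lin_basis_expansion:
  assumes "lin T"
  shows "T x = (\<Sum>a\<in>Poly_Mapping.keys x. scale (Poly_Mapping.lookup x a) (T (basis a)))"
  by (subst basis_expansion) (simp only: lin_sum[OF assms] lin_scale[OF assms])

lemma lin_eqI:
  assumes "lin S" "lin T" "\<And>a. S (basis a) = T (basis a)"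
  shows "S x = T x"
  by (simp only: lin_basis_expansion[OF assms(1), of x] lin_basis_expansion[OF assms(2), of x] assms(3))

lemma linear_extension_superset:
  assumes "finite A" "Poly_Mapping.keys x \<subseteq> A"
  shows "linear_extension \<phi> x = (\<Sum>a\<in>A. scale (Poly_Mapping.lookup x a) (\<phi> a))"
  unfolding linear_extension_def
  by (rule sum.mono_neutral_left) (use assms in \<open>auto simp: in_keys_iff\<close>)

lemma lin_linear_extension:
  fixes \<phi> :: "'a \<Rightarrow> ('b \<Rightarrow>\<^sub>0 'k::field)"
  shows "lin (linear_extension \<phi>)"
proof (rule linI)
  fix x y :: "'a \<Rightarrow>\<^sub>0 'k"
  let ?A = "Poly_Mapping.keys x \<union> Poly_Mapping.keys y"
  have "Poly_Mapping.keys (x + y) \<subseteq> ?A"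
    by (rule keys_add)
  then show "linear_extension \<phi> (x + y) = linear_extension \<phi> x + linear_extension \<phi> y"
    by (simp add: linear_extension_superset[of ?A] lookup_add scale.scale_left_distrib sum.distrib)
next
  fix c and x :: "'a \<Rightarrow>\<^sub>0 'k"
  have "Poly_Mapping.keys (scale c x) \<subseteq> Poly_Mapping.keys x"
    by (auto simp: in_keys_iff)
  then show "linear_extension \<phi> (scale c x) = scale c (linear_extension \<phi> x)"
    by (simp add: linear_extension_superset[of "Poly_Mapping.keys x"] scale.scale_sum_right)
qed

lemma linear_extension_basis [simp]: "linear_extension \<phi> (basis a) = \<phi> a"
  by (simp add: linear_extension_def basis_def)

lemma lookup_basis: "Poly_Mapping.lookup (basis a) b = (if a = b then 1 else 0)"
  by (simp add: basis_def lookup_single when_def)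

lemma basis_zero: "basis 0 = 1"
  by (simp add: basis_def single_one)

lemma basis_empty: "basis {#} = 1"
  using basis_zero by simp

lemma basis_mult: "basis a * basis b = basis (a + b)"
  by (simp add: basis_def mult_single)

lemma basis_sum_mset: "basis (sum_mset (image_mset f M)) = prod_mset (image_mset (\<lambda>x. basis (f x)) M)"
  by (induction M) (simp_all add: basis_zero flip: basis_mult)

lemma scale_eq_mult: "scale c x = Poly_Mapping.single 0 c * x"
  by (simp add: scale_def mult_map_scale_conv_mult)

lemma scale_mult_left: "scale c x * y = scale c (x * y)"
  and scale_mult_right: "x * scale c y = scale c (x * y)"
  for x y :: "'a::comm_monoid_add \<Rightarrow>\<^sub>0 'k::field"
  by (simp_all add: scale_eq_mult ac_simps)

lemma lin_mult_left: "lin (\<lambda>x. x * y)" and lin_mult_right: "lin (\<lambda>x. y * x)"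
  for y :: "'a::comm_monoid_add \<Rightarrow>\<^sub>0 'k::field"
  by (auto intro!: linI simp: algebra_simps scale_mult_left scale_mult_right)

lemma bilinear_eqI:
  assumes "\<And>y. lin (\<lambda>x. S x y)" "\<And>x. lin (S x)" "\<And>y. lin (\<lambda>x. T x y)" "\<And>x. lin (T x)"
    and "\<And>a b. S (basis a) (basis b) = T (basis a) (basis b)"
  shows "S x y = T x y"
  by (rule lin_eqI[OF assms(1,3)], rule lin_eqI[OF assms(2,4)], rule assms(5))

section \<open>Algebra homomorphisms between monoid algebras\<close>

definition alg_hom :: "(('a::comm_monoid_add \<Rightarrow>\<^sub>0 'k::field) \<Rightarrow> ('b::comm_monoid_add \<Rightarrow>\<^sub>0 'k)) \<Rightarrow> bool" where
  "alg_hom T \<longleftrightarrow> lin T \<and> T 1 = 1 \<and> (\<forall>x y. T (x * y) = T x * T y)"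

lemma alg_hom_lin: "alg_hom T \<Longrightarrow> lin T"
  and alg_hom_one: "alg_hom T \<Longrightarrow> T 1 = 1"
  and alg_hom_mult: "alg_hom T \<Longrightarrow> T (x * y) = T x * T y"
  by (simp_all add: alg_hom_def)

lemma alg_hom_prod_mset: "alg_hom T \<Longrightarrow> T (prod_mset M) = prod_mset (image_mset T M)"
  by (induction M) (simp_all add: alg_hom_one[of T] alg_hom_mult[of T])

lemma alg_hom_comp: "alg_hom S \<Longrightarrow> alg_hom T \<Longrightarrow> alg_hom (\<lambda>x. S (T x))"
  using lin_comp[of S T] by (simp add: alg_hom_def)

lemma alg_hom_linear_extension:
  assumes "\<phi> 0 = 1" "\<And>a b. \<phi> (a + b) = \<phi> a * \<phi> b"
  shows "alg_hom (linear_extension \<phi>)"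
proof -
  have "linear_extension \<phi> (x * y) = linear_extension \<phi> x * linear_extension \<phi> y" for x y
    by (rule bilinear_eqI[of "\<lambda>x y. linear_extension \<phi> (x * y)"
          "\<lambda>x y. linear_extension \<phi> x * linear_extension \<phi> y"])
      (simp_all only: lin_comp[OF lin_linear_extension lin_mult_left]
         lin_comp[OF lin_linear_extension lin_mult_right] lin_comp[OF lin_mult_left lin_linear_extension]
         lin_comp[OF lin_mult_right lin_linear_extension] basis_mult linear_extension_basis assms)
  moreover have "linear_extension \<phi> 1 = 1"
    using assms(1) linear_extension_basis[of \<phi> 0] unfolding basis_zero by simp
  ultimately show ?thesis
    by (simp add: alg_hom_def lin_linear_extension)
qed

lemma alg_hom_forest_eqI:
  fixes S T :: "('t multiset \<Rightarrow>\<^sub>0 'k::field) \<Rightarrow> ('b::comm_monoid_add \<Rightarrow>\<^sub>0 'k)"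
  assumes "alg_hom S" "alg_hom T" "\<And>t. S (basis {#t#}) = T (basis {#t#})"
  shows "S x = T x"
proof (rule lin_eqI[of S T])
  show "S (basis f) = T (basis f)" for f
  proof (induction f)
    case empty
    then show ?case using assms by (simp add: basis_empty alg_hom_one[of S] alg_hom_one[of T])
  next
    case (add t f)
    have "basis (add_mset t f) = basis {#t#} * (basis f :: _ \<Rightarrow>\<^sub>0 'k)"
      by (simp add: basis_mult)
    then show ?case using add assms by (simp only: alg_hom_mult[of S] alg_hom_mult[of T])
  qed
qed (use assms in \<open>simp_all add: alg_hom_lin\<close>)

section \<open>The tensor square\<close>

lemma lin_tensor_left: "lin (\<lambda>x. tensor x y)"
  unfolding tensor_def by (rule lin_linear_extension)

lemma lin_tensor_right: "lin (\<lambda>y. tensor x y)"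
proof (rule linI)
  show "tensor x (y + z) = tensor x y + tensor x z" for y z
    unfolding tensor_def linear_extension_def[of _ x]
    by (simp add: lin_add[OF lin_linear_extension] scale.scale_right_distrib sum.distrib)
  show "tensor x (scale c y) = scale c (tensor x y)" for c y
    unfolding tensor_def linear_extension_def[of _ x]
    by (simp add: lin_scale[OF lin_linear_extension] scale.scale_sum_right ac_simps)
qed

lemma tensor_basis [simp]: "tensor (basis f) (basis g) = basis (f, g)"
  by (simp add: tensor_def)

lemma tensor_basis_one [simp]: "tensor (basis f) 1 = basis (f, {#})"
  and tensor_one_basis [simp]: "tensor 1 (basis f) = basis ({#}, f)"
  by (simp_all flip: basis_empty)

lemma basis_pair_empty: "basis ({#}, {#}) = 1"
  using basis_zero[where 'a="'a multiset \<times> 'b multiset"] by (simp add: zero_prod_def)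

lemma tensor_one_one: "tensor 1 1 = 1"
proof -
  have "tensor (basis {#}) (basis {#}) = basis (0 :: 'a forest \<times> 'a forest)"
    by (simp add: zero_prod_def)
  then show ?thesis
    by (simp only: basis_empty basis_zero)
qed

lemma tensor_mult: "tensor x y * tensor x' y' = tensor (x * x') (y * y')"
proof -
  have 1: "tensor (basis f) (basis g) * tensor x' y' = tensor (basis f * x') (basis g * y')" for f g
    by (rule bilinear_eqI[of "\<lambda>x' y'. tensor (basis f) (basis g) * tensor x' y'"
          "\<lambda>x' y'. tensor (basis f * x') (basis g * y')"])
      (simp_all only: lin_comp[OF lin_mult_right lin_tensor_left]
         lin_comp[OF lin_mult_right lin_tensor_right] lin_comp[OF lin_tensor_left lin_mult_right]
         lin_comp[OF lin_tensor_right lin_mult_right] basis_mult tensor_basis plus_prod_def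
         fst_conv snd_conv)
  show ?thesis
    by (rule bilinear_eqI[of "\<lambda>x y. tensor x y * tensor x' y'" "\<lambda>x y. tensor (x * x') (y * y')"])
      (simp_all only: lin_comp[OF lin_mult_left lin_tensor_left]
         lin_comp[OF lin_mult_left lin_tensor_right] lin_comp[OF lin_tensor_left lin_mult_left]
         lin_comp[OF lin_tensor_right lin_mult_left] 1)
qed

definition graft_right :: "'i \<Rightarrow> ('i, 'k::field) tree_alg2 \<Rightarrow> ('i, 'k) tree_alg2" where
  "graft_right i = linear_extension (\<lambda>(f, g). basis (f, {#Node i g#}))"

lemma lin_graft: "lin (graft i)" and lin_graft_right: "lin (graft_right i)"
  by (simp_all add: graft_def graft_right_def lin_linear_extension)

lemma graft_basis [simp]: "graft i (basis f) = basis {#Node i f#}"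
  and graft_right_basis [simp]: "graft_right i (basis (f, g)) = basis (f, {#Node i g#})"
  by (simp_all add: graft_def graft_right_def)

section \<open>The cocycle property of grafting\<close>

lemma in_listset_iff: "cs \<in> listset (map C ts) \<longleftrightarrow> list_all2 (\<lambda>c s. c \<in> C s) cs ts"
  by (induction ts arbitrary: cs) (auto simp: set_Cons_def list_all2_Cons2)

text \<open>\<open>listset\<close> chooses one element per position, so this is distributivity: a
  sum over independent cuts of the branches becomes a product of sums.\<close>

lemma sum_listset:
  fixes v :: "'b \<Rightarrow> 'c::comm_semiring_1"
  shows "(\<Sum>cs\<in>listset (map C ts). prod_list (map v cs)) = prod_list (map (\<lambda>s. \<Sum>c\<in>C s. v c) ts)"
proof (induction ts)
  case (Cons s ts)
  have "listset (map C (s # ts)) = (\<lambda>(c, cs). c # cs) ` (C s \<times> listset (map C ts))"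
    by (auto simp: set_Cons_def)
  moreover have "inj_on (\<lambda>(c, cs). c # cs) (C s \<times> listset (map C ts))"
    by (auto simp: inj_on_def)
  ultimately have "(\<Sum>cs\<in>listset (map C (s # ts)). prod_list (map v cs)) =
      (\<Sum>c\<in>C s. v c) * (\<Sum>cs\<in>listset (map C ts). prod_list (map v cs))"
    by (simp add: sum.reindex sum_product sum.cartesian_product case_prod_unfold del: listset.simps)
  then show ?case
    using Cons by simp
qed simp

text \<open>Here the edge above the root may be cut as well. This adds the empty and the total cut
  to the admissible ones, which account for \<open>1 \<otimes> t\<close> and
  \<open>t \<otimes> 1\<close>, and makes the cuts of the branches of a vertex independent of each
  other.\<close>

definition branch_cuts :: "'i ptree \<Rightarrow> ('i \<times> bool) ptree set" where
  "branch_cuts p = {c. map_ptree fst c = p \<and> (\<forall>w\<in>root_leaf_paths c. length (filter snd w) \<le> 1)}"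

abbreviation uncut :: "'i ptree \<Rightarrow> ('i \<times> bool) ptree" where
  "uncut \<equiv> map_ptree (\<lambda>a. (a, False))"

definition total_cut :: "'i ptree \<Rightarrow> ('i \<times> bool) ptree" where
  "total_cut p = (case p of PNode i ts \<Rightarrow> PNode (i, True) (map uncut ts))"

definition cut_part :: "('i \<times> bool) ptree \<Rightarrow> 'i forest" where
  "cut_part c = (if snd (root c) then {#root_component c#} else {#}) + other_components c"

definition kept_part :: "('i \<times> bool) ptree \<Rightarrow> 'i forest" where
  "kept_part c = (if snd (root c) then {#} else {#root_component c#})"

lemma vertex_on_path: "v \<in> set_ptree c \<Longrightarrow> \<exists>w\<in>root_leaf_paths c. v \<in> set w"
proof (induction c)
  case (PNode a ts)
  have ne: "root_leaf_paths s \<noteq> {}" for s :: "'a ptree"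
    by (induction s) auto
  show ?case
  proof (cases "v = a")
    case True
    then show ?thesis using ne[of "PNode a ts"] by (auto split: if_splits simp: ex_in_conv)
  next
    case False
    then obtain s where "s \<in> set ts" "v \<in> set_ptree s" using PNode.prems by auto
    then show ?thesis using PNode.IH[of s] by fastforce
  qed
qed

lemma path_subset: "w \<in> root_leaf_paths c \<Longrightarrow> set w \<subseteq> set_ptree c"
  by (induction c arbitrary: w) (fastforce split: if_splits)

lemma uncut_unique:
  assumes "map_ptree fst c = p" "\<forall>v\<in>set_ptree c. \<not> snd v"
  shows "c = uncut p"
proof -
  have "map_ptree (\<lambda>v. (fst v, False)) c = map_ptree (\<lambda>v. v) c"
    by (rule ptree.map_cong) (use assms(2) in \<open>auto simp: prod_eq_iff\<close>)
  then show ?thesis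
    using assms(1) by (auto simp: ptree.map_comp o_def ptree.map_ident)
qed

lemma map_fst_uncut [simp]: "map_ptree fst (uncut p) = p"
  by (simp add: ptree.map_comp o_def ptree.map_ident)

lemma root_component_uncut [simp]: "root_component (uncut p) = shape p"
proof (induction p)
  case (PNode i ts)
  have "\<not> snd (root (uncut s))" for s :: "'a ptree" by (cases s) simp
  then show ?case using PNode by (simp add: o_def cong: map_cong)
qed

lemma other_components_uncut [simp]: "other_components (uncut p) = {#}"
proof (induction p)
  case (PNode i ts)
  have "\<not> snd (root (uncut s))" for s :: "'a ptree" by (cases s) simp
  then show ?case using PNode by (simp add: o_def cong: map_cong)
qed

lemma root_component_total_cut [simp]: "root_component (total_cut p) = shape p"
  and other_components_total_cut [simp]: "other_components (total_cut p) = {#}"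
  and root_total_cut [simp]: "snd (root (total_cut p))"
  and root_uncut [simp]: "\<not> snd (root (uncut p))"
proof -
  have "\<not> snd (root (uncut s))" for s :: "'a ptree" by (cases s) simp
  then show "root_component (total_cut p) = shape p" "other_components (total_cut p) = {#}"
    "snd (root (total_cut p))" "\<not> snd (root (uncut p))"
    by (cases p; simp add: total_cut_def o_def cong: map_cong)+
qed

text \<open>A flagged root uses up the one flag allowed on each path, and every vertex lies on a
  path, so nothing else can be flagged. An unflagged root leaves the admissible cuts and the empty
  cut.\<close>

lemma branch_cuts_eq:
  "branch_cuts p = insert (total_cut p) (insert (uncut p) (admissible_cuts p))"
proof (intro subset_antisym subsetI)
  fix c assume c: "c \<in> branch_cuts p"
  show "c \<in> insert (total_cut p) (insert (uncut p) (admissible_cuts p))"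
  proof (cases "snd (root c)")
    case True
    obtain a cs where cs: "c = PNode a cs" by (cases c)
    obtain i ts where p: "p = PNode i ts" by (cases p)
    have "\<not> snd v" if sv: "s \<in> set cs" "v \<in> set_ptree s" for s v
    proof
      assume "snd v"
      obtain w where w: "w \<in> root_leaf_paths s" "v \<in> set w"
        using vertex_on_path[OF sv(2)] by blast
      then have "a # w \<in> root_leaf_paths c" using sv(1) by (auto simp: cs)
      then have "length (filter snd (a # w)) \<le> 1" using c by (auto simp: branch_cuts_def)
      moreover have "snd a" using True by (simp add: cs)
      moreover have "filter snd w \<noteq> []" using w(2) \<open>snd v\<close> by (auto simp: filter_empty_conv)
      ultimately show False by simp
    qed
    then have "s = uncut (map_ptree fst s)" if "s \<in> set cs" for s
      using that by (intro uncut_unique) auto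
    then have "map uncut (map (map_ptree fst) cs) = cs"
      by (simp add: map_idI)
    then have "cs = map uncut ts"
      using c by (auto simp: branch_cuts_def cs p)
    moreover have "a = (i, True)"
      using c True by (auto simp: branch_cuts_def cs p prod_eq_iff)
    ultimately show ?thesis by (simp add: cs p total_cut_def)
  next
    case False
    then show ?thesis
      using c uncut_unique by (auto simp: branch_cuts_def admissible_cuts_def)
  qed
next
  fix c assume "c \<in> insert (total_cut p) (insert (uncut p) (admissible_cuts p))"
  moreover have "filter snd w = []" if "w \<in> root_leaf_paths (uncut s)" for w and s :: "'a ptree"
    using path_subset[OF that] by (auto simp: filter_empty_conv ptree.set_map)
  then have "uncut p \<in> branch_cuts p" "total_cut p \<in> branch_cuts p"
    by (cases p; auto simp: branch_cuts_def total_cut_def o_def split: if_splits)+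
  moreover have "admissible_cuts p \<subseteq> branch_cuts p"
    by (auto simp: branch_cuts_def admissible_cuts_def)
  ultimately show "c \<in> branch_cuts p" by auto
qed

lemma finite_branch_cuts: "finite (branch_cuts p)"
  by (simp add: branch_cuts_eq finite_admissible_cuts)

lemma uncut_not_admissible: "uncut p \<notin> admissible_cuts p"
  and total_cut_not_admissible: "total_cut p \<notin> admissible_cuts p"
  by (auto simp: admissible_cuts_def ptree.set_map)

lemma total_cut_neq_uncut: "total_cut p \<noteq> uncut p"
  by (metis root_total_cut root_uncut)

definition planar_coprod :: "'i ptree \<Rightarrow> ('i, 'k::field) tree_alg2" where
  "planar_coprod p = (\<Sum>c\<in>branch_cuts p. basis (cut_part c, kept_part c))"

lemma planar_coprod_eq:
  "planar_coprod p = tensor (basis {#shape p#}) 1 + tensor 1 (basis {#shape p#}) +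
     (\<Sum>c\<in>admissible_cuts p. tensor (basis (other_components c)) (basis {#root_component c#}))"
proof -
  have "(\<Sum>c\<in>admissible_cuts p. basis (cut_part c, kept_part c)) =
      (\<Sum>c\<in>admissible_cuts p. basis (other_components c, {#root_component c#}))"
    by (intro sum.cong) (auto simp: admissible_cuts_def cut_part_def kept_part_def)
  then show ?thesis
    by (simp add: planar_coprod_def branch_cuts_eq finite_admissible_cuts uncut_not_admissible
        total_cut_not_admissible total_cut_neq_uncut cut_part_def kept_part_def add.assoc)
qed

text \<open>Below an unflagged root the bound only concerns the tails of the paths, so it can be
  checked branch by branch.\<close>

lemma uncut_root_branch_cuts:
  "{c \<in> branch_cuts (PNode i ts). \<not> snd (root c)} =
     PNode (i, False) ` listset (map branch_cuts ts)" (is "?L = ?R")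
proof (intro subset_antisym subsetI)
  fix c assume c: "c \<in> ?L"
  obtain a cs where cs: "c = PNode a cs" by (cases c)
  have a: "a = (i, False)" using c by (auto simp: cs branch_cuts_def prod_eq_iff)
  have ts: "ts = map (map_ptree fst) cs" using c by (auto simp: cs branch_cuts_def)
  have "s \<in> branch_cuts (map_ptree fst s)" if "s \<in> set cs" for s
  proof -
    have "length (filter snd w) \<le> 1" if "w \<in> root_leaf_paths s" for w
    proof -
      have "a # w \<in> root_leaf_paths c" using that \<open>s \<in> set cs\<close> by (auto simp: cs)
      then show ?thesis using c by (auto simp: branch_cuts_def a)
    qed
    then show ?thesis by (simp add: branch_cuts_def)
  qed
  then have "list_all2 (\<lambda>c s. c \<in> branch_cuts s) cs ts"
    by (simp add: ts list_all2_conv_all_nth)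
  then show "c \<in> ?R" by (auto simp: cs a in_listset_iff)
next
  fix c assume "c \<in> ?R"
  then obtain cs where cs: "c = PNode (i, False) cs" "list_all2 (\<lambda>c s. c \<in> branch_cuts s) cs ts"
    by (auto simp: in_listset_iff)
  have "map (map_ptree fst) cs = ts"
    using cs(2) by (induction rule: list_all2_induct) (auto simp: branch_cuts_def)
  moreover have "\<forall>s\<in>set cs. \<forall>w\<in>root_leaf_paths s. length (filter snd w) \<le> 1"
    using cs(2) by (induction rule: list_all2_induct) (auto simp: branch_cuts_def)
  ultimately show "c \<in> ?L" by (auto simp: cs(1) branch_cuts_def)
qed

text \<open>The cocycle property on planar trees. The total cut gives the first term; all other cuts
  are tuples of cuts of the branches, whose cut parts multiply and whose kept parts are grafted on
  the root.\<close>

lemma planar_coprod_PNode: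
  "(planar_coprod (PNode i ts) :: ('i, 'k::field) tree_alg2) =
     tensor (basis {#shape (PNode i ts)#}) 1 + graft_right i (prod_list (map planar_coprod ts))"
proof -
  let ?B = "branch_cuts (PNode i ts)"
  let ?v = "\<lambda>c. basis (cut_part c, kept_part c) :: ('i, 'k) tree_alg2"
  have "{c \<in> ?B. snd (root c)} = {total_cut (PNode i ts)}"
    by (auto simp: branch_cuts_eq admissible_cuts_def)
  then have "planar_coprod (PNode i ts) =
      ?v (total_cut (PNode i ts)) + (\<Sum>c\<in>{c \<in> ?B. \<not> snd (root c)}. ?v c)"
    unfolding planar_coprod_def
    by (subst sum.Int_Diff[of _ _ "{c. snd (root c)}"])
       (simp_all add: finite_branch_cuts Int_def set_diff_eq)
  also have "?v (total_cut (PNode i ts)) = tensor (basis {#shape (PNode i ts)#}) 1"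
    by (simp add: cut_part_def kept_part_def)
  also have "(\<Sum>c\<in>{c \<in> ?B. \<not> snd (root c)}. ?v c) =
      (\<Sum>cs\<in>listset (map branch_cuts ts). graft_right i (prod_list (map ?v cs)))"
  proof -
    have "?v (PNode (i, False) cs) = graft_right i (prod_list (map ?v cs))" for cs
    proof -
      have "prod_list (map ?v cs) = basis (sum_list (map cut_part cs), sum_list (map kept_part cs))"
        by (induction cs) (simp_all add: basis_mult plus_prod_def basis_zero[symmetric] zero_prod_def)
      moreover have "mset (map root_component (filter (\<lambda>s. \<not> snd (root s)) cs)) =
          sum_list (map kept_part cs)"
        by (induction cs) (auto simp: kept_part_def)
      moreover have "other_components (PNode (i, False) cs) = sum_list (map cut_part cs)"
        by (simp add: cut_part_def[abs_def])
      ultimately show ?thesis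
        by (simp add: cut_part_def[of "PNode _ _"] kept_part_def[of "PNode _ _"] del: other_components.simps)
    qed
    then show ?thesis
      unfolding uncut_root_branch_cuts by (subst sum.reindex) (auto simp: inj_on_def)
  qed
  also have "\<dots> = graft_right i (prod_list (map planar_coprod ts))"
    by (simp add: lin_sum[OF lin_graft_right, symmetric] sum_listset
        planar_coprod_def[abs_def])
  finally show ?thesis .
qed

text \<open>The planar recursion read on isomorphism classes. Through it
  \<open>planar_coprod_shape\<close> shows that the representative chosen in
  \<open>coprod_tree\<close> does not matter.\<close>

primrec tree_coprod :: "'i rtree \<Rightarrow> ('i, 'k::field) tree_alg2" where
  "tree_coprod (Node i f) =
     tensor (basis {#Node i f#}) 1 + graft_right i (prod_mset (image_mset tree_coprod f))"

lemma planar_coprod_shape: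
  "(planar_coprod p :: ('i, 'k::field) tree_alg2) = tree_coprod (shape p)"
proof (induction p)
  case (PNode i ts)
  then have "map planar_coprod ts = map (tree_coprod :: _ \<Rightarrow> ('i, 'k) tree_alg2) (map shape ts)"
    by simp
  then have "prod_list (map planar_coprod ts :: ('i, 'k) tree_alg2 list) =
      prod_mset (image_mset tree_coprod (mset (map shape ts)))"
    by (metis mset_map prod_mset_prod_list)
  then show ?case
    by (simp only: planar_coprod_PNode shape.simps tree_coprod.simps)
qed

lemma coprod_tree_eq: "coprod_tree t = tree_coprod t"
proof -
  have "coprod_tree t = planar_coprod (SOME p. shape p = t)"
    by (simp only: coprod_tree_def planar_coprod_eq someI_ex[OF shape_surj])
  then show ?thesis
    by (simp only: planar_coprod_shape someI_ex[OF shape_surj])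
qed

lemma alg_hom_coprod: "alg_hom coprod"
  unfolding coprod_def by (rule alg_hom_linear_extension) simp_all

lemma coprod_Node:
  "coprod (basis {#Node i f#}) = tensor (basis {#Node i f#}) 1 + graft_right i (coprod (basis f))"
  by (simp add: coprod_def coprod_tree_eq cong: image_mset_cong)

lemma coprod_graft: "coprod (graft i x) = tensor (graft i x) 1 + graft_right i (coprod x)"
  by (rule lin_eqI[of "\<lambda>x. coprod (graft i x)" "\<lambda>x. tensor (graft i x) 1 + graft_right i (coprod x)"])
    (simp_all only: lin_comp[OF alg_hom_lin[OF alg_hom_coprod] lin_graft] graft_basis coprod_Node
      lin_plus[OF lin_comp[OF lin_tensor_left lin_graft]
        lin_comp[OF lin_graft_right alg_hom_lin[OF alg_hom_coprod]]])

section \<open>The antipode\<close>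

definition multiply :: "('i, 'k::field) tree_alg2 \<Rightarrow> ('i, 'k) tree_alg" where
  "multiply = linear_extension (\<lambda>(f, g). basis (f + g))"

text \<open>For the empty forest \<open>h\<close> this is the map
  \<open>id \<otimes> \<epsilon>\<close>.\<close>

definition right_coeff :: "'i forest \<Rightarrow> ('i, 'k::field) tree_alg2 \<Rightarrow> ('i, 'k) tree_alg" where
  "right_coeff h = linear_extension (\<lambda>(f, g). if g = h then basis f else 0)"

lemma alg_hom_multiply: "alg_hom multiply"
  unfolding multiply_def
  by (rule alg_hom_linear_extension)
    (auto simp: basis_mult zero_prod_def basis_empty ac_simps split: prod.splits)

lemma lin_multiply: "lin multiply"
  by (rule alg_hom_lin[OF alg_hom_multiply])

lemma multiply_tensor [simp]: "multiply (tensor x y) = x * y"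
  by (rule bilinear_eqI[of "\<lambda>x y. multiply (tensor x y)" "(*)"])
    (simp_all only: lin_comp[OF lin_multiply lin_tensor_left] lin_comp[OF lin_multiply lin_tensor_right]
      lin_mult_left lin_mult_right tensor_basis,
     simp add: multiply_def basis_mult)

lemma lin_right_coeff: "lin (right_coeff h)"
  unfolding right_coeff_def by (rule lin_linear_extension)

lemma right_coeff_basis: "right_coeff h (basis (f, g)) = (if g = h then basis f else 0)"
  by (simp add: right_coeff_def)

lemma right_coeff_tensor: "right_coeff h (tensor x y) = scale (Poly_Mapping.lookup y h) x"
proof (rule lin_eqI[of "\<lambda>x. right_coeff h (tensor x y)" "scale (Poly_Mapping.lookup y h)"])
  show "right_coeff h (tensor (basis f) y) = scale (Poly_Mapping.lookup y h) (basis f)" for f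
    by (rule lin_eqI[of "\<lambda>y. right_coeff h (tensor (basis f) y)" "\<lambda>y. scale (Poly_Mapping.lookup y h) (basis f)"])
      (simp_all add: lin_comp[OF lin_right_coeff lin_tensor_right] right_coeff_basis lookup_basis
        linI lookup_add scale.scale_left_distrib)
qed (simp_all only: lin_comp[OF lin_right_coeff lin_tensor_left],
     simp add: linI scale.scale_right_distrib ac_simps)

lemma right_coeff_empty_tensor: "right_coeff {#} (tensor x y) = scale (counit y) x"
  by (simp add: right_coeff_tensor counit_def)

lemma alg_hom_right_coeff_empty: "alg_hom (right_coeff {#})"
  unfolding right_coeff_def
  by (rule alg_hom_linear_extension)
    (auto simp: basis_mult zero_prod_def basis_empty split: prod.splits)

lemma graft_right_tensor: "graft_right i (tensor x y) = tensor x (graft i y)"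
  by (rule bilinear_eqI[of "\<lambda>x y. graft_right i (tensor x y)" "\<lambda>x y. tensor x (graft i y)"])
    (simp_all only: lin_comp[OF lin_graft_right lin_tensor_left] lin_comp[OF lin_graft_right lin_tensor_right]
      lin_tensor_left lin_comp[OF lin_tensor_right lin_graft] tensor_basis graft_basis graft_right_basis)

lemma tensor_one_mult_graft_right: "tensor x 1 * graft_right i z = graft_right i (tensor x 1 * z)"
proof (rule bilinear_eqI[of "\<lambda>x z. tensor x 1 * graft_right i z" "\<lambda>x z. graft_right i (tensor x 1 * z)"])
  show "tensor (basis f) 1 * graft_right i (basis p) = graft_right i (tensor (basis f) 1 * basis p)" for f p
    by (cases p) (simp add: basis_mult)
qed (simp_all only: lin_comp[OF lin_mult_left lin_tensor_left] lin_comp[OF lin_mult_right lin_graft_right]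
      lin_comp[OF lin_graft_right lin_comp[OF lin_mult_left lin_tensor_left]]
      lin_comp[OF lin_graft_right lin_mult_right])

lemma right_coeff_graft_right_empty: "right_coeff {#} (graft_right i z) = 0"
proof (rule lin_eqI[of "\<lambda>z. right_coeff {#} (graft_right i z)" "\<lambda>z. 0"])
  show "right_coeff {#} (graft_right i (basis p)) = 0" for p
    by (cases p) (simp add: right_coeff_basis)
qed (simp_all add: lin_comp[OF lin_right_coeff lin_graft_right] linI)

text \<open>
  With \<open>Q = (S \<otimes> id) \<circ> \<Delta>\<close> the equation \<open>S * id = \<eta> \<circ> \<epsilon>\<close> says that \<^const>\<open>multiply\<close> kills
  \<open>Q t\<close>; together with the cocycle property this determines \<open>Q\<close> by structural recursion.
\<close>

primrec antipode_left :: "'i rtree \<Rightarrow> ('i, 'k::field) tree_alg2" where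
  "antipode_left (Node i f) =
     graft_right i (prod_mset (image_mset antipode_left f)) -
     tensor (multiply (graft_right i (prod_mset (image_mset antipode_left f)))) 1"

definition antipode_left_alg :: "('i, 'k::field) tree_alg \<Rightarrow> ('i, 'k) tree_alg2" where
  "antipode_left_alg = linear_extension (\<lambda>f. prod_mset (image_mset antipode_left f))"

text \<open>Applying \<open>id \<otimes> \<epsilon>\<close> to
  \<open>Q = (S \<otimes> id) \<circ> \<Delta>\<close> returns \<open>S\<close>, by the counit
  law.\<close>

definition antipode :: "('i, 'k::field) tree_alg \<Rightarrow> ('i, 'k) tree_alg" where
  "antipode x = right_coeff {#} (antipode_left_alg x)"

lemma alg_hom_antipode_left_alg: "alg_hom antipode_left_alg"
  unfolding antipode_left_alg_def by (rule alg_hom_linear_extension) simp_all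

lemma alg_hom_antipode: "alg_hom antipode"
  unfolding antipode_def[abs_def]
  by (rule alg_hom_comp[OF alg_hom_right_coeff_empty alg_hom_antipode_left_alg])

lemma antipode_left_alg_Node:
  "antipode_left_alg (basis {#Node i f#}) = graft_right i (antipode_left_alg (basis f)) -
     tensor (multiply (graft_right i (antipode_left_alg (basis f)))) 1"
  by (simp add: antipode_left_alg_def)

lemma antipode_Node:
  "antipode (basis {#Node i f#}) = - multiply (graft_right i (antipode_left_alg (basis f)))"
  by (simp add: antipode_def antipode_left_alg_Node lin_diff[OF lin_right_coeff]
      right_coeff_graft_right_empty right_coeff_tensor lookup_basis flip: basis_empty)

lemma alg_hom_counit: "alg_hom (\<lambda>x :: ('i, 'k::field) tree_alg. scale (counit x) (1 :: ('i, 'k) tree_alg))"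
proof -
  have "(\<lambda>x :: ('i, 'k) tree_alg. scale (counit x) (1 :: ('i, 'k) tree_alg)) =
      (linear_extension (\<lambda>f. if f = {#} then 1 else 0) :: ('i, 'k) tree_alg \<Rightarrow> ('i, 'k) tree_alg)"
    by (rule ext, rule lin_eqI[of "\<lambda>x. scale (counit x) 1"])
      (simp_all add: linI counit_def lookup_add scale.scale_left_distrib lin_linear_extension lookup_basis)
  then show ?thesis
    by (simp add: alg_hom_linear_extension)
qed

text \<open>The term subtracted in \<open>antipode_left\<close> is chosen to cancel after
  multiplication, so every tree is sent to 0.\<close>

lemma multiply_antipode_left_alg: "multiply (antipode_left_alg x) = scale (counit x) 1"
proof (rule alg_hom_forest_eqI[of "\<lambda>x. multiply (antipode_left_alg x)"])
  show "multiply (antipode_left_alg (basis {#t#})) = scale (counit (basis {#t#})) 1" for t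
    by (cases t) (simp add: antipode_left_alg_Node lin_diff[OF lin_multiply] counit_def lookup_basis)
qed (rule alg_hom_comp[OF alg_hom_multiply alg_hom_antipode_left_alg] alg_hom_counit)+

definition antipode_tensor_id :: "('i, 'k::field) tree_alg2 \<Rightarrow> ('i, 'k) tree_alg2" where
  "antipode_tensor_id = linear_extension (\<lambda>(f, g). tensor (antipode (basis f)) (basis g))"

lemma alg_hom_antipode_tensor_id: "alg_hom antipode_tensor_id"
  unfolding antipode_tensor_id_def
  by (rule alg_hom_linear_extension)
    (auto simp: zero_prod_def basis_empty basis_pair_empty alg_hom_one[OF alg_hom_antipode] tensor_one_one
      tensor_mult basis_mult alg_hom_mult[OF alg_hom_antipode, symmetric] split: prod.splits)

lemma antipode_tensor_id_graft_right:
  "antipode_tensor_id (graft_right i z) = graft_right i (antipode_tensor_id z)"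
proof (rule lin_eqI[of "\<lambda>z. antipode_tensor_id (graft_right i z)" "\<lambda>z. graft_right i (antipode_tensor_id z)"])
  show "antipode_tensor_id (graft_right i (basis p)) = graft_right i (antipode_tensor_id (basis p))" for p
    by (cases p) (simp add: antipode_tensor_id_def graft_right_tensor)
qed (simp_all only: lin_comp[OF alg_hom_lin[OF alg_hom_antipode_tensor_id] lin_graft_right]
    lin_comp[OF lin_graft_right alg_hom_lin[OF alg_hom_antipode_tensor_id]])

lemma basis_forest: "basis f = prod_mset (image_mset (\<lambda>t. basis {#t#}) f)"
  using basis_sum_mset[of "\<lambda>t. {#t#}" f] by simp

lemma alg_hom_basis_forest: "alg_hom T \<Longrightarrow> T (basis f) = prod_mset (image_mset (\<lambda>t. T (basis {#t#})) f)"
  by (simp add: basis_forest[of f] alg_hom_prod_mset[of T] image_mset.compositionality o_def)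

lemma alg_hom_forest_cong:
  assumes "alg_hom S" "alg_hom T" "\<And>t. t \<in># f \<Longrightarrow> S (basis {#t#}) = T (basis {#t#})"
  shows "S (basis f) = T (basis f)"
  unfolding alg_hom_basis_forest[OF assms(1), of f] alg_hom_basis_forest[OF assms(2), of f]
  by (intro arg_cong[of _ _ prod_mset] image_mset_cong) (rule assms(3))

text \<open>Justifies the reading of \<open>Q\<close>: the term \<open>t \<otimes> 1\<close> of
  \<open>\<Delta>(t)\<close> becomes \<open>S(t) \<otimes> 1\<close>, exactly the correction term of
  \<open>antipode_left\<close>, while \<open>S \<otimes> id\<close> commutes with grafting on the
  right.\<close>

lemma antipode_tensor_id_coprod:
  fixes x :: "('a, 'b::field) tree_alg"
  shows "antipode_tensor_id (coprod x) = antipode_left_alg x"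
proof -
  note hom = alg_hom_comp[OF alg_hom_antipode_tensor_id alg_hom_coprod]
  have "antipode_tensor_id (coprod (basis {#t#})) = (antipode_left_alg (basis {#t#}) :: ('a, 'b) tree_alg2)"
    for t
  proof (induction t)
    case (Node i f)
    have "antipode_tensor_id (coprod (basis f)) = (antipode_left_alg (basis f) :: ('a, 'b) tree_alg2)"
      by (rule alg_hom_forest_cong[OF hom alg_hom_antipode_left_alg]) (rule Node.IH)
    moreover have "antipode_tensor_id (tensor (basis {#Node i f#}) 1) =
        - tensor (multiply (graft_right i (antipode_left_alg (basis f)))) (1 :: ('a, 'b) tree_alg)"
      by (simp add: antipode_tensor_id_def antipode_Node basis_empty lin_uminus[OF lin_tensor_left])
    ultimately show ?case
      by (simp only: coprod_Node lin_add[OF alg_hom_lin[OF alg_hom_antipode_tensor_id]]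
          antipode_tensor_id_graft_right antipode_left_alg_Node uminus_add_conv_diff)
  qed
  then show ?thesis
    by (rule alg_hom_forest_eqI[OF hom alg_hom_antipode_left_alg])
qed

text \<open>On \<open>\<Delta>(x)\<close> this yields, in Sweedler notation,
  \<open>x' S(x'') \<otimes> x'''\<close>. Showing that it equals \<open>1 \<otimes> x\<close> gives
  the second antipode equation without a proof of coassociativity.\<close>

definition id_tensor_antipode_left :: "('i, 'k::field) tree_alg2 \<Rightarrow> ('i, 'k) tree_alg2" where
  "id_tensor_antipode_left =
     linear_extension (\<lambda>(f, g). tensor (basis f) 1 * antipode_left_alg (basis g))"

lemma alg_hom_id_tensor_antipode_left: "alg_hom id_tensor_antipode_left"
  unfolding id_tensor_antipode_left_def
proof (rule alg_hom_linear_extension, goal_cases)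
  case 1
  show ?case
    by (simp add: zero_prod_def basis_empty basis_pair_empty tensor_one_one alg_hom_one[OF alg_hom_antipode_left_alg])
next
  case (2 p q)
  obtain f g f' g' where pq: "p = (f, g)" "q = (f', g')" by (cases p, cases q)
  have "tensor (basis (f + f')) 1 = tensor (basis f) 1 * (tensor (basis f') 1 :: ('a, 'b) tree_alg2)"
    by (simp only: tensor_mult basis_mult mult_1)
  moreover have "antipode_left_alg (basis (g + g')) =
      antipode_left_alg (basis g) * (antipode_left_alg (basis g') :: ('a, 'b) tree_alg2)"
    by (simp only: alg_hom_mult[OF alg_hom_antipode_left_alg, symmetric] basis_mult)
  ultimately show ?case
    by (simp add: pq ac_simps)
qed

lemma id_tensor_antipode_left_graft_right:
  fixes z :: "('a, 'b::field) tree_alg2"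
  shows "id_tensor_antipode_left (graft_right i z) = graft_right i (id_tensor_antipode_left z) -
     tensor (multiply (graft_right i (id_tensor_antipode_left z))) 1"
proof (rule lin_eqI[of "\<lambda>z. id_tensor_antipode_left (graft_right i z)"
    "\<lambda>z. graft_right i (id_tensor_antipode_left z) -
      tensor (multiply (graft_right i (id_tensor_antipode_left z))) 1"])
  fix p :: "'a forest \<times> 'a forest"
  obtain f g where p: "p = (f, g)" by (cases p)
  let ?u = "tensor (basis f) 1 :: ('a, 'b) tree_alg2"
  let ?w = "antipode_left_alg (basis g) :: ('a, 'b) tree_alg2"
  have 1: "id_tensor_antipode_left (basis p) = ?u * ?w"
    by (simp add: id_tensor_antipode_left_def p)
  have "id_tensor_antipode_left (graft_right i (basis p)) = ?u * antipode_left_alg (basis {#Node i g#})"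
    by (simp add: id_tensor_antipode_left_def p)
  also have "\<dots> = graft_right i (?u * ?w) - tensor (basis f * multiply (graft_right i ?w)) 1"
    by (simp only: antipode_left_alg_Node right_diff_distrib tensor_one_mult_graft_right tensor_mult mult_1)
  also have "basis f * multiply (graft_right i ?w) = multiply (?u * graft_right i ?w)"
    by (simp only: alg_hom_mult[OF alg_hom_multiply] multiply_tensor mult_1_right)
  finally show "id_tensor_antipode_left (graft_right i (basis p)) =
      graft_right i (id_tensor_antipode_left (basis p :: ('a, 'b) tree_alg2)) -
      tensor (multiply (graft_right i (id_tensor_antipode_left (basis p)))) 1"
    unfolding 1 tensor_one_mult_graft_right .
next
  note l = alg_hom_lin[OF alg_hom_id_tensor_antipode_left]
  show "lin (\<lambda>z. id_tensor_antipode_left (graft_right i z))"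
    by (rule lin_comp[OF l lin_graft_right])
  show "lin (\<lambda>z. graft_right i (id_tensor_antipode_left z) -
      tensor (multiply (graft_right i (id_tensor_antipode_left z))) 1)"
    by (rule lin_minus[OF lin_comp[OF lin_graft_right l]
          lin_comp[OF lin_tensor_left lin_comp[OF lin_multiply lin_comp[OF lin_graft_right l]]]])
qed

lemma alg_hom_tensor_one_left: "alg_hom (\<lambda>x. tensor 1 x)"
  by (simp add: alg_hom_def lin_tensor_right tensor_one_one tensor_mult)

text \<open>In the induction the branches contribute \<open>1 \<otimes> f\<close>; grafting turns
  this into \<open>1 \<otimes> t - t \<otimes> 1\<close>, and the second term cancels against the
  term \<open>t \<otimes> 1\<close> of \<open>\<Delta>(t)\<close>.\<close>

lemma id_tensor_antipode_left_coprod: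
  fixes x :: "('a, 'b::field) tree_alg"
  shows "id_tensor_antipode_left (coprod x) = tensor 1 x"
proof -
  note hom = alg_hom_comp[OF alg_hom_id_tensor_antipode_left alg_hom_coprod]
  have "id_tensor_antipode_left (coprod (basis {#t#})) = (tensor 1 (basis {#t#}) :: ('a, 'b) tree_alg2)"
    for t
  proof (induction t)
    case (Node i f)
    have "id_tensor_antipode_left (coprod (basis f)) = (tensor 1 (basis f) :: ('a, 'b) tree_alg2)"
      by (rule alg_hom_forest_cong[OF hom alg_hom_tensor_one_left]) (rule Node.IH)
    moreover have "id_tensor_antipode_left (tensor (basis {#Node i f#}) 1) =
        tensor (basis {#Node i f#}) (1 :: ('a, 'b) tree_alg)"
      by (simp add: id_tensor_antipode_left_def basis_empty alg_hom_one[OF alg_hom_antipode_left_alg])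
    ultimately show ?case
      by (simp only: coprod_Node lin_add[OF alg_hom_lin[OF alg_hom_id_tensor_antipode_left]]
          id_tensor_antipode_left_graft_right graft_right_tensor graft_basis multiply_tensor mult_1
          add_diff_cancel_left' add_diff_eq)
  qed
  then show ?thesis
    by (rule alg_hom_forest_eqI[OF hom alg_hom_tensor_one_left])
qed

lemma convolution_antipode_id:
  fixes x :: "('a, 'b::field) tree_alg"
  shows "convolution antipode id x = scale (counit x) 1"
proof -
  have "linear_extension (\<lambda>(f, g). antipode (basis f) * basis g) z = multiply (antipode_tensor_id z)" for z :: "('a, 'b) tree_alg2"
  proof (rule lin_eqI[of _ "\<lambda>z. multiply (antipode_tensor_id z)"])
    show "linear_extension (\<lambda>(f, g). antipode (basis f) * basis g) (basis p) =
        multiply (antipode_tensor_id (basis p))" for p :: "'a forest \<times> 'a forest"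
      by (cases p) (simp add: antipode_tensor_id_def)
  qed (rule lin_linear_extension lin_comp[OF lin_multiply alg_hom_lin[OF alg_hom_antipode_tensor_id]])+
  then show ?thesis
    by (simp add: convolution_def antipode_tensor_id_coprod multiply_antipode_left_alg)
qed

lemma convolution_id_antipode:
  fixes x :: "('a, 'b::field) tree_alg"
  shows "convolution id antipode x = scale (counit x) 1"
proof -
  have "linear_extension (\<lambda>(f, g). basis f * antipode (basis g)) z =
      right_coeff {#} (id_tensor_antipode_left z)" for z :: "('a, 'b) tree_alg2"
  proof (rule lin_eqI[of _ "\<lambda>z. right_coeff {#} (id_tensor_antipode_left z)"])
    show "linear_extension (\<lambda>(f, g). basis f * antipode (basis g)) (basis p) =
        right_coeff {#} (id_tensor_antipode_left (basis p))" for p :: "'a forest \<times> 'a forest"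
      by (cases p) (simp add: id_tensor_antipode_left_def antipode_def right_coeff_basis
          alg_hom_mult[OF alg_hom_right_coeff_empty])
  qed (rule lin_linear_extension
      lin_comp[OF lin_right_coeff alg_hom_lin[OF alg_hom_id_tensor_antipode_left]])+
  then show ?thesis
    by (simp add: convolution_def id_tensor_antipode_left_coprod right_coeff_empty_tensor)
qed

lemma is_antipode_antipode: "is_antipode antipode"
  by (simp add: is_antipode_def convolution_antipode_id convolution_id_antipode
      alg_hom_lin[OF alg_hom_antipode])

section \<open>Substitution into formal power series\<close>

definition map_fps :: "('a \<Rightarrow> 'b) \<Rightarrow> 'a fps \<Rightarrow> 'b fps" where
  "map_fps T x = Abs_fps (\<lambda>n. T (fps_nth x n))"

lemma map_fps_nth [simp]: "fps_nth (map_fps T x) n = T (fps_nth x n)"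
  by (simp add: map_fps_def)

lemma map_fps_mult:
  assumes "alg_hom T"
  shows "map_fps T (x * y) = map_fps T x * map_fps T y"
  by (rule fps_ext)
    (simp add: fps_mult_nth lin_sum[OF alg_hom_lin[OF assms]] alg_hom_mult[OF assms])

lemma map_fps_one: "alg_hom T \<Longrightarrow> map_fps T 1 = 1"
  by (rule fps_ext) (simp add: alg_hom_one[of T] lin_zero[OF alg_hom_lin[of T]])

lemma map_fps_prod_mset:
  "alg_hom T \<Longrightarrow> map_fps T (prod_mset (image_mset x P)) = prod_mset (image_mset (\<lambda>d. map_fps T (x d)) P)"
  by (induction P) (simp_all add: map_fps_one[of T] map_fps_mult[of T])

text \<open>Multi-indices are encoded as multisets of variables.\<close>

definition monomial :: "('i \<Rightarrow> 'a::comm_semiring_1 fps) \<Rightarrow> 'i multiset \<Rightarrow> 'a fps" where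
  "monomial x P = prod_mset (image_mset x P)"

text \<open>The cut-off \<open>size P \<le> n\<close> makes each component a finite sum. It loses
  nothing when the \<open>x d\<close> have no constant term, since a monomial then starts in degree
  \<open>size P\<close>.\<close>

definition msubst ::
  "('i::finite multiset \<Rightarrow> 'k::field) \<Rightarrow> ('i \<Rightarrow> ('a::cancel_comm_monoid_add \<Rightarrow>\<^sub>0 'k) fps) \<Rightarrow> ('a \<Rightarrow>\<^sub>0 'k) fps"
  where "msubst F x = Abs_fps (\<lambda>n. \<Sum>P | size P \<le> n. scale (F P) (fps_nth (monomial x P) n))"

lemma monomial_empty [simp]: "monomial x {#} = 1"
  and monomial_add_mset [simp]: "monomial x (add_mset d P) = x d * monomial x P"
  and monomial_union: "monomial x (P + Q) = monomial x P * monomial x Q"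
  by (simp_all add: monomial_def)

lemma finite_size_le: "finite {P :: 'i::finite multiset. size P \<le> n}"
proof (rule finite_subset)
  show "{P :: 'i multiset. size P \<le> n} \<subseteq> mset ` {xs. set xs \<subseteq> UNIV \<and> length xs \<le> n}"
  proof
    fix P :: "'i multiset" assume "P \<in> {P. size P \<le> n}"
    moreover obtain xs where "mset xs = P" using ex_mset by blast
    ultimately show "P \<in> mset ` {xs. set xs \<subseteq> UNIV \<and> length xs \<le> n}" by auto
  qed
  show "finite (mset ` {xs :: 'i list. set xs \<subseteq> UNIV \<and> length xs \<le> n})"
    by (intro finite_imageI finite_lists_length_le) simp
qed

lemma monomial_nth_less:
  assumes "\<And>d. fps_nth (x d) 0 = 0" "n < size P"
  shows "fps_nth (monomial x P) n = 0"
  using assms(2)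
proof (induction P arbitrary: n)
  case (add d P)
  have "fps_nth (x d) i * fps_nth (monomial x P) (n - i) = 0" if "i \<le> n" for i
    using add that assms(1) by (cases "i = 0") auto
  then show ?case by (simp add: fps_mult_nth)
qed simp

text \<open>A larger range of summation lets components of different degrees share one index set, as
  needed for products.\<close>

lemma msubst_nth:
  assumes "\<And>d. fps_nth (x d) 0 = 0" "n \<le> N"
  shows "fps_nth (msubst F x) n = (\<Sum>P | size P \<le> N. scale (F P) (fps_nth (monomial x P) n))"
proof -
  have "(\<Sum>P | size P \<le> n. scale (F P) (fps_nth (monomial x P) n)) =
      (\<Sum>P | size P \<le> N. scale (F P) (fps_nth (monomial x P) n))"
    by (rule sum.mono_neutral_left)
      (use assms in \<open>auto simp: finite_size_le monomial_nth_less\<close>)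
  then show ?thesis by (simp add: msubst_def)
qed

lemma monomial_nth_cong:
  assumes "\<And>d k. k \<le> n \<Longrightarrow> fps_nth (x d) k = fps_nth (y d) k"
  shows "k \<le> n \<Longrightarrow> fps_nth (monomial x P) k = fps_nth (monomial y P) k"
proof (induction P arbitrary: k)
  case (add d P)
  then show ?case
    using assms by (auto simp: fps_mult_nth intro!: sum.cong)
qed simp

lemma msubst_nth_cong:
  assumes "\<And>d k. k \<le> n \<Longrightarrow> fps_nth (x d) k = fps_nth (y d) k"
  shows "fps_nth (msubst F x) n = fps_nth (msubst F y) n"
  using monomial_nth_cong[of n x y, OF assms] by (simp add: msubst_def)

lemma map_fps_monomial: "alg_hom T \<Longrightarrow> map_fps T (monomial x P) = monomial (\<lambda>d. map_fps T (x d)) P"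
  by (simp add: monomial_def map_fps_prod_mset[of T])

lemma map_fps_msubst:
  assumes "alg_hom T"
  shows "map_fps T (msubst F x) = msubst F (\<lambda>d. map_fps T (x d))"
  by (rule fps_ext)
    (simp add: msubst_def lin_sum[OF alg_hom_lin[OF assms]] lin_scale[OF alg_hom_lin[OF assms]]
      flip: map_fps_monomial[OF assms])

lemma substitute_eq_msubst:
  assumes "\<And>d. fps_nth (x d) 0 = 0"
  shows "substitute F x = msubst (\<lambda>P. F (count P)) x"
proof (rule fps_ext)
  fix n
  let ?g = "\<lambda>p. scale (F p) (fps_nth (\<Prod>j\<in>UNIV. x j ^ p j) n)"
  have mon: "(\<Prod>j\<in>UNIV. x j ^ count P j) = monomial x P" for P
  proof -
    have "monomial x P = (\<Prod>j\<in>set_mset P. x j ^ count P j)"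
      by (simp add: monomial_def image_prod_mset_multiplicity)
    also have "\<dots> = (\<Prod>j\<in>UNIV. x j ^ count P j)"
      by (rule prod.mono_neutral_left) (auto simp: not_in_iff)
    finally show ?thesis by simp
  qed
  have "p \<in> count ` {P. size P \<le> n}" if "?g p \<noteq> 0" for p
  proof -
    \<comment> \<open>Over a finite type every exponent function is the count of a multiset.\<close>
    have p: "count (Abs_multiset p) = p" by simp
    then have "\<not> n < size (Abs_multiset p)"
      using that mon[of "Abs_multiset p"] monomial_nth_less[OF assms, of n "Abs_multiset p"] by auto
    then show ?thesis using p by (intro image_eqI[of _ _ "Abs_multiset p"]) auto
  qed
  then have "Sum_any ?g = sum ?g (count ` {P. size P \<le> n})"
    by (intro Sum_any.expand_superset) (auto simp: finite_size_le)
  also have "\<dots> = (\<Sum>P | size P \<le> n. ?g (count P))"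
    by (subst sum.reindex) (auto simp: inj_on_def multiset_eq_iff)
  finally show "fps_nth (substitute F x) n = fps_nth (msubst (\<lambda>P. F (count P)) x) n"
    by (simp add: substitute_def msubst_def mon)
qed

section \<open>The solution of the system\<close>

definition homogeneous :: "nat \<Rightarrow> ('i, 'k::field) tree_alg \<Rightarrow> bool" where
  "homogeneous n x \<longleftrightarrow> (\<forall>f\<in>Poly_Mapping.keys x. degree f = n)"

lemma completion_iff: "x \<in> completion \<longleftrightarrow> (\<forall>n. homogeneous n (fps_nth x n))"
  by (simp add: completion_def homogeneous_def)

lemma homogeneous_iff: "homogeneous n x \<longleftrightarrow> (\<forall>f. Poly_Mapping.lookup x f \<noteq> 0 \<longrightarrow> degree f = n)"
  by (auto simp: homogeneous_def in_keys_iff)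

lemma homogeneous_zero: "homogeneous n 0"
  by (simp add: homogeneous_def)

lemma homogeneous_scale: "homogeneous n x \<Longrightarrow> homogeneous n (scale c x)"
  by (simp add: homogeneous_iff)

lemma homogeneous_sum: "(\<And>a. a \<in> A \<Longrightarrow> homogeneous n (f a)) \<Longrightarrow> homogeneous n (sum f A)"
  unfolding homogeneous_iff lookup_sum by (fastforce intro: sum.neutral)

lemma homogeneous_mult: "homogeneous m x \<Longrightarrow> homogeneous n y \<Longrightarrow> homogeneous (m + n) (x * y)"
  using keys_mult[of x y] by (fastforce simp: homogeneous_def degree_def)

lemma completion_mult: "x \<in> completion \<Longrightarrow> y \<in> completion \<Longrightarrow> x * y \<in> completion"
  unfolding completion_iff fps_mult_nth
proof (intro allI homogeneous_sum)
  fix n k :: nat assume "\<forall>n. homogeneous n (fps_nth x n)" "\<forall>n. homogeneous n (fps_nth y n)" "k \<in> {0..n}"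
  then show "homogeneous n (fps_nth x k * fps_nth y (n - k))"
    using homogeneous_mult[of k "fps_nth x k" "n - k" "fps_nth y (n - k)"] by simp
qed

lemma completion_one: "1 \<in> completion"
  by (auto simp: completion_iff homogeneous_iff lookup_one degree_def)

lemma completion_msubst:
  assumes "\<And>d. x d \<in> completion"
  shows "msubst F x \<in> completion"
proof -
  have "monomial x P \<in> completion" for P
    by (induction P) (simp_all add: completion_one completion_mult assms)
  then show ?thesis
    by (auto simp: completion_iff msubst_def intro!: homogeneous_sum homogeneous_scale)
qed

lemma homogeneous_graft:
  assumes "homogeneous n x"
  shows "homogeneous (Suc n) (graft i x)"
  unfolding graft_def linear_extension_def
proof (intro homogeneous_sum homogeneous_scale)
  fix f assume "f \<in> Poly_Mapping.keys x"
  then have "degree f = n" using assms by (simp add: homogeneous_def)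
  then show "homogeneous (Suc n) (basis {#Node i f#} :: ('a, 'b) tree_alg)"
    by (auto simp: homogeneous_iff lookup_basis degree_def)
qed

lemma completion_graft: "x \<in> completion \<Longrightarrow> graft_completion i x \<in> completion"
  by (auto simp: completion_iff graft_completion_def homogeneous_zero homogeneous_graft split: nat.split)

lemma graft_completion_nth [simp]:
  "fps_nth (graft_completion i x) 0 = 0"
  "fps_nth (graft_completion i x) (Suc n) = graft i (fps_nth x n)"
  by (simp_all add: graft_completion_def)

text \<open>
  The solution is the limit of the iterates of the right-hand side, whose components of
  degree \<open>n\<close> are constant from the \<open>n\<close>-th iterate on.
\<close>

primrec iterate ::
  "('i::finite \<Rightarrow> 'i multiset \<Rightarrow> 'k::field) \<Rightarrow> nat \<Rightarrow> 'i \<Rightarrow> ('i, 'k) tree_alg fps" where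
  "iterate F 0 = (\<lambda>_. 0)"
| "iterate F (Suc k) = (\<lambda>i. graft_completion i (msubst (F i) (iterate F k)))"

text \<open>Grafting raises degrees by one, so arguments that agree through degree \<open>k\<close>
  have images that agree through degree \<open>Suc k\<close>.\<close>

lemma iterate_stable: "n \<le> k \<Longrightarrow> fps_nth (iterate F (Suc k) i) n = fps_nth (iterate F k i) n"
proof (induction k arbitrary: i n)
  case (Suc k)
  show ?case
  proof (cases n)
    case (Suc m)
    have "fps_nth (msubst (F i) (iterate F (Suc k))) m = fps_nth (msubst (F i) (iterate F k)) m"
      by (rule msubst_nth_cong) (use Suc.IH Suc.prems Suc in auto)
    then show ?thesis by (simp add: Suc)
  qed simp
qed simp

lemma iterate_limit: "n \<le> k \<Longrightarrow> fps_nth (iterate F k i) n = fps_nth (iterate F n i) n"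
  by (induction k rule: dec_induct) (simp_all add: iterate_stable del: iterate.simps)

lemma sdse_solution_exists: "\<exists>x. is_sdse_solution a x"
proof -
  let ?F = "\<lambda>i P. a i (count P)"
  define x where "x i = Abs_fps (\<lambda>n. fps_nth (iterate ?F n i) n)" for i
  have x0: "fps_nth (x d) 0 = 0" for d by (simp add: x_def)
  have "iterate ?F k i \<in> completion" for k i
  proof (induction k arbitrary: i)
    case 0
    show ?case by (simp add: completion_iff homogeneous_zero)
  next
    case (Suc k)
    then show ?case by (simp add: completion_graft completion_msubst)
  qed
  then have "x i \<in> completion" for i
    by (simp add: completion_iff x_def)
  moreover have "x i = graft_completion i (substitute (a i) x)" for i
  proof (rule fps_ext)
    fix n
    show "fps_nth (x i) n = fps_nth (graft_completion i (substitute (a i) x)) n"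
    proof (cases n)
      case (Suc m)
      have "fps_nth (msubst (?F i) (iterate ?F m)) m = fps_nth (msubst (?F i) x) m"
        by (rule msubst_nth_cong) (simp add: x_def iterate_limit[of _ m])
      then show ?thesis by (simp add: Suc x_def[of i] substitute_eq_msubst[OF x0])
    qed (simp add: x0)
  qed
  ultimately show ?thesis unfolding is_sdse_solution_def by blast
qed

lemma is_sdse_solution_nth:
  assumes "is_sdse_solution a x"
  shows "fps_nth (x i) 0 = 0"
    and "fps_nth (x i) (Suc n) = graft i (fps_nth (msubst (\<lambda>P. a i (count P)) x) n)"
proof -
  have x: "x i = graft_completion i (substitute (a i) x)" for i
    using assms by (simp add: is_sdse_solution_def)
  show 0: "fps_nth (x i) 0 = 0" for i by (subst x) simp
  show "fps_nth (x i) (Suc n) = graft i (fps_nth (msubst (\<lambda>P. a i (count P)) x) n)"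
    by (subst x) (simp add: substitute_eq_msubst[OF 0])
qed

lemma sdse_solution_unique:
  assumes "is_sdse_solution a x" "is_sdse_solution a y"
  shows "x = y"
proof -
  have "fps_nth (x i) n = fps_nth (y i) n" for i n
  proof (induction n arbitrary: i rule: less_induct)
    case (less n)
    show ?case
    proof (cases n)
      case 0
      then show ?thesis by (simp add: is_sdse_solution_nth[OF assms(1)] is_sdse_solution_nth[OF assms(2)])
    next
      case (Suc m)
      have "fps_nth (msubst (\<lambda>P. a i (count P)) x) m = fps_nth (msubst (\<lambda>P. a i (count P)) y) m"
        by (rule msubst_nth_cong) (use less Suc in auto)
      then show ?thesis
        by (simp add: Suc is_sdse_solution_nth[OF assms(1)] is_sdse_solution_nth[OF assms(2)])
    qed
  qed
  then show ?thesis by (auto simp: fps_eq_iff)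
qed

lemma is_sdse_solution_sdse_solution: "is_sdse_solution a (sdse_solution a)"
proof -
  obtain x where "is_sdse_solution a x" using sdse_solution_exists by blast
  then show ?thesis
    unfolding sdse_solution_def
    by (rule theI[of "is_sdse_solution a"]) (rule sdse_solution_unique[OF _ \<open>is_sdse_solution a x\<close>])
qed

section \<open>Right coefficients of the coproduct of a solution\<close>

text \<open>With this exponential normalisation a partial derivative of the series is just a shift
  of the multi-index.\<close>

definition exp_subst ::
  "('i::finite multiset \<Rightarrow> 'k::field_char_0) \<Rightarrow> ('i \<Rightarrow> ('a::cancel_comm_monoid_add \<Rightarrow>\<^sub>0 'k) fps) \<Rightarrow> ('a \<Rightarrow>\<^sub>0 'k) fps"
  where "exp_subst b x = msubst (\<lambda>P. b P / (\<Prod>d\<in>UNIV. fact (count P d))) x"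

lemma prod_fact_add_mset:
  "(\<Prod>d\<in>UNIV. fact (count (add_mset e P) d)) =
     (of_nat (Suc (count P e)) * (\<Prod>d\<in>UNIV. fact (count P d)) :: 'k::field_char_0)"
  for P :: "'i::finite multiset"
proof -
  have "(\<Prod>d\<in>UNIV. fact (count (add_mset e P) d)) =
      (\<Prod>d\<in>UNIV. (if d = e then of_nat (Suc (count P e)) else 1) * (fact (count P d) :: 'k))"
    by (intro prod.cong) auto
  then show ?thesis
    by (simp add: prod.distrib prod.delta)
qed

lemma of_nat_mult_eq_scale: "of_nat n * x = scale (of_nat n) x"
  for x :: "'a::cancel_comm_monoid_add \<Rightarrow>\<^sub>0 'k::field"
  by (induction n) (simp_all add: scale.scale_left_distrib distrib_right)

text \<open>The derivation \<open>id \<otimes> \<partial>/\<partial>s\<close>, with the trees as the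
  variables of the polynomial algebra.\<close>

definition right_deriv :: "'i rtree \<Rightarrow> ('i, 'k::field) tree_alg2 \<Rightarrow> ('i, 'k) tree_alg2" where
  "right_deriv s = linear_extension (\<lambda>(f, g). scale (of_nat (count g s)) (basis (f, g - {#s#})))"

lemma lin_right_deriv: "lin (right_deriv s)"
  unfolding right_deriv_def by (rule lin_linear_extension)

lemma right_deriv_basis: "right_deriv s (basis (f, g)) = scale (of_nat (count g s)) (basis (f, g - {#s#}))"
  by (simp add: right_deriv_def)

lemma right_deriv_mult: "right_deriv s (x * y) = right_deriv s x * y + x * right_deriv s y"
proof (rule bilinear_eqI[of "\<lambda>x y. right_deriv s (x * y)" "\<lambda>x y. right_deriv s x * y + x * right_deriv s y"])
  fix p q :: "'a forest \<times> 'a forest"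
  obtain f g f' g' where pq: "p = (f, g)" "q = (f', g')" by (cases p, cases q)
  \<comment> \<open>If \<open>s\<close> does not occur in \<open>h\<close>, the scalar is 0, so the
    truncated difference of multisets does no harm.\<close>
  have 1: "scale (of_nat (count h s)) (basis (f + f', h + h' - {#s#})) =
      scale (of_nat (count h s)) (basis (f + f', h - {#s#} + h') :: ('a, 'b) tree_alg2)" for h h' :: "'a forest"
    by (cases "s \<in># h") (auto simp: not_in_iff)
  have "right_deriv s (basis p * basis q) =
      (scale (of_nat (count g s)) (basis (f + f', g + g' - {#s#})) +
       scale (of_nat (count g' s)) (basis (f + f', g' + g - {#s#})) :: ('a, 'b) tree_alg2)"
    by (simp add: pq basis_mult right_deriv_basis scale.scale_left_distrib add.commute)
  then show "right_deriv s (basis p * basis q :: ('a, 'b) tree_alg2) =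
      right_deriv s (basis p) * basis q + basis p * right_deriv s (basis q)"
    unfolding 1 by (simp add: pq right_deriv_basis scale_mult_left scale_mult_right basis_mult add.commute)
qed (simp_all only: lin_comp[OF lin_right_deriv lin_mult_left] lin_comp[OF lin_right_deriv lin_mult_right]
    lin_plus[OF lin_comp[OF lin_mult_left lin_right_deriv] lin_mult_left]
    lin_plus[OF lin_mult_right lin_comp[OF lin_mult_right lin_right_deriv]])

lemma right_coeff_right_deriv:
  "right_coeff g (right_deriv s z) = scale (of_nat (Suc (count g s))) (right_coeff (add_mset s g) z)"
proof (rule lin_eqI[of "\<lambda>z. right_coeff g (right_deriv s z)"
    "\<lambda>z. scale (of_nat (Suc (count g s))) (right_coeff (add_mset s g) z)"])
  fix p :: "'a forest \<times> 'a forest"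
  obtain f h where p: "p = (f, h)" by (cases p)
  show "right_coeff g (right_deriv s (basis p)) =
      scale (of_nat (Suc (count g s))) (right_coeff (add_mset s g) (basis p :: ('a, 'b) tree_alg2))"
    by (cases "s \<in># h") (auto simp: p right_deriv_basis lin_zero[OF lin_right_coeff] lin_scale[OF lin_right_coeff]
        right_coeff_basis not_in_iff dest!: multi_member_split)
next
  show "lin (\<lambda>z. right_coeff g (right_deriv s z))"
    by (rule lin_comp[OF lin_right_coeff lin_right_deriv])
  show "lin (\<lambda>z. scale (of_nat (Suc (count g s))) (right_coeff (add_mset s g) z))"
    by (rule linI) (simp_all add: lin_add[OF lin_right_coeff] lin_scale[OF lin_right_coeff]
        scale.scale_right_distrib ac_simps)
qed

lemma right_deriv_tensor_one: "right_deriv s (tensor x 1) = 0"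
  by (rule lin_eqI[of "\<lambda>x. right_deriv s (tensor x 1)" "\<lambda>x. 0"])
    (simp_all add: lin_comp[OF lin_right_deriv lin_tensor_left] linI right_deriv_basis)

text \<open>All right factors are single trees here, so differentiation leaves only multiples of 1
  on the right.\<close>

lemma right_deriv_graft_right:
  "right_deriv s (graft_right i z) = tensor (right_coeff {#s#} (graft_right i z)) 1"
proof (rule lin_eqI[of "\<lambda>z. right_deriv s (graft_right i z)" "\<lambda>z. tensor (right_coeff {#s#} (graft_right i z)) 1"])
  show "right_deriv s (graft_right i (basis p)) = tensor (right_coeff {#s#} (graft_right i (basis p))) 1" for p
    by (cases p) (auto simp: right_deriv_basis right_coeff_basis lin_zero[OF lin_tensor_left])
qed (simp_all only: lin_comp[OF lin_right_deriv lin_graft_right]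
    lin_comp[OF lin_tensor_left lin_comp[OF lin_right_coeff lin_graft_right]])

lemma right_coeff_graft_right:
  "right_coeff {#Node i g#} (graft_right j z) = (if i = j then right_coeff g z else 0)"
proof (rule lin_eqI[of "\<lambda>z. right_coeff {#Node i g#} (graft_right j z)" "\<lambda>z. if i = j then right_coeff g z else 0"])
  show "right_coeff {#Node i g#} (graft_right j (basis p)) = (if i = j then right_coeff g (basis p) else 0)" for p
    by (cases p) (auto simp: right_coeff_basis)
  show "lin (\<lambda>z. if i = j then right_coeff g z else 0)"
    by (rule linI) (simp_all add: lin_add[OF lin_right_coeff] lin_scale[OF lin_right_coeff])
qed (rule lin_comp[OF lin_right_coeff lin_graft_right])

lemma right_coeff_graft_right_size: "size h \<noteq> 1 \<Longrightarrow> right_coeff h (graft_right j z) = 0"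
proof (rule lin_eqI[of "\<lambda>z. right_coeff h (graft_right j z)" "\<lambda>z. 0"])
  show "size h \<noteq> 1 \<Longrightarrow> right_coeff h (graft_right j (basis p)) = 0" for p
    by (cases p) (auto simp: right_coeff_basis)
qed (simp_all add: lin_comp[OF lin_right_coeff lin_graft_right] linI)

lemma right_coeff_mult_tensor_one: "right_coeff g (z * tensor y 1) = right_coeff g z * y"
proof (rule bilinear_eqI[of "\<lambda>z y. right_coeff g (z * tensor y 1)" "\<lambda>z y. right_coeff g z * y"])
  show "right_coeff g (basis p * tensor (basis f) 1) = right_coeff g (basis p) * basis f" for p f
    by (cases p) (simp add: basis_mult right_coeff_basis)
qed (simp_all only: lin_comp[OF lin_right_coeff lin_mult_left]
    lin_comp[OF lin_right_coeff lin_comp[OF lin_mult_right lin_tensor_left]]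
    lin_comp[OF lin_mult_left lin_right_coeff] lin_mult_right)

primrec label :: "'i rtree \<Rightarrow> 'i" where
  "label (Node i f) = i"

lemma map_fps_right_deriv_mult:
  "map_fps (right_deriv s) (x * y) = map_fps (right_deriv s) x * y + x * map_fps (right_deriv s) y"
  by (rule fps_ext)
    (simp add: fps_mult_nth lin_sum[OF lin_right_deriv] right_deriv_mult sum.distrib)

lemma map_fps_right_deriv_monomial:
  fixes z :: "'a \<Rightarrow> ('b, 'c::field) tree_alg2 fps"
  assumes "\<And>d. map_fps (right_deriv s) (z d) = (if d = e then u else 0)"
  shows "map_fps (right_deriv s) (monomial z P) = of_nat (count P e) * (monomial z (P - {#e#}) * u)"
proof (induction P)
  case empty
  have "right_deriv s (1 :: ('b, 'c) tree_alg2) = 0"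
    using right_deriv_tensor_one[of s 1] by (simp add: tensor_one_one)
  then show ?case by (intro fps_ext) (simp add: lin_zero[OF lin_right_deriv])
next
  case (add d P)
  show ?case
  proof (cases "e \<in># P")
    case True
    then obtain P' where "P = add_mset e P'" by (metis multi_member_split)
    then show ?thesis using add by (auto simp: map_fps_right_deriv_mult assms algebra_simps)
  next
    case False
    then show ?thesis using add by (auto simp: map_fps_right_deriv_mult assms algebra_simps not_in_iff)
  qed
qed

text \<open>The chain rule when only \<open>z e\<close> depends on \<open>s\<close>.\<close>

lemma right_deriv_exp_subst:
  assumes z0: "\<And>d. fps_nth (z d) 0 = 0"
    and z: "\<And>d. map_fps (right_deriv s) (z d) = (if d = e then u else 0)"
  shows "map_fps (right_deriv s) (exp_subst b z) = exp_subst (\<lambda>Q. b (add_mset e Q)) z * u"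
proof (rule fps_ext)
  fix n
  let ?c = "\<lambda>P. b P / (\<Prod>d\<in>UNIV. fact (count P d))"
  let ?c' = "\<lambda>Q. b (add_mset e Q) / (\<Prod>d\<in>UNIV. fact (count Q d))"
  have c: "?c (add_mset e Q) * of_nat (Suc (count Q e)) = ?c' Q" for Q
    by (simp add: prod_fact_add_mset del: of_nat_Suc count_add_mset)
  \<comment> \<open>The bound is \<open>Suc n\<close> because differentiation removes one
    \<open>e\<close> from \<open>P\<close>; what remains are all multi-indices of size at most
    \<open>n\<close>.\<close>
  have "fps_nth (map_fps (right_deriv s) (exp_subst b z)) n =
      (\<Sum>P | size P \<le> Suc n. scale (?c P) (fps_nth (map_fps (right_deriv s) (monomial z P)) n))"
    by (simp add: exp_subst_def msubst_nth[OF z0, of n "Suc n"] lin_sum[OF lin_right_deriv]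
        lin_scale[OF lin_right_deriv])
  also have "\<dots> = (\<Sum>P | size P \<le> Suc n.
      scale (?c P * of_nat (count P e)) (fps_nth (monomial z (P - {#e#}) * u) n))"
    unfolding map_fps_right_deriv_monomial[of s z, OF z]
    by (simp add: fps_of_nat[symmetric] of_nat_mult_eq_scale)
  also have "\<dots> = (\<Sum>P\<in>add_mset e ` {Q. size Q \<le> n}.
      scale (?c P * of_nat (count P e)) (fps_nth (monomial z (P - {#e#}) * u) n))"
  proof (rule sum.mono_neutral_right)
    have "P \<in> add_mset e ` {Q. size Q \<le> n}" if "size P \<le> Suc n" "e \<in># P" for P
      using that by (intro image_eqI[of _ _ "P - {#e#}"]) (auto simp: size_Diff_singleton)
    then show "\<forall>P\<in>{P. size P \<le> Suc n} - add_mset e ` {Q. size Q \<le> n}.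
        scale (?c P * of_nat (count P e)) (fps_nth (monomial z (P - {#e#}) * u) n) = 0"
      by (metis (no_types, lifting) DiffE mem_Collect_eq mult_zero_right not_in_iff of_nat_0
          scale.scale_zero_left)
  qed (auto simp: finite_size_le)
  also have "\<dots> = (\<Sum>Q | size Q \<le> n. scale (?c' Q) (fps_nth (monomial z Q * u) n))"
    by (subst sum.reindex) (simp_all add: inj_on_def c[symmetric])
  also have "\<dots> = (\<Sum>Q | size Q \<le> n. \<Sum>k=0..n. scale (?c' Q) (fps_nth (monomial z Q) k) * fps_nth u (n - k))"
    by (simp add: fps_mult_nth scale.scale_sum_right scale_mult_left)
  also have "\<dots> = (\<Sum>k=0..n. (\<Sum>Q | size Q \<le> n. scale (?c' Q) (fps_nth (monomial z Q) k)) * fps_nth u (n - k))"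
    by (subst sum.swap) (simp add: sum_distrib_right)
  also have "\<dots> = fps_nth (exp_subst (\<lambda>Q. b (add_mset e Q)) z * u) n"
    unfolding fps_mult_nth exp_subst_def
    by (intro sum.cong refl) (simp add: msubst_nth[OF z0, of _ n])
  finally show "fps_nth (map_fps (right_deriv s) (exp_subst b z)) n =
      fps_nth (exp_subst (\<lambda>Q. b (add_mset e Q)) z * u) n" .
qed

text \<open>
  The system is described by the derivatives \<open>b i P\<close> at the origin of its series, which removes
  all symmetry factors below.
\<close>

locale dyson_schwinger =
  fixes b :: "'i::finite \<Rightarrow> 'i multiset \<Rightarrow> 'k::field_char_0"
    and X :: "'i \<Rightarrow> ('i, 'k) tree_alg fps"
  assumes X_0: "fps_nth (X i) 0 = 0"
    and X_Suc: "fps_nth (X i) (Suc n) = graft i (fps_nth (exp_subst (b i) X) n)"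
    and X_completion: "X i \<in> completion"
    and b_empty: "b i {#} = 1"
begin

definition Z :: "'i \<Rightarrow> ('i, 'k) tree_alg2 fps" where
  "Z d = map_fps coprod (X d)"

definition Y :: "'i rtree \<Rightarrow> ('i, 'k) tree_alg fps" where
  "Y s = map_fps (right_coeff {#s#}) (Z (label s))"

lemma Z_0: "fps_nth (Z d) 0 = 0"
  by (simp add: Z_def X_0 lin_zero[OF alg_hom_lin[OF alg_hom_coprod]])

lemma coprod_exp_subst: "map_fps coprod (exp_subst c X) = exp_subst c Z"
  by (simp add: exp_subst_def map_fps_msubst[OF alg_hom_coprod] Z_def[abs_def])

lemma Z_Suc:
  "fps_nth (Z d) (Suc n) =
     tensor (fps_nth (X d) (Suc n)) 1 + graft_right d (fps_nth (exp_subst (b d) Z) n)"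
  by (simp add: Z_def[of d] X_Suc coprod_graft flip: coprod_exp_subst)

text \<open>By the cocycle property a right factor occurring in the coproduct of \<open>X d\<close>
  is empty or a single tree with root \<open>d\<close>.\<close>

lemma right_coeff_Z:
  "right_coeff {#} (fps_nth (Z d) n) = fps_nth (X d) n"
  "right_coeff {#s#} (fps_nth (Z d) n) = (if label s = d then fps_nth (Y s) n else 0)"
  "size h > 1 \<Longrightarrow> right_coeff h (fps_nth (Z d) n) = 0"
proof -
  show "right_coeff {#} (fps_nth (Z d) n) = fps_nth (X d) n"
    by (cases n) (simp_all add: Z_0 Z_Suc X_0 lin_zero[OF lin_right_coeff] lin_add[OF lin_right_coeff]
        right_coeff_graft_right_empty right_coeff_tensor lookup_one)
  show "right_coeff {#s#} (fps_nth (Z d) n) = (if label s = d then fps_nth (Y s) n else 0)"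
    by (cases n; cases s) (simp_all add: Y_def Z_0 Z_Suc lin_zero[OF lin_right_coeff]
        lin_add[OF lin_right_coeff] right_coeff_graft_right right_coeff_tensor lookup_one)
  show "size h > 1 \<Longrightarrow> right_coeff h (fps_nth (Z d) n) = 0"
    by (cases n; cases "h = {#}") (auto simp: Z_0 Z_Suc lin_zero[OF lin_right_coeff]
        lin_add[OF lin_right_coeff] right_coeff_graft_right_size right_coeff_tensor lookup_one)
qed

lemma right_deriv_Z:
  "map_fps (right_deriv s) (Z d) = (if d = label s then map_fps (\<lambda>y. tensor y 1) (Y s) else 0)"
proof (rule fps_ext)
  fix n
  show "fps_nth (map_fps (right_deriv s) (Z d)) n =
      fps_nth (if d = label s then map_fps (\<lambda>y. tensor y 1) (Y s) else 0) n"
  proof (cases n)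
    case 0
    then show ?thesis
      by (simp add: Z_0 Y_def lin_zero[OF lin_right_deriv] lin_zero[OF lin_right_coeff]
          lin_zero[OF lin_tensor_left])
  next
    case (Suc m)
    have "right_coeff {#s#} (fps_nth (Z d) n) = right_coeff {#s#} (graft_right d (fps_nth (exp_subst (b d) Z) m))"
      by (simp add: Suc Z_Suc lin_add[OF lin_right_coeff] right_coeff_tensor lookup_one)
    then have "fps_nth (map_fps (right_deriv s) (Z d)) n = tensor (right_coeff {#s#} (fps_nth (Z d) n)) 1"
      by (simp add: Suc Z_Suc lin_add[OF lin_right_deriv] right_deriv_tensor_one right_deriv_graft_right
          lin_add[OF lin_right_coeff])
    then show ?thesis
      by (auto simp: right_coeff_Z lin_zero[OF lin_tensor_left])
  qed
qed

lemma map_fps_right_coeff_mult: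
  "map_fps (right_coeff g) (w * map_fps (\<lambda>y. tensor y 1) y) = map_fps (right_coeff g) w * y"
  by (rule fps_ext) (simp add: fps_mult_nth lin_sum[OF lin_right_coeff] right_coeff_mult_tensor_one)

text \<open>Taylor's formula for the substitution of \<open>Z\<close>: the factor \<open>\<kappa>\<close> is the symmetry factor of \<open>g\<close>.\<close>

lemma right_coeff_exp_subst:
  "\<exists>\<kappa>::nat. \<kappa> > 0 \<and> (\<forall>c. of_nat \<kappa> * map_fps (right_coeff g) (exp_subst c Z) =
     prod_mset (image_mset Y g) * exp_subst (\<lambda>P. c (P + image_mset label g)) X)"
proof (induction g)
  case empty
  have "map_fps (right_coeff {#}) (exp_subst c Z) = exp_subst c X" for c
  proof -
    have "map_fps (right_coeff {#}) (Z d) = X d" for d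
      by (rule fps_ext) (simp add: right_coeff_Z)
    then show ?thesis
      by (simp add: exp_subst_def map_fps_msubst[OF alg_hom_right_coeff_empty])
  qed
  then show ?case by (intro exI[of _ 1]) simp
next
  case (add s g)
  then obtain \<kappa> :: nat where \<kappa>: "\<kappa> > 0"
    and IH: "\<And>c. of_nat \<kappa> * map_fps (right_coeff g) (exp_subst c Z) =
      prod_mset (image_mset Y g) * exp_subst (\<lambda>P. c (P + image_mset label g)) X"
    by blast
  have "of_nat (\<kappa> * Suc (count g s)) * map_fps (right_coeff (add_mset s g)) (exp_subst c Z) =
      prod_mset (image_mset Y (add_mset s g)) * exp_subst (\<lambda>P. c (P + image_mset label (add_mset s g))) X" for c
  proof -
    \<comment> \<open>One more copy of \<open>s\<close> on the right costs one derivative. The chain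
      rule then supplies the factor \<open>Y s\<close> and shifts the coefficients by the root of
      \<open>s\<close>; the exponent \<open>Suc (count g s)\<close> accumulates in
      \<open>\<kappa>\<close>.\<close>
    have "of_nat (Suc (count g s)) * map_fps (right_coeff (add_mset s g)) (exp_subst c Z) =
        map_fps (right_coeff g) (map_fps (right_deriv s) (exp_subst c Z))"
      by (rule fps_ext)
        (simp add: right_coeff_right_deriv fps_of_nat[symmetric] of_nat_mult_eq_scale del: of_nat_Suc)
    also have "\<dots> = map_fps (right_coeff g) (exp_subst (\<lambda>Q. c (add_mset (label s) Q)) Z) * Y s"
      by (simp add: right_deriv_exp_subst[of Z s "label s", OF Z_0 right_deriv_Z] map_fps_right_coeff_mult)
    finally have "of_nat (\<kappa> * Suc (count g s)) * map_fps (right_coeff (add_mset s g)) (exp_subst c Z) =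
        (of_nat \<kappa> * map_fps (right_coeff g) (exp_subst (\<lambda>Q. c (add_mset (label s) Q)) Z)) * Y s"
      by (simp only: of_nat_mult mult.assoc)
    then show ?thesis
      by (simp add: IH ac_simps)
  qed
  then show ?case
    using \<kappa> by (intro exI[of _ "\<kappa> * Suc (count g s)"]) auto
qed

text \<open>The factor \<open>fps_X\<close> stands for the root: grafting shifts degrees by
  one.\<close>

lemma Y_Node:
  obtains \<kappa> :: nat where "\<kappa> > 0"
    "of_nat \<kappa> * Y (Node i g) =
       fps_X * (prod_mset (image_mset Y g) * exp_subst (\<lambda>P. b i (P + image_mset label g)) X)"
proof -
  obtain \<kappa> :: nat where \<kappa>: "\<kappa> > 0"
    "of_nat \<kappa> * map_fps (right_coeff g) (exp_subst (b i) Z) =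
       prod_mset (image_mset Y g) * exp_subst (\<lambda>P. b i (P + image_mset label g)) X"
    using right_coeff_exp_subst[of g] by blast
  have "Y (Node i g) = fps_X * map_fps (right_coeff g) (exp_subst (b i) Z)"
  proof (rule fps_ext)
    fix n
    show "fps_nth (Y (Node i g)) n = fps_nth (fps_X * map_fps (right_coeff g) (exp_subst (b i) Z)) n"
      by (cases n) (simp_all add: Y_def Z_0 Z_Suc lin_zero[OF lin_right_coeff] lin_add[OF lin_right_coeff]
        right_coeff_graft_right right_coeff_tensor lookup_one)
  qed
  then have "of_nat \<kappa> * Y (Node i g) = fps_X * (of_nat \<kappa> * map_fps (right_coeff g) (exp_subst (b i) Z))"
    by (simp add: ac_simps)
  then show thesis
    using that \<kappa> by simp
qed

end

section \<open>Coefficients of single trees and of single vertices\<close>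

lemma lookup_linear_extension:
  "Poly_Mapping.lookup (linear_extension \<phi> x) b =
     (\<Sum>a\<in>Poly_Mapping.keys x. Poly_Mapping.lookup x a * Poly_Mapping.lookup (\<phi> a) b)"
  by (simp add: linear_extension_def lookup_sum)

definition left_coeff :: "'i forest \<Rightarrow> ('i, 'k::field) tree_alg2 \<Rightarrow> ('i, 'k) tree_alg" where
  "left_coeff h = linear_extension (\<lambda>(f, g). if f = h then basis g else 0)"

lemma lin_left_coeff: "lin (left_coeff h)"
  unfolding left_coeff_def by (rule lin_linear_extension)

lemma left_coeff_basis: "left_coeff h (basis (f, g)) = (if f = h then basis g else 0)"
  by (simp add: left_coeff_def)

lemma lookup_left_coeff: "Poly_Mapping.lookup (left_coeff h z) g = Poly_Mapping.lookup z (h, g)"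
proof -
  have "Poly_Mapping.lookup (left_coeff h z) g =
      (\<Sum>a\<in>Poly_Mapping.keys z. if a = (h, g) then Poly_Mapping.lookup z a else 0)"
    unfolding left_coeff_def lookup_linear_extension
    by (intro sum.cong) (auto simp: lookup_basis split: prod.splits)
  then show ?thesis by (simp add: in_keys_iff)
qed

lemma lookup_right_coeff: "Poly_Mapping.lookup (right_coeff h z) f = Poly_Mapping.lookup z (f, h)"
proof -
  have "Poly_Mapping.lookup (right_coeff h z) f =
      (\<Sum>a\<in>Poly_Mapping.keys z. if a = (f, h) then Poly_Mapping.lookup z a else 0)"
    unfolding right_coeff_def lookup_linear_extension
    by (intro sum.cong) (auto simp: lookup_basis split: prod.splits)
  then show ?thesis by (simp add: in_keys_iff)
qed

lemma left_coeff_tensor: "left_coeff h (tensor x y) = scale (Poly_Mapping.lookup x h) y"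
proof (rule poly_mapping_eqI)
  fix g
  have "Poly_Mapping.lookup (left_coeff h (tensor x y)) g = Poly_Mapping.lookup (right_coeff g (tensor x y)) h"
    by (simp add: lookup_left_coeff lookup_right_coeff)
  then show "Poly_Mapping.lookup (left_coeff h (tensor x y)) g = Poly_Mapping.lookup (scale (Poly_Mapping.lookup x h) y) g"
    by (simp add: right_coeff_tensor mult.commute)
qed

lemma left_coeff_empty_graft_right: "left_coeff {#} (graft_right i z) = graft i (left_coeff {#} z)"
proof (rule lin_eqI[of "\<lambda>z. left_coeff {#} (graft_right i z)" "\<lambda>z. graft i (left_coeff {#} z)"])
  show "left_coeff {#} (graft_right i (basis p)) = graft i (left_coeff {#} (basis p))" for p
    by (cases p) (simp add: left_coeff_basis lin_zero[OF lin_graft])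
qed (simp_all only: lin_comp[OF lin_left_coeff lin_graft_right] lin_comp[OF lin_graft lin_left_coeff])

lemma alg_hom_left_coeff_empty: "alg_hom (left_coeff {#})"
  unfolding left_coeff_def
  by (rule alg_hom_linear_extension)
    (auto simp: basis_mult zero_prod_def basis_empty split: prod.splits)

text \<open>The counit law \<open>(\<epsilon> \<otimes> id) \<circ> \<Delta> = id\<close>. It later
  identifies the counit of \<open>Y s\<close> with the coefficient of \<open>s\<close> in the
  solution.\<close>

lemma left_coeff_empty_coprod:
  fixes x :: "('a, 'b::field) tree_alg"
  shows "left_coeff {#} (coprod x) = x"
proof -
  note hom = alg_hom_comp[OF alg_hom_left_coeff_empty alg_hom_coprod]
  have id: "alg_hom (\<lambda>x :: ('a, 'b) tree_alg. x)"
    by (simp add: alg_hom_def lin_id)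
  have "left_coeff {#} (coprod (basis {#t#})) = (basis {#t#} :: ('a, 'b) tree_alg)" for t
  proof (induction t)
    case (Node i f)
    have "left_coeff {#} (coprod (basis f)) = (basis f :: ('a, 'b) tree_alg)"
      by (rule alg_hom_forest_cong[OF hom id]) (rule Node.IH)
    then show ?case
      by (simp add: coprod_Node lin_add[OF lin_left_coeff] left_coeff_basis left_coeff_empty_graft_right)
  qed
  then show ?thesis
    by (rule alg_hom_forest_eqI[OF hom id])
qed

lemma counit_mult:
  fixes x y :: "('a, 'b::field) tree_alg"
  shows "counit (x * y) = counit x * counit y"
proof -
  have "scale (counit (x * y)) (1 :: ('a, 'b) tree_alg) = scale (counit x) 1 * scale (counit y) 1"
    using alg_hom_mult[OF alg_hom_counit, of x y] .
  then have "Poly_Mapping.lookup (scale (counit (x * y)) (1 :: ('a, 'b) tree_alg)) {#} =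
      Poly_Mapping.lookup (scale (counit x) 1 * scale (counit y) (1 :: ('a, 'b) tree_alg)) {#}"
    by simp
  then show ?thesis
    by (simp add: scale_mult_left scale_mult_right lookup_one)
qed

definition tree_coeff :: "'i rtree \<Rightarrow> ('i, 'k::field) tree_alg \<Rightarrow> 'k" where
  "tree_coeff t x = Poly_Mapping.lookup x {#t#}"

text \<open>A single tree arises in a product of forests only as that tree times the empty forest,
  so its coefficient is a derivation relative to the counit.\<close>

lemma tree_coeff_mult:
  fixes x y :: "('a, 'b::field) tree_alg"
  shows "tree_coeff t (x * y) = tree_coeff t x * counit y + counit x * tree_coeff t y"
proof -
  \<comment> \<open>\<open>bilinear_eqI\<close> compares maps into monoid algebras, so the scalar
    functionals are turned into multiples of 1.\<close>
  define S where "S x = scale (tree_coeff t x) (1 :: ('a, 'b) tree_alg)" for x :: "('a, 'b) tree_alg"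
  define \<eta> where "\<eta> x = scale (counit x) (1 :: ('a, 'b) tree_alg)" for x :: "('a, 'b) tree_alg"
  have lin: "lin S" "lin \<eta>"
    by (auto simp: S_def \<eta>_def tree_coeff_def counit_def lookup_add scale.scale_left_distrib intro!: linI)
  have "S (x * y) = S x * \<eta> y + \<eta> x * S y"
  proof (rule bilinear_eqI[of "\<lambda>x y. S (x * y)" "\<lambda>x y. S x * \<eta> y + \<eta> x * S y"])
    show "S (basis f * basis g) = S (basis f) * \<eta> (basis g) + \<eta> (basis f) * S (basis g)" for f g
      by (auto simp: basis_mult S_def \<eta>_def tree_coeff_def counit_def lookup_basis
          scale_mult_left scale_mult_right union_is_single)
  qed (simp_all only: lin_comp[OF lin(1) lin_mult_left] lin_comp[OF lin(1) lin_mult_right]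
      lin_plus[OF lin_comp[OF lin_mult_left lin(1)] lin_comp[OF lin_mult_left lin(2)]]
      lin_plus[OF lin_comp[OF lin_mult_right lin(2)] lin_comp[OF lin_mult_right lin(1)]])
  then have "Poly_Mapping.lookup (S (x * y)) {#} = Poly_Mapping.lookup (S x * \<eta> y + \<eta> x * S y) {#}"
    by simp
  then show ?thesis
    by (simp add: S_def \<eta>_def scale_mult_left scale_mult_right lookup_add lookup_one mult.commute)
qed

lemma counit_sum: "counit (sum f A) = (\<Sum>a\<in>A. counit (f a))"
  and tree_coeff_sum: "tree_coeff t (sum f A) = (\<Sum>a\<in>A. tree_coeff t (f a))"
  and counit_scale: "counit (scale k x) = k * counit x"
  and tree_coeff_scale: "tree_coeff t (scale k x) = k * tree_coeff t x"
  by (simp_all add: counit_def tree_coeff_def lookup_sum)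

lemma counit_zero: "counit 0 = 0" and tree_coeff_zero: "tree_coeff t 0 = 0"
  and counit_one: "counit 1 = 1" and tree_coeff_one: "tree_coeff t 1 = 0"
  by (simp_all add: counit_def tree_coeff_def lookup_one)

lemma map_fps_counit_mult: "map_fps counit (x * y) = map_fps counit x * map_fps counit y"
  by (rule fps_ext) (simp add: fps_mult_nth counit_sum counit_mult)

lemma map_fps_tree_coeff_mult:
  "map_fps (tree_coeff t) (x * y) =
     map_fps (tree_coeff t) x * map_fps counit y + map_fps counit x * map_fps (tree_coeff t) y"
  by (rule fps_ext) (simp add: fps_mult_nth tree_coeff_sum tree_coeff_mult sum.distrib)

lemma map_fps_counit_one: "map_fps counit 1 = 1" and map_fps_tree_coeff_one: "map_fps (tree_coeff t) 1 = 0"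
  by (rule fps_ext; simp add: counit_one counit_zero tree_coeff_one tree_coeff_zero)+

lemma map_fps_X:
  "map_fps counit (fps_X * x) = fps_X * map_fps counit x"
  "map_fps (tree_coeff t) (fps_X * x) = fps_X * map_fps (tree_coeff t) x"
  by (rule fps_ext; simp add: counit_zero tree_coeff_zero)+

lemma map_fps_of_nat:
  "map_fps counit (of_nat n * x) = of_nat n * map_fps counit x"
  "map_fps (tree_coeff t) (of_nat n * x) = of_nat n * map_fps (tree_coeff t) x"
  by (rule fps_ext; simp add: fps_of_nat[symmetric] of_nat_mult_eq_scale counit_scale tree_coeff_scale)+

context dyson_schwinger
begin

text \<open>By \<open>tree_coeff_X\<close> this component of the solution is the only one in which
  \<open>s\<close> can occur.\<close>

definition c :: "'i rtree \<Rightarrow> 'k" where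
  "c s = tree_coeff s (fps_nth (X (label s)) (vertices s))"

abbreviation vertex :: "'i \<Rightarrow> 'i rtree" where
  "vertex j \<equiv> Node j {#}"

lemma X_nonzero_degree: "Poly_Mapping.lookup (fps_nth (X d) n) f \<noteq> 0 \<Longrightarrow> degree f = n"
  using X_completion[of d] by (auto simp: completion_iff homogeneous_iff)

lemma X_nth_eq_graft: "\<exists>x. fps_nth (X d) n = graft d x"
  by (cases n) (auto simp: X_0 X_Suc lin_zero[OF lin_graft] intro: exI[of _ 0])

lemma lookup_graft_label: "label s \<noteq> d \<Longrightarrow> Poly_Mapping.lookup (graft d x) {#s#} = 0"
  unfolding graft_def lookup_linear_extension by (intro sum.neutral) (auto simp: lookup_basis)

lemma tree_coeff_X:
  "tree_coeff s (fps_nth (X d) n) = (if label s = d \<and> n = vertices s then c s else 0)"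
proof (cases "label s = d")
  case False
  then show ?thesis
    using X_nth_eq_graft[of d n] lookup_graft_label[of s d] by (auto simp: tree_coeff_def)
next
  case True
  then show ?thesis
    using X_nonzero_degree[of d n "{#s#}"] by (auto simp: tree_coeff_def c_def degree_def)
qed

lemma map_fps_counit_X: "map_fps counit (X d) = 0"
proof (rule fps_ext)
  fix n
  show "fps_nth (map_fps counit (X d)) n = fps_nth 0 n"
    using X_nonzero_degree[of d n "{#}"] by (cases "n = 0") (auto simp: counit_def X_0 degree_def)
qed

lemma exp_subst_nth_0: "fps_nth (exp_subst a X) 0 = scale (a {#}) 1"
  by (simp add: exp_subst_def msubst_def)

lemma c_vertex: "c (vertex j) = 1"
  by (simp add: c_def X_Suc exp_subst_nth_0 b_empty tree_coeff_def lookup_basis flip: basis_empty)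

lemma map_fps_vertex_coeff_X: "map_fps (tree_coeff (vertex j)) (X d) = (if d = j then fps_X else 0)"
  by (rule fps_ext) (simp add: tree_coeff_X c_vertex)

lemma map_fps_counit_monomial: "map_fps counit (monomial X P) = (if P = {#} then 1 else 0)"
  by (induction P) (simp_all add: map_fps_counit_one map_fps_counit_mult map_fps_counit_X)

text \<open>The vertex must come from one factor \<open>X j\<close>; any further factor contributes
  its counit, which is 0.\<close>

lemma map_fps_vertex_coeff_monomial:
  "map_fps (tree_coeff (vertex j)) (monomial X P) = (if P = {#j#} then fps_X else 0)"
  by (induction P) (auto simp: map_fps_tree_coeff_one map_fps_tree_coeff_mult map_fps_vertex_coeff_X
      map_fps_counit_X map_fps_counit_monomial)

lemma map_fps_counit_msubst: "map_fps counit (msubst a X) = fps_const (a {#})"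
proof (rule fps_ext)
  fix n
  have "counit (fps_nth (monomial X P) n) = (if P = {#} \<and> n = 0 then 1 else 0)" for P
    using arg_cong[OF map_fps_counit_monomial, of "\<lambda>x. fps_nth x n" P] by auto
  then show "fps_nth (map_fps counit (msubst a X)) n = fps_nth (fps_const (a {#})) n"
    by (auto simp: msubst_def counit_sum counit_scale if_distrib[of "(*) _"]
        sum.delta finite_size_le cong: if_cong)
qed

lemma map_fps_counit_exp_subst: "map_fps counit (exp_subst a X) = fps_const (a {#})"
  by (simp add: exp_subst_def map_fps_counit_msubst)

lemma map_fps_vertex_coeff_exp_subst:
  "map_fps (tree_coeff (vertex j)) (exp_subst a X) = fps_const (a {#j#}) * fps_X"
proof (rule fps_ext)
  fix n
  have 1: "tree_coeff (vertex j) (fps_nth (monomial X P) n) = (if P = {#j#} then if n = 1 then 1 else 0 else 0)" for P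
    using arg_cong[OF map_fps_vertex_coeff_monomial, of "\<lambda>x. fps_nth x n" j P] by (auto split: if_splits)
  have "(\<Prod>d\<in>UNIV. fact (count {#j#} d)) = (1 :: 'k)"
    by (intro prod.neutral) auto
  then show "fps_nth (map_fps (tree_coeff (vertex j)) (exp_subst a X)) n = fps_nth (fps_const (a {#j#}) * fps_X) n"
    by (auto simp: exp_subst_def msubst_def tree_coeff_sum tree_coeff_scale 1 if_distrib[of "(*) _"]
        sum.delta finite_size_le cong: if_cong)
qed

lemma map_fps_counit_Y: "map_fps counit (Y s) = fps_const (c s) * fps_X ^ vertices s"
proof (rule fps_ext)
  fix n
  have "counit (fps_nth (Y s) n) = Poly_Mapping.lookup (left_coeff {#} (coprod (fps_nth (X (label s)) n))) {#s#}"
    by (simp add: Y_def Z_def counit_def lookup_right_coeff lookup_left_coeff)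
  also have "\<dots> = tree_coeff s (fps_nth (X (label s)) n)"
    by (simp add: left_coeff_empty_coprod tree_coeff_def)
  finally show "fps_nth (map_fps counit (Y s)) n = fps_nth (fps_const (c s) * fps_X ^ vertices s) n"
    by (simp add: tree_coeff_X)
qed

lemma map_fps_counit_prod_Y:
  "map_fps counit (prod_mset (image_mset Y g)) = fps_const (prod_mset (image_mset c g)) * fps_X ^ degree g"
  by (induction g)
    (simp_all add: map_fps_counit_one map_fps_counit_mult map_fps_counit_Y degree_def power_add
      ac_simps flip: fps_const_mult)

text \<open>The coefficient of \<open>vertex j \<otimes> s\<close> in the coproduct of the solution
  for the root of \<open>s\<close>; the degree is forced to be one more than that of
  \<open>s\<close>.\<close>

definition vertex_coeff :: "'i \<Rightarrow> 'i rtree \<Rightarrow> 'k" where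
  "vertex_coeff j s = tree_coeff (vertex j) (fps_nth (Y s) (Suc (vertices s)))"

text \<open>Leibniz rule: one factor supplies the vertex, the others their counits
  \<open>c s\<close>. The ratios \<open>\<mu>\<close> enter by multiplication because
  \<open>c s\<close> may vanish.\<close>

lemma map_fps_vertex_coeff_prod_Y:
  assumes "\<And>s. s \<in># g \<Longrightarrow> map_fps (tree_coeff (vertex j)) (Y s) = fps_const (vertex_coeff j s) * fps_X ^ Suc (vertices s)"
  obtains a where
    "map_fps (tree_coeff (vertex j)) (prod_mset (image_mset Y g)) = fps_const a * fps_X ^ Suc (degree g)"
    "\<And>\<mu>. (\<And>s. s \<in># g \<Longrightarrow> vertex_coeff j s = \<mu> s * c s) \<Longrightarrow>
       a = sum_mset (image_mset \<mu> g) * prod_mset (image_mset c g)"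
proof -
  have "\<exists>a. map_fps (tree_coeff (vertex j)) (prod_mset (image_mset Y g)) = fps_const a * fps_X ^ Suc (degree g) \<and>
    (\<forall>\<mu>. (\<forall>s. s \<in># g \<longrightarrow> vertex_coeff j s = \<mu> s * c s) \<longrightarrow>
       a = sum_mset (image_mset \<mu> g) * prod_mset (image_mset c g))"
    using assms
  proof (induction g)
    case empty
    then show ?case by (intro exI[of _ 0]) (simp add: map_fps_tree_coeff_one)
  next
    case (add s g)
    then obtain a where a: "map_fps (tree_coeff (vertex j)) (prod_mset (image_mset Y g)) =
        fps_const a * fps_X ^ Suc (degree g)"
      and \<mu>: "\<And>\<mu>. (\<forall>s. s \<in># g \<longrightarrow> vertex_coeff j s = \<mu> s * c s) \<Longrightarrow>
        a = sum_mset (image_mset \<mu> g) * prod_mset (image_mset c g)"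
      by auto
    let ?a = "vertex_coeff j s * prod_mset (image_mset c g) + c s * a"
    have s: "map_fps (tree_coeff (vertex j)) (Y s) = fps_const (vertex_coeff j s) * fps_X ^ Suc (vertices s)"
      using add.prems by simp
    have "map_fps (tree_coeff (vertex j)) (prod_mset (image_mset Y (add_mset s g))) =
        fps_const (vertex_coeff j s) * fps_X ^ Suc (vertices s) *
          (fps_const (prod_mset (image_mset c g)) * fps_X ^ degree g) +
        fps_const (c s) * fps_X ^ vertices s * (fps_const a * fps_X ^ Suc (degree g))"
      by (simp only: image_mset_add_mset prod_mset.add_mset map_fps_tree_coeff_mult s a
          map_fps_counit_Y map_fps_counit_prod_Y)
    also have "\<dots> = fps_const ?a * fps_X ^ Suc (degree (add_mset s g))"
      by (simp add: degree_def power_add algebra_simps flip: fps_const_mult fps_const_add)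
    finally show ?case
      using \<mu> by (intro exI[of _ ?a]) (auto simp: algebra_simps)
  qed
  then show thesis using that by blast
qed

text \<open>The counit and the coefficient of the vertex are both applied to the identity of
  \<open>Y_Node\<close>. They share the same \<open>\<kappa>\<close>, which therefore drops out when
  the two results are compared. The vertex comes either from a factor \<open>Y s\<close> or from the
  linear term of the shifted series.\<close>

lemma tree_coeff_Node:
  assumes "\<And>s. s \<in># g \<Longrightarrow> map_fps (tree_coeff (vertex j)) (Y s) = fps_const (vertex_coeff j s) * fps_X ^ Suc (vertices s)"
  shows "map_fps (tree_coeff (vertex j)) (Y (Node i g)) =
      fps_const (vertex_coeff j (Node i g)) * fps_X ^ Suc (vertices (Node i g))" (is ?A)
    and "\<exists>\<kappa>::nat. \<kappa> > 0 \<and> of_nat \<kappa> * c (Node i g) = prod_mset (image_mset c g) * b i (image_mset label g) \<and>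
      (\<forall>\<mu>. (\<forall>s. s \<in># g \<longrightarrow> vertex_coeff j s = \<mu> s * c s) \<longrightarrow>
        of_nat \<kappa> * vertex_coeff j (Node i g) = prod_mset (image_mset c g) *
          (sum_mset (image_mset \<mu> g) * b i (image_mset label g) + b i (add_mset j (image_mset label g))))" (is ?B)
proof -
  let ?p = "prod_mset (image_mset c g)" and ?t = "image_mset label g" and ?n = "vertices (Node i g)"
  obtain \<kappa> :: nat where \<kappa>: "\<kappa> > 0" "of_nat \<kappa> * Y (Node i g) =
      fps_X * (prod_mset (image_mset Y g) * exp_subst (\<lambda>P. b i (P + ?t)) X)"
    using Y_Node by blast
  obtain a where a: "map_fps (tree_coeff (vertex j)) (prod_mset (image_mset Y g)) = fps_const a * fps_X ^ Suc (degree g)"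
    and \<mu>: "\<And>\<mu>. (\<And>s. s \<in># g \<Longrightarrow> vertex_coeff j s = \<mu> s * c s) \<Longrightarrow> a = sum_mset (image_mset \<mu> g) * ?p"
    using map_fps_vertex_coeff_prod_Y[OF assms] by blast
  have n: "?n = Suc (degree g)" by (simp add: degree_def)
  have "of_nat \<kappa> * (fps_const (c (Node i g)) * fps_X ^ ?n) = fps_const (?p * b i ?t) * fps_X ^ ?n"
    using arg_cong[OF \<kappa>(2), of "map_fps counit"]
    unfolding map_fps_of_nat map_fps_X unfolding map_fps_counit_mult map_fps_counit_prod_Y map_fps_counit_exp_subst
      map_fps_counit_Y n
    by (simp add: ac_simps flip: fps_const_mult)
  from arg_cong[OF this, of "\<lambda>x. fps_nth x ?n"]
  have 1: "of_nat \<kappa> * c (Node i g) = ?p * b i ?t"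
    by (simp add: fps_of_nat[symmetric])
  have 2: "of_nat \<kappa> * map_fps (tree_coeff (vertex j)) (Y (Node i g)) =
      fps_const (a * b i ?t + ?p * b i (add_mset j ?t)) * fps_X ^ Suc ?n"
    using arg_cong[OF \<kappa>(2), of "map_fps (tree_coeff (vertex j))"]
    unfolding map_fps_of_nat map_fps_X unfolding map_fps_tree_coeff_mult map_fps_counit_prod_Y a
      map_fps_counit_exp_subst map_fps_vertex_coeff_exp_subst n
    by (simp add: algebra_simps flip: fps_const_mult fps_const_add)
  have 3: "of_nat \<kappa> * tree_coeff (vertex j) (fps_nth (Y (Node i g)) m) =
      (if m = Suc ?n then a * b i ?t + ?p * b i (add_mset j ?t) else 0)" for m
    using arg_cong[OF 2, of "\<lambda>x. fps_nth x m"]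
    by (simp add: fps_of_nat[symmetric] del: power_Suc vertices.simps)
  have "tree_coeff (vertex j) (fps_nth (Y (Node i g)) m) = (if m = Suc ?n then vertex_coeff j (Node i g) else 0)" for m
    using 3[of m] \<kappa>(1) by (auto simp: vertex_coeff_def split: if_splits)
  then show ?A by (intro fps_ext) (simp del: power_Suc vertices.simps)
  have "of_nat \<kappa> * vertex_coeff j (Node i g) = a * b i ?t + ?p * b i (add_mset j ?t)"
    using 3[of "Suc ?n"] by (simp add: vertex_coeff_def)
  then show ?B
    using \<kappa>(1) 1 \<mu> by (intro exI[of _ \<kappa>]) (auto simp: algebra_simps)
qed

lemma map_fps_vertex_coeff_Y:
  "map_fps (tree_coeff (vertex j)) (Y s) = fps_const (vertex_coeff j s) * fps_X ^ Suc (vertices s)"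
proof (induction s)
  case (Node i g)
  then show ?case by (rule tree_coeff_Node(1))
qed

lemma c_Node:
  obtains \<kappa> :: nat where "\<kappa> > 0"
    "of_nat \<kappa> * c (Node i g) = prod_mset (image_mset c g) * b i (image_mset label g)"
proof -
  obtain \<kappa> :: nat where "\<kappa> > 0 \<and>
      of_nat \<kappa> * c (Node i g) = prod_mset (image_mset c g) * b i (image_mset label g)"
    using tree_coeff_Node(2)[of g i i, OF map_fps_vertex_coeff_Y] by (elim exE conjE) blast
  then show thesis using that by blast
qed

lemma c_Node_eq_0_iff:
  "c (Node i g) = 0 \<longleftrightarrow> prod_mset (image_mset c g) = 0 \<or> b i (image_mset label g) = 0"
proof -
  obtain \<kappa> :: nat where \<kappa>: "\<kappa> > 0"
    "of_nat \<kappa> * c (Node i g) = prod_mset (image_mset c g) * b i (image_mset label g)"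
    by (rule c_Node)
  have "c (Node i g) = 0 \<longleftrightarrow> of_nat \<kappa> * c (Node i g) = 0"
    using \<kappa>(1) by simp
  then show ?thesis
    by (simp only: \<kappa>(2) mult_eq_0_iff)
qed

text \<open>Ladders suffice: a root with a single branch only needs one nonzero linear
  coefficient.\<close>

lemma exists_tree:
  assumes "\<And>i. \<exists>j. b i {#j#} \<noteq> 0"
  shows "n \<ge> 1 \<Longrightarrow> \<exists>s. label s = i \<and> vertices s = n \<and> c s \<noteq> 0"
proof (induction n arbitrary: i rule: nat_induct_at_least)
  case base
  show ?case by (intro exI[of _ "vertex i"]) (simp add: c_vertex)
next
  case (Suc n)
  obtain j where j: "b i {#j#} \<noteq> 0" using assms by blast
  obtain s where s: "label s = j" "vertices s = n" "c s \<noteq> 0" using Suc by blast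
  show ?case
    by (intro exI[of _ "Node i {#s#}"]) (simp add: s j c_Node_eq_0_iff)
qed

section \<open>The subalgebra generated by the components of the solution\<close>

definition A :: "('i, 'k) tree_alg set" where
  "A = subalgebra hull {fps_nth (X i) n | i n. True}"

lemma subalgebra_hull: "subalgebra (subalgebra hull S)"
proof -
  have "subalgebra (\<Inter>{T. subalgebra T \<and> S \<subseteq> T})"
    by (auto simp: subalgebra_def scale.subspace_def)
  then show ?thesis by (simp add: hull_def conj_commute)
qed

lemma subalgebra_A: "subalgebra A"
  by (simp add: A_def subalgebra_hull)

lemma subspace_A: "scale.subspace A"
  using subalgebra_A by (simp add: subalgebra_def)

lemma X_in_A: "fps_nth (X i) n \<in> A"
  unfolding A_def by (rule subsetD[OF hull_subset]) blast

lemma A_induct: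
  assumes "x \<in> A" "\<And>i n. fps_nth (X i) n \<in> S" "subalgebra S"
  shows "x \<in> S"
proof -
  have "subalgebra hull {fps_nth (X i) n | i n. True} \<subseteq> S"
    by (rule hull_minimal[where S = subalgebra]) (use assms(2,3) in auto)
  then show ?thesis
    using assms(1) by (auto simp: A_def)
qed

text \<open>Proportionality to \<open>c\<close> on trees of given root and size survives products,
  since by \<open>tree_coeff_mult\<close> each factor enters only through a multiple given by the
  counit of the other.\<close>

lemma tree_coeff_A: "x \<in> A \<Longrightarrow> \<exists>k. \<forall>s. label s = i \<and> vertices s = n \<longrightarrow> tree_coeff s x = k * c s"
proof -
  let ?P = "\<lambda>x. \<exists>k. \<forall>s. label s = i \<and> vertices s = n \<longrightarrow> tree_coeff s x = k * c s"
  have "x \<in> {x. ?P x}" if "x \<in> A"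
    using that
  proof (rule A_induct)
    show "fps_nth (X d) m \<in> {x. ?P x}" for d m
      by (auto simp: tree_coeff_X intro: exI[of _ "if d = i \<and> m = n then 1 else 0"])
    have "?P (x + y)" if "?P x" "?P y" for x y
    proof -
      obtain k k' where "\<forall>s. label s = i \<and> vertices s = n \<longrightarrow> tree_coeff s x = k * c s"
        "\<forall>s. label s = i \<and> vertices s = n \<longrightarrow> tree_coeff s y = k' * c s"
        using \<open>?P x\<close> \<open>?P y\<close> by blast
      then show ?thesis
        by (intro exI[of _ "k + k'"]) (simp add: tree_coeff_def lookup_add distrib_right)
    qed
    moreover have "?P (scale r x)" if "?P x" for r x
    proof -
      obtain k where "\<forall>s. label s = i \<and> vertices s = n \<longrightarrow> tree_coeff s x = k * c s"
        using \<open>?P x\<close> by blast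
      then show ?thesis by (intro exI[of _ "r * k"]) (simp add: tree_coeff_scale)
    qed
    moreover have "?P (x * y)" if "?P x" "?P y" for x y
    proof -
      obtain k k' where "\<forall>s. label s = i \<and> vertices s = n \<longrightarrow> tree_coeff s x = k * c s"
        "\<forall>s. label s = i \<and> vertices s = n \<longrightarrow> tree_coeff s y = k' * c s"
        using \<open>?P x\<close> \<open>?P y\<close> by blast
      then show ?thesis
        by (intro exI[of _ "k * counit y + counit x * k'"]) (simp add: tree_coeff_mult algebra_simps)
    qed
    moreover have "?P 0" "?P 1"
      by (auto simp: tree_coeff_zero tree_coeff_one intro: exI[of _ 0])
    ultimately show "subalgebra {x. ?P x}"
      by (auto simp: subalgebra_def scale.subspace_def)
  qed
  then show "x \<in> A \<Longrightarrow> ?P x" by simp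
qed

section \<open>Necessity\<close>

text \<open>The part to the right of a fixed vertex in an element of \<open>A \<otimes> A\<close>
  lies in \<open>A\<close>, so \<open>tree_coeff_A\<close> applies to it. Degree
  \<open>Suc n\<close> is used because one vertex is split off from trees with \<open>n\<close>
  remaining vertices.\<close>

lemma hopf_imp_vertex_coeff:
  assumes "hopf_subalgebra A"
  shows "\<exists>k. \<forall>s. label s = i \<and> vertices s = n \<longrightarrow> vertex_coeff j s = k * c s"
proof -
  let ?L = "left_coeff {#vertex j#}"
  have "scale.span {tensor x y | x y. x \<in> A \<and> y \<in> A} \<subseteq> {z. ?L z \<in> A}"
  proof (rule scale.span_minimal)
    show "{tensor x y | x y. x \<in> A \<and> y \<in> A} \<subseteq> {z. ?L z \<in> A}"
      using subspace_A by (auto simp: left_coeff_tensor scale.subspace_def)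
    show "scale.subspace {z. ?L z \<in> A}"
      using subspace_A by (auto simp: scale.subspace_def lin_zero[OF lin_left_coeff]
          lin_add[OF lin_left_coeff] lin_scale[OF lin_left_coeff])
  qed
  then have "?L (coprod (fps_nth (X i) (Suc n))) \<in> A"
    using assms X_in_A[of i "Suc n"] unfolding hopf_subalgebra_def by blast
  then obtain k where k: "\<And>s. label s = i \<Longrightarrow> vertices s = n \<Longrightarrow>
      tree_coeff s (?L (coprod (fps_nth (X i) (Suc n)))) = k * c s"
    using tree_coeff_A[of _ i n] by blast
  have "vertex_coeff j s = tree_coeff s (?L (coprod (fps_nth (X i) (Suc n))))" if "label s = i" "vertices s = n" for s
    using that by (simp add: vertex_coeff_def Y_def Z_def tree_coeff_def lookup_right_coeff lookup_left_coeff)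
  then show ?thesis using k by auto
qed

text \<open>The first condition for derivatives at the origin: the factor
  \<open>1 / (p_j + 1)\<close> is absorbed by the factorials.\<close>

definition growth :: "('i \<Rightarrow> 'i \<Rightarrow> nat \<Rightarrow> 'k) \<Rightarrow> bool" where
  "growth lam \<longleftrightarrow> (\<forall>i j P. b i (add_mset j P) =
     (lam i j (Suc (size P)) - (\<Sum>d\<in>#P. b d {#j#})) * b i P)"

text \<open>The second condition with the pairs \<open>(d_l, n_l)\<close> collected in
  \<open>M\<close> and the common linear coefficient of the series \<open>i\<close> cancelled. The
  empty \<open>M\<close> adds only a trivial instance.\<close>

definition additive :: "('i \<Rightarrow> 'i \<Rightarrow> nat \<Rightarrow> 'k) \<Rightarrow> bool" where
  "additive lam \<longleftrightarrow> (\<forall>i j (M :: ('i \<times> nat) multiset). b i (image_mset fst M) \<noteq> 0 \<longrightarrow> (\<forall>q\<in>#M. snd q \<ge> 1) \<longrightarrow>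
     lam i j (Suc (\<Sum>q\<in>#M. snd q)) =
       lam i j (Suc (size M)) + (\<Sum>q\<in>#M. lam (fst q) j (snd q) - b (fst q) {#j#}))"

text \<open>The recursion multiplies the old coefficient by a scalar, so a vanishing coefficient
  stays zero when the multi-index grows.\<close>

lemma growth_subset:
  assumes "growth lam" "b i (Q + R) \<noteq> 0"
  shows "b i Q \<noteq> 0"
  using assms(2)
proof (induction R)
  case (add d R)
  have "b i (add_mset d (Q + R)) = (lam i d (Suc (size (Q + R))) - (\<Sum>e\<in>#Q + R. b e {#d#})) * b i (Q + R)"
    using assms(1) unfolding growth_def by blast
  then show ?case
    using add by auto
qed simp

lemma linear_coeff_nonzero:
  assumes "growth lam" "\<And>i. \<exists>P. P \<noteq> {#} \<and> b i P \<noteq> 0"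
  shows "\<exists>j. b i {#j#} \<noteq> 0"
proof -
  obtain P where "P \<noteq> {#}" "b i P \<noteq> 0" using assms(2) by blast
  then obtain j R where "b i ({#j#} + R) \<noteq> 0"
    by (cases P) auto
  then show ?thesis using growth_subset[OF assms(1)] by blast
qed

lemma hopf_imp_conditions:
  assumes "hopf_subalgebra A" and nonconst: "\<And>i. \<exists>P. P \<noteq> {#} \<and> b i P \<noteq> 0"
  shows "\<exists>lam. growth lam \<and> additive lam"
proof -
  define lam where "lam i j n = (SOME k. \<forall>s. label s = i \<and> vertices s = n \<longrightarrow> vertex_coeff j s = k * c s)" for i j n
  have lam: "vertex_coeff j s = lam i j n * c s" if "label s = i" "vertices s = n" for i j n s
    using someI_ex[OF hopf_imp_vertex_coeff[OF assms(1), of i n j]] that by (simp add: lam_def)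
  \<comment> \<open>The two formulas of \<open>tree_coeff_Node\<close> are compared for the tree
    with branches \<open>g\<close>; the product of the \<open>c s\<close> cancels because none of
    them is 0.\<close>
  have main: "lam i j (Suc (degree g)) * b i (image_mset label g) =
      (\<Sum>s\<in>#g. lam (label s) j (vertices s)) * b i (image_mset label g) + b i (add_mset j (image_mset label g))"
    if "\<And>s. s \<in># g \<Longrightarrow> c s \<noteq> 0" for i j g
  proof -
    let ?p = "prod_mset (image_mset c g)" and ?t = "image_mset label g"
    obtain \<kappa> :: nat where \<kappa>: "\<kappa> > 0" "of_nat \<kappa> * c (Node i g) = ?p * b i ?t"
      "of_nat \<kappa> * vertex_coeff j (Node i g) = ?p * ((\<Sum>s\<in>#g. lam (label s) j (vertices s)) * b i ?t + b i (add_mset j ?t))"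
      using tree_coeff_Node(2)[of g j i, OF map_fps_vertex_coeff_Y]
        lam by (metis (no_types, lifting))
    have "?p \<noteq> 0" using that by auto
    moreover have "vertex_coeff j (Node i g) = lam i j (Suc (degree g)) * c (Node i g)"
      by (rule lam) (simp_all add: degree_def)
    then have "of_nat \<kappa> * vertex_coeff j (Node i g) = lam i j (Suc (degree g)) * (?p * b i ?t)"
      using \<kappa>(2) by (simp add: ac_simps)
    ultimately show ?thesis using \<kappa>(3) by simp
  qed
  have lam1: "lam i j 1 = b i {#j#}" for i j
    using main[of "{#}" i j] by (simp add: b_empty degree_def)
  have growth: "growth lam"
    unfolding growth_def
  proof (intro allI)
    fix i j P
    show "b i (add_mset j P) = (lam i j (Suc (size P)) - (\<Sum>d\<in>#P. b d {#j#})) * b i P"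
    proof -
      have "c s \<noteq> 0" if "s \<in># image_mset vertex P" for s
        using that by (auto simp: c_vertex)
      from main[of "image_mset vertex P" i j, OF this] show ?thesis
        using lam1 by (simp add: degree_def image_mset.compositionality o_def algebra_simps)
    qed
  qed
  \<comment> \<open>Every pair in \<open>M\<close> can be realised by a branch with prescribed root,
    prescribed size and nonzero coefficient.\<close>
  have "\<exists>s. label s = i \<and> vertices s = n \<and> c s \<noteq> 0" if "n \<ge> 1" for i n
    using exists_tree[OF linear_coeff_nonzero[OF growth nonconst] that] .
  then have "\<exists>s. snd q \<ge> 1 \<longrightarrow> label s = fst q \<and> vertices s = snd q \<and> c s \<noteq> 0" for q
    by blast
  then obtain t where t: "\<And>q. snd q \<ge> 1 \<Longrightarrow> label (t q) = fst q \<and> vertices (t q) = snd q \<and> c (t q) \<noteq> 0"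
    by metis
  have "additive lam"
    unfolding additive_def
  proof (intro allI impI)
    fix i j and M :: "('i \<times> nat) multiset"
    assume nz: "b i (image_mset fst M) \<noteq> 0" and M: "\<forall>q\<in>#M. snd q \<ge> 1"
    let ?g = "image_mset t M"
    have tq: "label (t q) = fst q" "vertices (t q) = snd q" "c (t q) \<noteq> 0" if "q \<in># M" for q
      using t[of q] M that by auto
    have nz_g: "c s \<noteq> 0" if s: "s \<in># ?g" for s
    proof -
      have "s \<in> t ` set_mset M" using s by (simp only: set_image_mset)
      then obtain q where "s = t q" "q \<in># M" by (rule imageE)
      then show ?thesis by (simp only: tq(3) not_False_eq_True)
    qed
    have g: "image_mset label ?g = image_mset fst M" "degree ?g = (\<Sum>q\<in>#M. snd q)"
      "(\<Sum>s\<in>#?g. lam (label s) j (vertices s)) = (\<Sum>q\<in>#M. lam (fst q) j (snd q))"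
      by (auto simp: degree_def image_mset.compositionality o_def tq intro!: image_mset_cong arg_cong[of _ _ sum_mset])
    let ?B = "b i (image_mset fst M)" and ?L = "lam i j (Suc (\<Sum>q\<in>#M. snd q))"
    let ?K = "lam i j (Suc (size M))"
    let ?S = "\<Sum>q\<in>#M. lam (fst q) j (snd q)" and ?T = "\<Sum>q\<in>#M. b (fst q) {#j#}"
    have "b i (add_mset j (image_mset fst M)) =
        (lam i j (Suc (size (image_mset fst M))) - (\<Sum>d\<in>#image_mset fst M. b d {#j#})) * ?B"
      using growth unfolding growth_def by blast
    also have "(\<Sum>d\<in>#image_mset fst M. b d {#j#}) = ?T"
      by (simp only: image_mset.compositionality o_def)
    also have "size (image_mset fst M) = size M"
      by (rule size_image_mset)
    \<comment> \<open>Replacing the coefficient of the larger multi-index by means of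
      \<open>growth\<close> makes \<open>?B\<close> a common factor, which is then
      cancelled.\<close>
    finally have "?L * ?B = ?S * ?B + (?K - ?T) * ?B"
      using main[of ?g i j, OF nz_g] unfolding g by (rule subst)
    also have "\<dots> = (?K + (?S - ?T)) * ?B"
      by (simp only: distrib_right left_diff_distrib add_diff_eq diff_add_eq add.commute)
    finally have "?L = ?K + (?S - ?T)"
      by (rule mult_right_cancel[OF nz, THEN iffD1])
    also have "?S - ?T = (\<Sum>q\<in>#M. lam (fst q) j (snd q) - b (fst q) {#j#})"
      by (induction M) (simp_all add: algebra_simps)
    finally show "?L = ?K + (\<Sum>q\<in>#M. lam (fst q) j (snd q) - b (fst q) {#j#})" .
  qed
  then show ?thesis using growth by blast
qed

end

section \<open>Products of series and the growth recursion\<close>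

definition conv :: "('i multiset \<Rightarrow> 'k::comm_ring_1) \<Rightarrow> ('i multiset \<Rightarrow> 'k) \<Rightarrow> 'i multiset \<Rightarrow> 'k" where
  "conv \<phi> \<psi> P = (\<Sum>Q | Q \<subseteq># P. \<phi> Q * \<psi> (P - Q))"

lemma finite_submultisets: "finite {Q :: 'i::finite multiset. Q \<subseteq># P}"
  by (rule finite_subset[OF _ finite_size_le[of "size P"]]) (auto simp: size_mset_mono)

lemma msubst_mult:
  assumes x0: "\<And>d. fps_nth (x d) 0 = 0"
  shows "msubst \<phi> x * msubst \<psi> x = msubst (conv \<phi> \<psi>) x"
proof (rule fps_ext)
  fix n
  let ?S = "{P :: 'a multiset. size P \<le> n}"
  let ?f = "\<lambda>Q R. scale (\<phi> Q * \<psi> R) (fps_nth (monomial x (Q + R)) n)"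
  have "fps_nth (msubst \<phi> x * msubst \<psi> x) n =
      (\<Sum>k=0..n. (\<Sum>Q\<in>?S. scale (\<phi> Q) (fps_nth (monomial x Q) k)) *
        (\<Sum>R\<in>?S. scale (\<psi> R) (fps_nth (monomial x R) (n - k))))"
    unfolding fps_mult_nth by (intro sum.cong refl) (simp add: msubst_nth[OF x0, of _ n])
  also have "\<dots> = (\<Sum>k=0..n. \<Sum>Q\<in>?S. \<Sum>R\<in>?S.
      scale (\<phi> Q * \<psi> R) (fps_nth (monomial x Q) k * fps_nth (monomial x R) (n - k)))"
    by (simp add: sum_product scale_mult_left scale_mult_right mult.commute)
  also have "\<dots> = (\<Sum>Q\<in>?S. \<Sum>k=0..n. \<Sum>R\<in>?S.
      scale (\<phi> Q * \<psi> R) (fps_nth (monomial x Q) k * fps_nth (monomial x R) (n - k)))"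
    by (rule sum.swap)
  also have "\<dots> = (\<Sum>Q\<in>?S. \<Sum>R\<in>?S. ?f Q R)"
    by (intro sum.cong refl, subst sum.swap)
      (simp add: monomial_union fps_mult_nth scale.scale_sum_right)
  also have "\<dots> = (\<Sum>(Q, R)\<in>?S \<times> ?S. ?f Q R)"
    by (rule sum.cartesian_product)
  also have "\<dots> = (\<Sum>(Q, R) | size Q + size R \<le> n. ?f Q R)"
  proof (rule sum.mono_neutral_right)
    have "size Q + size R \<le> n" if "fps_nth (monomial x (Q + R)) n \<noteq> 0" for Q R
      using that monomial_nth_less[of x n "Q + R", OF x0] by (metis not_le size_union)
    then show "\<forall>p\<in>?S \<times> ?S - {(Q, R). size Q + size R \<le> n}. (case p of (Q, R) \<Rightarrow> ?f Q R) = 0"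
      by auto
  qed (auto intro: finite_cartesian_product finite_size_le)
  \<comment> \<open>A pair \<open>(Q, R)\<close> is recorded as the total multi-index
    \<open>P = Q + R\<close> together with its part \<open>Q\<close>.\<close>
  also have "\<dots> = (\<Sum>(P, Q)\<in>(SIGMA P:?S. {Q. Q \<subseteq># P}). ?f Q (P - Q))"
    by (rule sum.reindex_bij_witness[of _ "\<lambda>(P, Q). (Q, P - Q)" "\<lambda>(Q, R). (Q + R, Q)"])
      (auto simp: size_Diff_submset size_mset_mono)
  also have "\<dots> = (\<Sum>P\<in>?S. \<Sum>Q | Q \<subseteq># P. ?f Q (P - Q))"
    by (rule sum.Sigma[symmetric]) (auto simp: finite_size_le finite_submultisets)
  also have "\<dots> = (\<Sum>P\<in>?S. scale (conv \<phi> \<psi> P) (fps_nth (monomial x P) n))"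
    by (intro sum.cong refl) (simp add: conv_def scale.scale_sum_left)
  finally show "fps_nth (msubst \<phi> x * msubst \<psi> x) n = fps_nth (msubst (conv \<phi> \<psi>) x) n"
    by (simp add: msubst_def)
qed

lemma sum_submultisets_count:
  fixes h :: "'i::finite multiset \<Rightarrow> 'k::comm_ring_1"
  shows "(\<Sum>Q | Q \<subseteq># add_mset j P. of_nat (count Q j) * h Q) =
     (\<Sum>Q | Q \<subseteq># P. of_nat (Suc (count Q j)) * h (add_mset j Q))"
proof -
  have "(\<Sum>Q | Q \<subseteq># add_mset j P. of_nat (count Q j) * h Q) =
      (\<Sum>Q\<in>{Q. Q \<subseteq># add_mset j P \<and> j \<in># Q}. of_nat (count Q j) * h Q)"
    by (rule sum.mono_neutral_right) (auto simp: finite_submultisets not_in_iff)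
  also have "\<dots> = (\<Sum>Q | Q \<subseteq># P. of_nat (Suc (count Q j)) * h (add_mset j Q))"
    by (rule sum.reindex_bij_witness[of _ "add_mset j" "\<lambda>Q. Q - {#j#}"])
      (auto simp: subset_eq_diff_conv)
  finally show ?thesis .
qed

lemma sum_submultisets_swap:
  "(\<Sum>Q | Q \<subseteq># P. f Q (P - Q)) = (\<Sum>Q | Q \<subseteq># P. f (P - Q) Q)"
proof -
  have "P - (P - Q) = Q" if "Q \<subseteq># P" for Q
    using that by (auto simp: multiset_eq_iff subseteq_mset_def)
  then show ?thesis
    by (intro sum.reindex_bij_witness[of _ "\<lambda>Q. P - Q" "\<lambda>Q. P - Q"]) auto
qed

text \<open>The product rule for \<open>\<partial>_j\<close> on coefficients: the exponent of
  \<open>j\<close> in the product is split between the two factors.\<close>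

lemma conv_Suc:
  fixes \<phi> \<psi> :: "'i::finite multiset \<Rightarrow> 'k::comm_ring_1"
  shows "of_nat (Suc (count P j)) * conv \<phi> \<psi> (add_mset j P) =
     (\<Sum>Q | Q \<subseteq># P. of_nat (Suc (count Q j)) * \<phi> (add_mset j Q) * \<psi> (P - Q) +
        \<phi> Q * (of_nat (Suc (count (P - Q) j)) * \<psi> (add_mset j (P - Q))))"
proof -
  let ?P = "add_mset j P"
  have "of_nat (Suc (count P j)) * conv \<phi> \<psi> ?P =
      (\<Sum>Q | Q \<subseteq># ?P. of_nat (Suc (count P j)) * (\<phi> Q * \<psi> (?P - Q)))"
    by (simp only: conv_def sum_distrib_left)
  also have "\<dots> =
      (\<Sum>Q | Q \<subseteq># ?P. of_nat (count Q j) * (\<phi> Q * \<psi> (?P - Q)) +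
        of_nat (count (?P - Q) j) * (\<phi> Q * \<psi> (?P - Q)))"
  proof (rule sum.cong[OF refl])
    fix Q assume "Q \<in> {Q. Q \<subseteq># ?P}"
    then have "count Q j \<le> count ?P j" by (simp add: mset_subset_eq_count del: count_add_mset)
    then have "Suc (count P j) = count Q j + count (?P - Q) j" by simp
    then show "of_nat (Suc (count P j)) * (\<phi> Q * \<psi> (?P - Q)) =
        of_nat (count Q j) * (\<phi> Q * \<psi> (?P - Q)) + of_nat (count (?P - Q) j) * (\<phi> Q * \<psi> (?P - Q))"
      by (simp only: of_nat_add distrib_right)
  qed
  also have "\<dots> = (\<Sum>Q | Q \<subseteq># ?P. of_nat (count Q j) * (\<phi> Q * \<psi> (?P - Q))) +
        (\<Sum>Q | Q \<subseteq># ?P. of_nat (count Q j) * (\<phi> (?P - Q) * \<psi> Q))"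
    unfolding sum.distrib
      sum_submultisets_swap[of "\<lambda>Q R. of_nat (count R j) * (\<phi> Q * \<psi> R)" ?P] ..
  also have "\<dots> = (\<Sum>Q | Q \<subseteq># P. of_nat (Suc (count Q j)) * (\<phi> (add_mset j Q) * \<psi> (P - Q))) +
        (\<Sum>Q | Q \<subseteq># P. of_nat (Suc (count Q j)) * (\<phi> (P - Q) * \<psi> (add_mset j Q)))"
    unfolding sum_submultisets_count by simp
  also have "(\<Sum>Q | Q \<subseteq># P. of_nat (Suc (count Q j)) * (\<phi> (P - Q) * \<psi> (add_mset j Q))) =
      (\<Sum>Q | Q \<subseteq># P. of_nat (Suc (count (P - Q) j)) * (\<phi> Q * \<psi> (add_mset j (P - Q))))"
    by (rule sum_submultisets_swap[of "\<lambda>R Q. of_nat (Suc (count R j)) * (\<phi> Q * \<psi> (add_mset j R))" P])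
  finally show ?thesis
    by (simp only: sum.distrib[symmetric] mult.assoc mult.left_commute[of "\<phi> _"])
qed

text \<open>
  In generating functions \<open>grows w \<alpha>\<close> reads
  \<open>\<partial>\<^sub>j \<psi> + (\<Sum>\<^sub>d w d j \<sqdot> h\<^sub>d \<sqdot> \<partial>\<^sub>d \<psi>) = \<alpha>\<^sub>j(E) \<psi>\<close> with the Euler operator \<open>E\<close>. The left-hand
  side is a derivation, hence the stability under products.
\<close>

definition grows ::
  "('i \<Rightarrow> 'i \<Rightarrow> 'k::field_char_0) \<Rightarrow> ('i \<Rightarrow> nat \<Rightarrow> 'k) \<Rightarrow> ('i multiset \<Rightarrow> 'k) \<Rightarrow> bool" where
  "grows w \<alpha> \<psi> \<longleftrightarrow> (\<forall>j P. of_nat (Suc (count P j)) * \<psi> (add_mset j P) =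
     (\<alpha> j (size P) - (\<Sum>d\<in>#P. w d j)) * \<psi> P)"

text \<open>The recursion determines a solution from its constant term. The two scalars express
  proportionality of solutions without dividing by constant terms that may be 0.\<close>

lemma grows_unique:
  assumes "grows w \<alpha> \<phi>" "grows w \<alpha> \<psi>" "k * \<phi> {#} = m * \<psi> {#}"
  shows "k * \<phi> P = m * \<psi> P"
proof (induction P)
  case (add j P)
  let ?n = "of_nat (Suc (count P j)) :: 'b"
  have "?n * (k * \<phi> (add_mset j P)) = k * (?n * \<phi> (add_mset j P))"
    by (simp only: mult.left_commute)
  also have "\<dots> = (\<alpha> j (size P) - (\<Sum>d\<in>#P. w d j)) * (k * \<phi> P)"
    using assms(1) by (simp add: grows_def del: of_nat_Suc)
  also have "\<dots> = m * (?n * \<psi> (add_mset j P))"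
    using assms(2) by (simp add: add grows_def del: of_nat_Suc)
  also have "\<dots> = ?n * (m * \<psi> (add_mset j P))"
    by (simp only: mult.left_commute)
  finally show ?case by (simp del: of_nat_Suc)
qed (use assms(3) in simp)

text \<open>The rates only have to add up where both factors are nonzero. This restriction is
  essential later, when the addition law comes from \<open>additive\<close>.\<close>

lemma grows_conv:
  fixes \<phi> \<psi> :: "'i::finite multiset \<Rightarrow> 'k::field_char_0"
  assumes \<phi>: "grows w \<alpha> \<phi>" and \<psi>: "grows w \<beta> \<psi>"
    and \<gamma>: "\<And>j P Q. \<phi> P \<noteq> 0 \<Longrightarrow> \<psi> Q \<noteq> 0 \<Longrightarrow> \<alpha> j (size P) + \<beta> j (size Q) = \<gamma> j (size P + size Q)"
  shows "grows w \<gamma> (conv \<phi> \<psi>)"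
  unfolding grows_def conv_Suc
proof (intro allI)
  fix j P
  let ?w = "\<lambda>P. \<Sum>d\<in>#P. w d j"
  have "of_nat (Suc (count Q j)) * \<phi> (add_mset j Q) * \<psi> (P - Q) +
      \<phi> Q * (of_nat (Suc (count (P - Q) j)) * \<psi> (add_mset j (P - Q))) =
      (\<gamma> j (size P) - ?w P) * (\<phi> Q * \<psi> (P - Q))" if "Q \<subseteq># P" for Q
  proof -
    have "of_nat (Suc (count Q j)) * \<phi> (add_mset j Q) * \<psi> (P - Q) +
        \<phi> Q * (of_nat (Suc (count (P - Q) j)) * \<psi> (add_mset j (P - Q))) =
        (\<alpha> j (size Q) - ?w Q) * \<phi> Q * \<psi> (P - Q) + \<phi> Q * ((\<beta> j (size (P - Q)) - ?w (P - Q)) * \<psi> (P - Q))"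
      using \<phi> \<psi> by (simp only: grows_def)
    also have "\<dots> = (\<alpha> j (size Q) + \<beta> j (size (P - Q)) - (?w Q + ?w (P - Q))) * (\<phi> Q * \<psi> (P - Q))"
      by (simp add: algebra_simps)
    also have "?w Q + ?w (P - Q) = ?w P"
      using that by (metis image_mset_union subset_mset.add_diff_inverse sum_mset.union)
    also have "(\<alpha> j (size Q) + \<beta> j (size (P - Q)) - ?w P) * (\<phi> Q * \<psi> (P - Q)) =
        (\<gamma> j (size P) - ?w P) * (\<phi> Q * \<psi> (P - Q))"
    proof (cases "\<phi> Q = 0 \<or> \<psi> (P - Q) = 0")
      case False
      moreover have "size Q + size (P - Q) = size P"
        using that by (simp add: size_Diff_submset size_mset_mono)
      ultimately show ?thesis using \<gamma>[of Q "P - Q" j] by simp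
    qed auto
    finally show ?thesis .
  qed
  then show "(\<Sum>Q | Q \<subseteq># P. of_nat (Suc (count Q j)) * \<phi> (add_mset j Q) * \<psi> (P - Q) +
        \<phi> Q * (of_nat (Suc (count (P - Q) j)) * \<psi> (add_mset j (P - Q)))) =
      (\<gamma> j (size P) - ?w P) * conv \<phi> \<psi> P"
    by (simp only: conv_def sum_distrib_left) (rule sum.cong, auto)
qed

lemma conv_nonzero: "conv \<phi> \<psi> P \<noteq> 0 \<Longrightarrow> \<exists>Q. Q \<subseteq># P \<and> \<phi> Q \<noteq> 0 \<and> \<psi> (P - Q) \<noteq> 0"
  unfolding conv_def by (metis (mono_tags, lifting) mem_Collect_eq mult_zero_left mult_zero_right sum.neutral)

lemma msubst_in_subalgebra:
  assumes B: "subalgebra B" and x: "\<And>d k. k \<le> n \<Longrightarrow> fps_nth (x d) k \<in> B"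
  shows "fps_nth (msubst \<phi> x) n \<in> B"
proof -
  have sp: "scale.subspace B" and mult: "\<And>x y. x \<in> B \<Longrightarrow> y \<in> B \<Longrightarrow> x * y \<in> B" and one: "1 \<in> B"
    using B by (auto simp: subalgebra_def)
  have "k \<le> n \<Longrightarrow> fps_nth (monomial x P) k \<in> B" for k P
  proof (induction P arbitrary: k)
    case empty
    then show ?case using one scale.subspace_0[OF sp] by simp
  next
    case (add d P)
    then show ?case
      using x by (auto simp: fps_mult_nth intro!: scale.subspace_sum[OF sp] mult)
  qed
  then show ?thesis
    by (auto simp: msubst_def intro!: scale.subspace_sum[OF sp] scale.subspace_scale[OF sp])
qed

lemma vertices_pos: "vertices s \<ge> 1"
  by (cases s) simp

section \<open>Sufficiency\<close>

context dyson_schwinger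
begin

text \<open>\<open>N\<close> is the total weight of an instance of the second condition over a
  nonzero coefficient in which the entries of \<open>Q\<close> still have weight 1. These are the
  places reserved for trees whose factor \<open>Y\<close> has not been multiplied in yet.\<close>

definition realizable :: "'i \<Rightarrow> 'i multiset \<Rightarrow> nat \<Rightarrow> bool" where
  "realizable i Q N \<longleftrightarrow> (\<exists>M. image_mset (\<lambda>d. (d, 1)) Q \<subseteq># M \<and> b i (image_mset fst M) \<noteq> 0 \<and>
     (\<forall>q\<in>#M. snd q \<ge> 1) \<and> (\<Sum>q\<in>#M. snd q) = N)"

text \<open>One reserved entry \<open>(d, 1)\<close> becomes \<open>(d, n)\<close>. The two
  instances of \<open>additive\<close> have the same roots and the same number of entries, so they
  differ only in the summand of this entry.\<close>

lemma realizable_replace: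
  assumes "realizable i (add_mset d Q) N" "n \<ge> 1"
  shows "realizable i Q (N - 1 + n)"
    and "additive lam \<Longrightarrow> growth lam \<Longrightarrow>
      lam i j (Suc (N - 1 + n)) = lam i j (Suc N) + lam d j n - b d {#j#}"
proof -
  obtain M where M: "image_mset (\<lambda>d. (d, 1)) (add_mset d Q) \<subseteq># M" "b i (image_mset fst M) \<noteq> 0"
    "\<forall>q\<in>#M. snd q \<ge> 1" "(\<Sum>q\<in>#M. snd q) = N"
    using assms(1) by (auto simp: realizable_def)
  define M' where "M' = M - {#(d, 1)#}"
  have M': "M = add_mset (d, 1) M'"
    using M(1) by (simp add: M'_def insert_subset_eq_iff)
  let ?M = "add_mset (d, n) M'"
  have N: "(\<Sum>q\<in>#?M. snd q) = N - 1 + n" using M(4) by (simp add: M')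
  have nz: "b i (image_mset fst ?M) \<noteq> 0" using M(2) by (simp add: M')
  have pos: "\<forall>q\<in>#?M. snd q \<ge> 1" using M(3) assms(2) by (simp add: M')
  have "image_mset (\<lambda>d. (d, 1)) Q \<subseteq># M'" using M(1) by (simp add: M')
  then have "image_mset (\<lambda>d. (d, 1)) Q \<subseteq># ?M"
    by (rule subset_mset.order_trans) simp
  then show "realizable i Q (N - 1 + n)"
    using N nz pos unfolding realizable_def by blast
  assume lam: "additive lam" "growth lam"
  \<comment> \<open>Hence the summand of an entry of weight 1 is 0.\<close>
  have "lam d j 1 = b d {#j#}"
    using lam(2)[unfolded growth_def, rule_format, of d j "{#}"] by (simp add: b_empty)
  moreover have "lam i j (Suc (\<Sum>q\<in>#M. snd q)) =
      lam i j (Suc (size M)) + (\<Sum>q\<in>#M. lam (fst q) j (snd q) - b (fst q) {#j#})"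
    using lam(1) M(2,3) unfolding additive_def by blast
  moreover have "lam i j (Suc (\<Sum>q\<in>#?M. snd q)) =
      lam i j (Suc (size ?M)) + (\<Sum>q\<in>#?M. lam (fst q) j (snd q) - b (fst q) {#j#})"
    using lam(1) nz pos unfolding additive_def by blast
  ultimately show "lam i j (Suc (N - 1 + n)) = lam i j (Suc N) + lam d j n - b d {#j#}"
    unfolding N M(4) by (simp add: M')
qed

abbreviation w :: "'i \<Rightarrow> 'i \<Rightarrow> 'k" where
  "w \<equiv> \<lambda>d j. b d {#j#}"

text \<open>\<open>Q\<close> is generalised so that the induction can move the root of each tree
  from \<open>g\<close> into \<open>Q\<close>, as a reserved entry, and then fill it by multiplying
  with \<open>Y s\<close>. The rate of the product has one correction \<open>w d j\<close> for each
  entry still reserved; \<open>realizable_replace\<close> shows that the factor \<open>Y s\<close>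
  removes its own correction. The last clause supplies the nonvanishing that \<open>additive\<close>
  asks for.\<close>

lemma prod_Y_series:
  assumes lam: "growth lam" "additive lam"
    and Y: "\<And>s. s \<in># g \<Longrightarrow> \<exists>\<psi>. Y s = fps_X ^ vertices s * msubst \<psi> X \<and>
      grows w (\<lambda>j m. lam (label s) j (vertices s + m)) \<psi>"
  shows "\<exists>\<psi>. prod_mset (image_mset Y g) * exp_subst (\<lambda>P. b i (P + Q + image_mset label g)) X =
        fps_X ^ degree g * msubst \<psi> X \<and>
      grows w (\<lambda>j m. lam i j (Suc (degree g + size Q + m)) - (\<Sum>d\<in>#Q. w d j)) \<psi> \<and>
      (\<forall>P. \<psi> P \<noteq> 0 \<longrightarrow> realizable i Q (degree g + size Q + size P))"
  using Y
proof (induction g arbitrary: Q)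
  case empty
  let ?\<psi> = "\<lambda>P. b i (P + Q) / (\<Prod>d\<in>UNIV. fact (count P d))"
  have "of_nat (Suc (count P j)) * ?\<psi> (add_mset j P) =
      (lam i j (Suc (size Q + size P)) - (\<Sum>d\<in>#Q. w d j) - (\<Sum>d\<in>#P. w d j)) * ?\<psi> P" for j P
  proof -
    have "of_nat (Suc (count P j)) * ?\<psi> (add_mset j P) = b i (add_mset j (P + Q)) / (\<Prod>d\<in>UNIV. fact (count P d))"
      by (simp add: prod_fact_add_mset del: of_nat_Suc count_add_mset)
    also have "b i (add_mset j (P + Q)) =
        (lam i j (Suc (size (P + Q))) - (\<Sum>d\<in>#P + Q. w d j)) * b i (P + Q)"
      using lam(1) unfolding growth_def by blast
    finally have *: "of_nat (Suc (count P j)) * ?\<psi> (add_mset j P) =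
        (lam i j (Suc (size (P + Q))) - (\<Sum>d\<in>#P + Q. w d j)) * b i (P + Q) / (\<Prod>d\<in>UNIV. fact (count P d))" .
    have size: "size (P + Q) = size Q + size P" and sum: "(\<Sum>d\<in>#P + Q. w d j) = (\<Sum>d\<in>#Q. w d j) + (\<Sum>d\<in>#P. w d j)"
      by simp_all
    show ?thesis
      using * unfolding size sum diff_diff_eq times_divide_eq_right .
  qed
  then have "grows w (\<lambda>j m. lam i j (Suc (degree {#} + size Q + m)) - (\<Sum>d\<in>#Q. w d j)) ?\<psi>"
    by (simp add: grows_def degree_def del: of_nat_Suc)
  moreover have "realizable i Q (degree {#} + size Q + size P)" if "?\<psi> P \<noteq> 0" for P
    unfolding realizable_def
    \<comment> \<open>Before any factor is multiplied in, all entries have weight 1.\<close>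
    by (rule exI[of _ "image_mset (\<lambda>d. (d, 1)) (P + Q)"])
      (use that in \<open>auto simp: image_mset.compositionality o_def degree_def\<close>)
  moreover have "prod_mset (image_mset Y {#}) * exp_subst (\<lambda>P. b i (P + Q + image_mset label {#})) X =
      fps_X ^ degree {#} * msubst ?\<psi> X"
    by (simp add: exp_subst_def degree_def)
  ultimately show ?case by blast
next
  case (add s g)
  let ?d = "label s" and ?v = "vertices s"
  obtain \<phi> where \<phi>: "Y s = fps_X ^ ?v * msubst \<phi> X" "grows w (\<lambda>j m. lam ?d j (?v + m)) \<phi>"
    using add.prems[of s] by auto
  obtain \<psi> where \<psi>: "prod_mset (image_mset Y g) * exp_subst (\<lambda>P. b i (P + add_mset ?d Q + image_mset label g)) X =
        fps_X ^ degree g * msubst \<psi> X"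
    "grows w (\<lambda>j m. lam i j (Suc (degree g + size (add_mset ?d Q) + m)) - (\<Sum>d\<in>#add_mset ?d Q. w d j)) \<psi>"
    "\<And>P. \<psi> P \<noteq> 0 \<Longrightarrow> realizable i (add_mset ?d Q) (degree g + size (add_mset ?d Q) + size P)"
    \<comment> \<open>The root of \<open>s\<close> is reserved first.\<close>
    using add.IH[of "add_mset ?d Q"] add.prems by auto
  have deg: "degree (add_mset s g) = ?v + degree g" by (simp add: degree_def)
  have "prod_mset (image_mset Y (add_mset s g)) * exp_subst (\<lambda>P. b i (P + Q + image_mset label (add_mset s g))) X =
      Y s * (prod_mset (image_mset Y g) * exp_subst (\<lambda>P. b i (P + add_mset ?d Q + image_mset label g)) X)"
    by (simp add: mult.assoc)
  also have "\<dots> = fps_X ^ degree (add_mset s g) * (msubst \<phi> X * msubst \<psi> X)"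
    unfolding \<phi>(1) \<psi>(1) deg by (simp add: power_add ac_simps)
  also have "\<dots> = fps_X ^ degree (add_mset s g) * msubst (conv \<phi> \<psi>) X"
    by (simp add: msubst_mult[OF X_0])
  finally have 1: "prod_mset (image_mset Y (add_mset s g)) *
      exp_subst (\<lambda>P. b i (P + Q + image_mset label (add_mset s g))) X =
      fps_X ^ degree (add_mset s g) * msubst (conv \<phi> \<psi>) X" .
  have 2: "grows w (\<lambda>j m. lam i j (Suc (degree (add_mset s g) + size Q + m)) - (\<Sum>d\<in>#Q. w d j)) (conv \<phi> \<psi>)"
  proof (rule grows_conv[OF \<phi>(2) \<psi>(2)])
    fix j P R
    assume "\<phi> P \<noteq> 0" "\<psi> R \<noteq> 0"
    then have L: "lam i j (Suc (degree g + size (add_mset ?d Q) + size R - 1 + (?v + size P))) =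
        lam i j (Suc (degree g + size (add_mset ?d Q) + size R)) + lam ?d j (?v + size P) - w ?d j"
      using \<psi>(3) vertices_pos[of s] lam by (intro realizable_replace(2)) auto
    have E: "degree g + size (add_mset ?d Q) + size R - 1 + (?v + size P) =
        degree (add_mset s g) + size Q + (size P + size R)"
      by (simp add: deg)
    show "lam ?d j (?v + size P) + (lam i j (Suc (degree g + size (add_mset ?d Q) + size R)) -
        (\<Sum>d\<in>#add_mset ?d Q. w d j)) =
        lam i j (Suc (degree (add_mset s g) + size Q + (size P + size R))) - (\<Sum>d\<in>#Q. w d j)"
      using L unfolding E by simp
  qed
  have 3: "realizable i Q (degree (add_mset s g) + size Q + size P)" if nz: "conv \<phi> \<psi> P \<noteq> 0" for P
  proof -
    obtain R where R: "R \<subseteq># P" "\<phi> R \<noteq> 0" "\<psi> (P - R) \<noteq> 0"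
      using conv_nonzero[OF nz] by blast
    have "realizable i Q (degree g + size (add_mset ?d Q) + size (P - R) - 1 + (?v + size R))"
      using \<psi>(3)[OF R(3)] vertices_pos[of s] by (intro realizable_replace(1)) auto
    moreover have "size (P - R) + size R = size P"
      using R(1) by (simp add: size_Diff_submset size_mset_mono)
    then have "degree g + size (add_mset ?d Q) + size (P - R) - 1 + (?v + size R) =
        degree (add_mset s g) + size Q + size P"
      by (simp add: deg)
    ultimately show ?thesis by (simp only:)
  qed
  show ?case using 1 2 3 by blast
qed

lemma Y_series_exists:
  assumes lam: "growth lam" "additive lam"
  shows "\<exists>\<psi>. Y s = fps_X ^ vertices s * msubst \<psi> X \<and> grows w (\<lambda>j m. lam (label s) j (vertices s + m)) \<psi>"
proof (induction s)
  case (Node i g)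
  obtain \<psi> where \<psi>: "prod_mset (image_mset Y g) * exp_subst (\<lambda>P. b i (P + {#} + image_mset label g)) X =
        fps_X ^ degree g * msubst \<psi> X"
    "grows w (\<lambda>j m. lam i j (Suc (degree g + size {#} + m)) - (\<Sum>d\<in>#{#}. w d j)) \<psi>"
    using prod_Y_series[OF lam Node, where i = i and Q = "{#}"] by auto
  obtain \<kappa> :: nat where \<kappa>: "\<kappa> > 0" "of_nat \<kappa> * Y (Node i g) =
      fps_X * (prod_mset (image_mset Y g) * exp_subst (\<lambda>P. b i (P + image_mset label g)) X)"
    by (rule Y_Node)
  let ?\<psi> = "\<lambda>P. \<psi> P / of_nat \<kappa>"
  have "Y (Node i g) = fps_X ^ Suc (degree g) * msubst ?\<psi> X"
  proof (rule fps_ext)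
    fix n
    have "of_nat \<kappa> * msubst ?\<psi> X = msubst \<psi> X"
      by (rule fps_ext) (use \<kappa>(1) in \<open>simp add: msubst_def fps_of_nat[symmetric] of_nat_mult_eq_scale
          scale.scale_sum_right\<close>)
    then have "of_nat \<kappa> * (fps_X ^ Suc (degree g) * msubst ?\<psi> X) = fps_X ^ Suc (degree g) * msubst \<psi> X"
      by (simp only: mult.left_commute[of "of_nat \<kappa>"])
    also have "\<dots> = of_nat \<kappa> * Y (Node i g)"
      using \<psi>(1) by (simp only: \<kappa>(2) add_0_right power_Suc mult.assoc)
    finally have "of_nat \<kappa> * (fps_X ^ Suc (degree g) * msubst ?\<psi> X) = of_nat \<kappa> * Y (Node i g)" .
    from arg_cong[OF this, of "\<lambda>x. fps_nth x n"]
    show "fps_nth (Y (Node i g)) n = fps_nth (fps_X ^ Suc (degree g) * msubst ?\<psi> X) n"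
      using \<kappa>(1) by (simp add: fps_of_nat[symmetric] of_nat_mult_eq_scale del: power_Suc)
  qed
  moreover have "grows w (\<lambda>j m. lam i j (Suc (degree g) + m)) ?\<psi>"
    using \<psi>(2) by (simp add: grows_def field_simps del: of_nat_Suc)
  ultimately show ?case
    by (intro exI[of _ ?\<psi>]) (simp add: degree_def)
qed

text \<open>The counit keeps only the constant term of a series in the solution, which is thereby
  identified with \<open>c s\<close>.\<close>

lemma Y_series:
  assumes "growth lam" "additive lam"
  obtains \<psi> where "Y s = fps_X ^ vertices s * msubst \<psi> X"
    "grows w (\<lambda>j m. lam (label s) j (vertices s + m)) \<psi>" "\<psi> {#} = c s"
proof -
  obtain \<psi> where \<psi>: "Y s = fps_X ^ vertices s * msubst \<psi> X"
    "grows w (\<lambda>j m. lam (label s) j (vertices s + m)) \<psi>"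
    using Y_series_exists[OF assms] by blast
  have X: "map_fps counit (fps_X ^ n * x) = fps_X ^ n * map_fps counit x"
    for n and x :: "('i, 'k) tree_alg fps"
    by (induction n) (simp_all add: mult.assoc map_fps_X)
  have "fps_const (c s) * fps_X ^ vertices s = fps_X ^ vertices s * fps_const (\<psi> {#})"
    using map_fps_counit_Y[of s] unfolding \<psi>(1) X map_fps_counit_msubst by simp
  then have "fps_const (c s) = fps_const (\<psi> {#})"
    by (simp add: mult.commute)
  from arg_cong[OF this, of "\<lambda>x. fps_nth x 0"] have "\<psi> {#} = c s"
    by simp
  then show thesis using that \<psi> by blast
qed

text \<open>A tree has at least one vertex, so the power of \<open>fps_X\<close> in
  \<open>Y s\<close> leaves only components of the solution of degree below
  \<open>n\<close>.\<close>

lemma Y_in_subalgebra: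
  assumes "growth lam" "additive lam" "subalgebra B" "\<And>d k. k < n \<Longrightarrow> fps_nth (X d) k \<in> B"
  shows "fps_nth (Y s) n \<in> B"
proof -
  obtain \<psi> where \<psi>: "Y s = fps_X ^ vertices s * msubst \<psi> X"
    using Y_series[OF assms(1,2)] by blast
  show ?thesis
  proof (cases "n < vertices s")
    case True
    then show ?thesis
      using assms(3) by (simp add: \<psi> fps_X_power_mult_nth subalgebra_def scale.subspace_0)
  next
    case False
    then have "fps_nth (msubst \<psi> X) (n - vertices s) \<in> B"
      using vertices_pos[of s] by (intro msubst_in_subalgebra[OF assms(3)] assms(4)) auto
    then show ?thesis using False by (simp add: \<psi> fps_X_power_mult_nth)
  qed
qed

text \<open>Both series satisfy the same recursion, which depends only on root and size.
  Cross-multiplication includes the case of vanishing coefficients.\<close>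

lemma Y_proportional:
  assumes "growth lam" "additive lam" "label s = label t" "vertices s = vertices t"
  shows "scale (c t) (fps_nth (Y s) n) = scale (c s) (fps_nth (Y t) n)"
proof -
  obtain \<phi> where \<phi>: "Y s = fps_X ^ vertices s * msubst \<phi> X"
    "grows w (\<lambda>j m. lam (label s) j (vertices s + m)) \<phi>" "\<phi> {#} = c s"
    using Y_series[OF assms(1,2)] by blast
  obtain \<psi> where \<psi>: "Y t = fps_X ^ vertices s * msubst \<psi> X"
    "grows w (\<lambda>j m. lam (label s) j (vertices s + m)) \<psi>" "\<psi> {#} = c t"
    using Y_series[OF assms(1,2)] assms(3,4) by metis
  have "c t * \<phi> P = c s * \<psi> P" for P
    by (rule grows_unique[OF \<phi>(2) \<psi>(2)]) (simp add: \<phi>(3) \<psi>(3))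
  then show ?thesis
    by (simp add: \<phi>(1) \<psi>(1) fps_X_power_mult_nth msubst_def scale.scale_sum_right)
qed

lemma lookup_X_size: "size h \<noteq> 1 \<Longrightarrow> Poly_Mapping.lookup (fps_nth (X d) n) h = 0"
  using X_nth_eq_graft[of d n]
  by (auto simp: graft_def lookup_linear_extension lookup_basis intro!: sum.neutral)

lemma right_coeff_eqI:
  assumes "\<And>h. right_coeff h x = right_coeff h y"
  shows "x = y"
proof (rule poly_mapping_eqI)
  fix p
  show "Poly_Mapping.lookup x p = Poly_Mapping.lookup y p"
    by (cases p) (metis assms lookup_right_coeff)
qed

text \<open>\<open>W i m n\<close> is taken from any tree with root \<open>i\<close>,
  \<open>m\<close> vertices and nonzero coefficient, normalised by that coefficient. Membership is
  stated for arbitrary subalgebras because it is applied both to \<open>A\<close> and to the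
  preimage of \<open>A\<close> under the antipode.\<close>

lemma coprod_X:
  assumes lam: "growth lam" "additive lam" and nz: "\<And>i. \<exists>j. b i {#j#} \<noteq> 0"
  obtains W where
    "\<And>i n. coprod (fps_nth (X i) n) =
      tensor (fps_nth (X i) n) 1 + (\<Sum>m=1..n. tensor (W i m n) (fps_nth (X i) m))"
    "\<And>i m n B. subalgebra B \<Longrightarrow> m \<ge> 1 \<Longrightarrow> (\<And>d k. k < n \<Longrightarrow> fps_nth (X d) k \<in> B) \<Longrightarrow> W i m n \<in> B"
proof -
  define t where "t i m = (SOME s. label s = i \<and> vertices s = m \<and> c s \<noteq> 0)" for i m
  have t: "label (t i m) = i" "vertices (t i m) = m" "c (t i m) \<noteq> 0" if "m \<ge> 1" for i m
    using someI_ex[OF exists_tree[OF nz that, of i]] by (simp_all add: t_def)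
  define W where "W i m n = scale (1 / c (t i m)) (fps_nth (Y (t i m)) n)" for i m n
  have Y_W: "fps_nth (Y s) n = scale (c s) (W (label s) (vertices s) n)" for s n
  proof -
    let ?t = "t (label s) (vertices s)"
    note t = t[OF vertices_pos, of "label s" s]
    have "scale (c ?t) (fps_nth (Y s) n) = scale (c s) (fps_nth (Y ?t) n)"
      by (rule Y_proportional[OF lam]) (simp_all add: t)
    then have "scale (1 / c ?t) (scale (c ?t) (fps_nth (Y s) n)) = scale (1 / c ?t) (scale (c s) (fps_nth (Y ?t) n))"
      by simp
    then show ?thesis using t(3) by (simp add: W_def)
  qed
  have "coprod (fps_nth (X i) n) =
      tensor (fps_nth (X i) n) 1 + (\<Sum>m=1..n. tensor (W i m n) (fps_nth (X i) m))" (is "?l = ?r") for i n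
  proof (rule right_coeff_eqI)
    fix h :: "'i forest"
    have l: "?l = fps_nth (Z i) n" by (simp add: Z_def)
    have r: "right_coeff h ?r = scale (1 when h = {#}) (fps_nth (X i) n) +
        (\<Sum>m=1..n. scale (Poly_Mapping.lookup (fps_nth (X i) m) h) (W i m n))"
      by (simp add: lin_add[OF lin_right_coeff] lin_sum[OF lin_right_coeff] right_coeff_tensor lookup_one)
    consider "h = {#}" | s where "h = {#s#}" | "size h > 1"
      by (metis One_nat_def Suc_lessI nonempty_has_size size_1_singleton_mset)
    then show "right_coeff h ?l = right_coeff h ?r"
    proof cases
      case 1
      then show ?thesis
        unfolding l r by (simp add: right_coeff_Z lookup_X_size)
    next
      case (2 s)
      have "right_coeff h ?r = (\<Sum>m=1..n. scale (tree_coeff s (fps_nth (X i) m)) (W i m n))"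
        unfolding r by (simp add: 2 tree_coeff_def)
      also have "\<dots> = (\<Sum>m=1..n. if m = vertices s then scale (if label s = i then c s else 0) (W i m n) else 0)"
        by (intro sum.cong) (auto simp: tree_coeff_X)
      also have "\<dots> = (if vertices s \<le> n then scale (if label s = i then c s else 0) (W i (vertices s) n) else 0)"
        using vertices_pos[of s] by simp
      also have "\<dots> = (if label s = i then fps_nth (Y s) n else 0)"
      \<comment> \<open>A tree with more than \<open>n\<close> vertices gives 0 on both sides, by
        the power of \<open>fps_X\<close> in \<open>Y s\<close>.\<close>
      proof (cases "vertices s \<le> n")
        case False
        obtain \<psi> where "Y s = fps_X ^ vertices s * msubst \<psi> X"
          using Y_series[OF lam] by blast
        then show ?thesis using False by (simp add: fps_X_power_mult_nth)
      qed (auto simp: Y_W)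
      finally show ?thesis
        unfolding l 2 by (simp add: right_coeff_Z)
    next
      case 3
      then have "h \<noteq> {#}" by auto
      then show ?thesis
        unfolding l r using 3 by (auto simp: right_coeff_Z lookup_X_size)
    qed
  qed
  moreover have "W i m n \<in> B"
    if "subalgebra B" "m \<ge> 1" "\<And>d k. k < n \<Longrightarrow> fps_nth (X d) k \<in> B" for i m n B
    using Y_in_subalgebra[OF lam that(1,3), of n "t i m"] that(1)
    by (auto simp: W_def subalgebra_def scale.subspace_scale)
  ultimately show thesis using that by blast
qed

lemma tensor_span_mult:
  assumes "z \<in> scale.span {tensor x y | x y. x \<in> A \<and> y \<in> A}" "z' \<in> scale.span {tensor x y | x y. x \<in> A \<and> y \<in> A}"
  shows "z * z' \<in> scale.span {tensor x y | x y. x \<in> A \<and> y \<in> A}"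
proof -
  let ?T = "{tensor x y | x y. x \<in> A \<and> y \<in> A}"
  have sub: "scale.subspace {z. f z \<in> scale.span ?T}" if "lin f" for f :: "('i, 'k) tree_alg2 \<Rightarrow> _"
    using scale.subspace_span[of ?T]
    by (auto simp: scale.subspace_def lin_zero[OF that] lin_add[OF that] lin_scale[OF that])
  have 1: "tensor x y * z' \<in> scale.span ?T" if "x \<in> A" "y \<in> A" for x y
  proof -
    have "scale.span ?T \<subseteq> {z'. tensor x y * z' \<in> scale.span ?T}"
    proof (rule scale.span_minimal[OF _ sub[OF lin_mult_right]])
      have "tensor (x * x') (y * y') \<in> scale.span ?T" if "x' \<in> A" "y' \<in> A" for x' y'
        using that \<open>x \<in> A\<close> \<open>y \<in> A\<close> subalgebra_A by (intro scale.span_base) (auto simp: subalgebra_def)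
      then show "?T \<subseteq> {z'. tensor x y * z' \<in> scale.span ?T}" by (auto simp: tensor_mult)
    qed
    then show ?thesis using assms(2) by blast
  qed
  have "scale.span ?T \<subseteq> {z. z * z' \<in> scale.span ?T}"
    by (rule scale.span_minimal[OF _ sub[OF lin_mult_left]]) (auto simp: 1)
  then show ?thesis using assms(1) by blast
qed

lemma antipode_tensor_id_tensor: "antipode_tensor_id (tensor x y) = tensor (antipode x) y"
proof -
  note S = alg_hom_lin[OF alg_hom_antipode] and T = alg_hom_lin[OF alg_hom_antipode_tensor_id]
  show ?thesis
    by (rule bilinear_eqI[of "\<lambda>x y. antipode_tensor_id (tensor x y)" "\<lambda>x y. tensor (antipode x) y"])
      (simp_all only: lin_comp[OF T lin_tensor_left] lin_comp[OF T lin_tensor_right]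
        lin_comp[OF lin_tensor_left S] lin_tensor_right tensor_basis,
       simp add: antipode_tensor_id_def)
qed

lemma conditions_imp_hopf:
  assumes lam: "growth lam" "additive lam" and nonconst: "\<And>i. \<exists>P. P \<noteq> {#} \<and> b i P \<noteq> 0"
  shows "hopf_subalgebra A"
proof -
  have nz: "\<exists>j. b i {#j#} \<noteq> 0" for i
    by (rule linear_coeff_nonzero[OF lam(1) nonconst])
  obtain W where coprod: "\<And>i n. coprod (fps_nth (X i) n) =
      tensor (fps_nth (X i) n) 1 + (\<Sum>m=1..n. tensor (W i m n) (fps_nth (X i) m))"
    and W: "\<And>i m n B. subalgebra B \<Longrightarrow> m \<ge> 1 \<Longrightarrow> (\<And>d k. k < n \<Longrightarrow> fps_nth (X d) k \<in> B) \<Longrightarrow> W i m n \<in> B"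
    using coprod_X[OF lam nz] by blast
  let ?T = "{tensor x y | x y. x \<in> A \<and> y \<in> A}"
  have one: "1 \<in> A" using subalgebra_A by (simp add: subalgebra_def)
  have T: "tensor x y \<in> scale.span ?T" if "x \<in> A" "y \<in> A" for x y
    by (rule scale.span_base) (use that in blast)
  have "coprod x \<in> scale.span ?T" if "x \<in> A" for x
  proof -
    have "x \<in> {x. coprod x \<in> scale.span ?T}"
      using that
    proof (rule A_induct)
      show "fps_nth (X i) n \<in> {x. coprod x \<in> scale.span ?T}" for i n
        using W[OF subalgebra_A] X_in_A one unfolding coprod mem_Collect_eq
        by (intro scale.span_add scale.span_sum T) auto
      note h = alg_hom_coprod and l = alg_hom_lin[OF alg_hom_coprod]
      have "tensor 1 1 \<in> scale.span ?T" by (rule T[OF one one])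
      then show "subalgebra {x. coprod x \<in> scale.span ?T}"
        by (auto simp: subalgebra_def scale.subspace_def alg_hom_one[OF h] alg_hom_mult[OF h] lin_zero[OF l]
            lin_add[OF l] lin_scale[OF l] tensor_one_one tensor_span_mult scale.span_zero scale.span_add
            scale.span_scale)
    qed
    then show ?thesis by simp
  qed
  moreover have "antipode x \<in> A" if "x \<in> A" for x
  proof -
    let ?S = "{x. antipode x \<in> A}"
    note h = alg_hom_antipode and l = alg_hom_lin[OF alg_hom_antipode]
    have S: "subalgebra ?S"
      using subalgebra_A by (auto simp: subalgebra_def scale.subspace_def alg_hom_one[OF h] alg_hom_mult[OF h]
          lin_zero[OF l] lin_add[OF l] lin_scale[OF l])
    have "fps_nth (X i) n \<in> ?S" for i n
    proof (induction n arbitrary: i rule: less_induct)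
      case (less n)
      \<comment> \<open>So the antipode equation for this component has right-hand side 0 and can be
        solved for its antipode, which comes from the term
        \<open>X_i(n) \<otimes> 1\<close>.\<close>
      have "counit (fps_nth (X i) n) = 0"
        using arg_cong[OF map_fps_counit_X[of i], of "\<lambda>x. fps_nth x n"] by simp
      then have "multiply (antipode_tensor_id (coprod (fps_nth (X i) n))) = 0"
        by (simp add: antipode_tensor_id_coprod multiply_antipode_left_alg)
      then have "antipode (fps_nth (X i) n) = - (\<Sum>m=1..n. antipode (W i m n) * fps_nth (X i) m)"
        unfolding coprod
        by (simp add: lin_add[OF alg_hom_lin[OF alg_hom_antipode_tensor_id]]
            lin_sum[OF alg_hom_lin[OF alg_hom_antipode_tensor_id]] lin_add[OF lin_multiply]
            lin_sum[OF lin_multiply] antipode_tensor_id_tensor eq_neg_iff_add_eq_0)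
      \<comment> \<open>The induction hypothesis puts all components of degree below
        \<open>n\<close> into the subalgebra \<open>?S\<close>, hence also
        \<open>W i m n\<close>.\<close>
      moreover have "antipode (W i m n) \<in> A" if "m \<ge> 1" for m
        using W[OF S that] less by blast
      ultimately show ?case
        using subalgebra_A X_in_A
        by (auto simp: subalgebra_def intro!: scale.subspace_neg scale.subspace_sum)
    qed
    then show ?thesis using A_induct[OF that _ S] by blast
  qed
  ultimately show ?thesis
    using is_antipode_antipode subalgebra_A by (auto simp: hopf_subalgebra_def)
qed

end

section \<open>Multi-indices as functions\<close>

definition derivative_at_0 :: "('i::finite, 'k::field_char_0) series \<Rightarrow> 'i multiset \<Rightarrow> 'k" where
  "derivative_at_0 f P = (\<Prod>d\<in>UNIV. fact (count P d)) * f (count P)"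

lemma sum_mset_eq_sum_count:
  fixes f :: "'i::finite \<Rightarrow> 'k::comm_semiring_1"
  shows "(\<Sum>d\<in>#P. f d) = (\<Sum>d\<in>UNIV. of_nat (count P d) * f d)"
proof (induction P)
  case (add e P)
  have "(\<Sum>d\<in>UNIV. of_nat (count (add_mset e P) d) * f d) =
      (\<Sum>d\<in>UNIV. of_nat (count P d) * f d + (if d = e then f d else 0))"
    by (intro sum.cong) (auto simp: distrib_right add.commute)
  then show ?case
    using add by (simp add: sum.distrib add.commute)
qed simp

lemma size_eq_sum_count: "size P = (\<Sum>d\<in>UNIV. count P d)" for P :: "'i::finite multiset"
  using sum_mset_eq_sum_count[of "\<lambda>_. 1 :: nat" P] by simp

lemma lin_coeff_eq:
  fixes f :: "('i::finite, 'k::field_char_0) series"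
  shows "derivative_at_0 f {#j#} = lin_coeff f j"
proof -
  have "(\<Prod>d\<in>UNIV. fact (count {#j#} d)) = (1 :: 'k)"
    by (intro prod.neutral) auto
  moreover have "count {#j#} = (\<lambda>_. 0)(j := 1)"
    by auto
  ultimately show ?thesis
    by (simp add: derivative_at_0_def lin_coeff_def)
qed

lemma derivative_at_0_eq_0_iff: "derivative_at_0 f P = 0 \<longleftrightarrow> f (count P) = 0"
  by (simp add: derivative_at_0_def)

text \<open>Passes from multisets of pairs to the indexed families \<open>d_1, ..., d_p\<close> and
  \<open>n_1, ..., n_p\<close> of the theorem.\<close>

lemma enumerate_multiset:
  "\<exists>d n. M = image_mset (\<lambda>q. (d q, n q)) (mset_set {1..size M})" for M :: "('a \<times> 'b) multiset"
proof (induction M)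
  case (add q M)
  then obtain d n where M: "M = image_mset (\<lambda>q. (d q, n q)) (mset_set {1..size M})" by blast
  let ?p = "Suc (size M)"
  have "image_mset (\<lambda>q'. ((d(?p := fst q)) q', (n(?p := snd q)) q')) (mset_set {1..?p}) =
      add_mset q (image_mset (\<lambda>q. (d q, n q)) (mset_set {1..size M}))"
    by (simp add: atLeastAtMostSuc_conv, rule image_mset_cong) auto
  then show ?case
    using M by (intro exI[of _ "d(?p := fst q)"] exI[of _ "n(?p := snd q)"]) simp
qed simp

theorem proposition19:
  fixes a :: "'i::finite \<Rightarrow> ('i, 'k::field_char_0) series"
  assumes nonconst: "\<And>i. nonconstant (a i)"
    and const_coeff: "\<And>i. a i (\<lambda>_. 0) = 1"
  shows "hopf_sdse a \<longleftrightarrow>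
    (\<exists>lam :: 'i \<Rightarrow> 'i \<Rightarrow> nat \<Rightarrow> 'k.
      (\<forall>i j. \<forall>p :: 'i \<Rightarrow> nat.
        a i (p(j := p j + 1)) =
          1 / of_nat (p j + 1) *
          (lam i j ((\<Sum>l\<in>UNIV. p l) + 1) - (\<Sum>l\<in>UNIV. of_nat (p l) * lin_coeff (a l) j)) *
          a i p) \<and>
      (\<forall>p\<ge>1. \<forall>i j. \<forall>d :: nat \<Rightarrow> 'i.
        a i (\<lambda>k. card {q \<in> {1..p}. d q = k}) \<noteq> 0 \<longrightarrow>
        (\<forall>n :: nat \<Rightarrow> nat. (\<forall>l\<in>{1..p}. n l \<ge> 1) \<longrightarrow>
          lam i j ((\<Sum>l=1..p. n l) + 1) - lin_coeff (a i) j =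
            lam i j (p + 1) - lin_coeff (a i) j +
            (\<Sum>l=1..p. lam (d l) j (n l) - lin_coeff (a (d l)) j))))"
proof -
  let ?b = "\<lambda>i. derivative_at_0 (a i)"
  let ?X = "sdse_solution a"
  note sol = is_sdse_solution_sdse_solution[of a]
  interpret dyson_schwinger ?b ?X
  proof
    have "exp_subst (?b i) ?X = msubst (\<lambda>P. a i (count P)) ?X" for i
      by (simp add: exp_subst_def derivative_at_0_def)
    then show "fps_nth (?X i) 0 = 0" "fps_nth (?X i) (Suc n) = graft i (fps_nth (exp_subst (?b i) ?X) n)" for i n
      by (simp_all add: is_sdse_solution_nth[OF sol])
    show "?X i \<in> completion" for i
      using sol unfolding is_sdse_solution_def by blast
    have "count {#} = (\<lambda>_ :: 'i. 0 :: nat)" by auto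
    then show "?b i {#} = 1" for i
      by (simp add: derivative_at_0_def const_coeff)
  qed
  have nz: "\<exists>P. P \<noteq> {#} \<and> ?b i P \<noteq> 0" for i
  proof -
    obtain p where p: "p \<noteq> (\<lambda>_. 0)" "a i p \<noteq> 0"
      using nonconst[of i] by (auto simp: nonconstant_def)
    have count: "count (Abs_multiset p) = p" by simp
    have "Abs_multiset p \<noteq> {#}"
    proof
      assume "Abs_multiset p = {#}"
      then have "p = count {#}" using count by (simp only:)
      then show False using p(1) by (simp add: fun_eq_iff)
    qed
    then show ?thesis
      using p(2) count by (intro exI[of _ "Abs_multiset p"]) (simp add: derivative_at_0_eq_0_iff)
  qed
  have "hopf_subalgebra A \<longleftrightarrow> (\<exists>lam. growth lam \<and> additive lam)"
  proof
    assume "hopf_subalgebra A"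
    then show "\<exists>lam. growth lam \<and> additive lam"
      by (rule hopf_imp_conditions) (rule nz)
  next
    assume "\<exists>lam. growth lam \<and> additive lam"
    then show "hopf_subalgebra A"
      by (elim exE conjE) (rule conditions_imp_hopf[OF _ _ nz])
  qed
  moreover have "growth lam \<longleftrightarrow>
      (\<forall>i j. \<forall>p :: 'i \<Rightarrow> nat.
        a i (p(j := p j + 1)) =
          1 / of_nat (p j + 1) *
          (lam i j ((\<Sum>l\<in>UNIV. p l) + 1) - (\<Sum>l\<in>UNIV. of_nat (p l) * lin_coeff (a l) j)) *
          a i p)" for lam
  proof -
    \<comment> \<open>Both sides contain the product of factorials for \<open>P\<close>, and adding
      \<open>j\<close> multiplies it by \<open>p_j + 1\<close>; cancelling it leaves the first
      condition.\<close>
    have eq: "?b i (add_mset j P) = (lam i j (Suc (size P)) - (\<Sum>d\<in>#P. ?b d {#j#})) * ?b i P \<longleftrightarrow>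
        a i ((count P)(j := count P j + 1)) =
          1 / of_nat (count P j + 1) *
          (lam i j ((\<Sum>l\<in>UNIV. count P l) + 1) - (\<Sum>l\<in>UNIV. of_nat (count P l) * lin_coeff (a l) j)) *
          a i (count P)" for i j P
    proof -
      let ?f = "\<Prod>d\<in>UNIV. fact (count P d) :: 'k"
      let ?r = "lam i j ((\<Sum>l\<in>UNIV. count P l) + 1) - (\<Sum>l\<in>UNIV. of_nat (count P l) * lin_coeff (a l) j)"
      let ?n = "of_nat (count P j + 1) :: 'k"
      have f: "?f \<noteq> 0" and n: "?n \<noteq> 0" by (simp_all del: of_nat_Suc of_nat_add)
      have divide: "x * m = r * y \<longleftrightarrow> x = 1 / m * r * y" if "m \<noteq> 0" for x m r y :: 'k
        using that by (auto simp: field_simps)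
      have cnt: "count (add_mset j P) = (count P)(j := count P j + 1)" by auto
      have "?b i (add_mset j P) = ?f * (?n * a i ((count P)(j := count P j + 1)))"
        unfolding derivative_at_0_def prod_fact_add_mset unfolding cnt Suc_eq_plus1
        by (simp only: mult.assoc mult.left_commute)
      moreover have "lam i j (Suc (size P)) - (\<Sum>d\<in>#P. ?b d {#j#}) = ?r"
        by (simp add: lin_coeff_eq sum_mset_eq_sum_count size_eq_sum_count)
      moreover have "?b i P = ?f * a i (count P)"
        by (simp add: derivative_at_0_def)
      ultimately have "?b i (add_mset j P) = (lam i j (Suc (size P)) - (\<Sum>d\<in>#P. ?b d {#j#})) * ?b i P \<longleftrightarrow>
          ?f * (?n * a i ((count P)(j := count P j + 1))) = ?f * (?r * a i (count P))"
        by (simp only: mult.left_commute)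
      also have "\<dots> \<longleftrightarrow> a i ((count P)(j := count P j + 1)) * ?n = ?r * a i (count P)"
        unfolding mult_left_cancel[OF f] mult.commute[of ?n] ..
      also have "\<dots> \<longleftrightarrow> a i ((count P)(j := count P j + 1)) = 1 / ?n * ?r * a i (count P)"
        by (rule divide[OF n])
      finally show ?thesis .
    qed
    let ?E = "\<lambda>i j p. a i (p(j := p j + 1)) = 1 / of_nat (p j + 1) *
      (lam i j ((\<Sum>l\<in>UNIV. p l) + 1) - (\<Sum>l\<in>UNIV. of_nat (p l) * lin_coeff (a l) j)) * a i p"
    show ?thesis
      unfolding growth_def eq
    proof (intro iffI allI)
      fix i j p
      assume "\<forall>i j P. ?E i j (count P)"
      then have "?E i j (count (Abs_multiset p))" by blast
      moreover have "count (Abs_multiset p) = p" by simp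
      ultimately show "?E i j p" by (simp only:)
    next
      fix i j P
      assume "\<forall>i j p. ?E i j p"
      then show "?E i j (count P)" by blast
    qed
  qed
  moreover have "additive lam \<longleftrightarrow>
      (\<forall>p\<ge>1. \<forall>i j. \<forall>d :: nat \<Rightarrow> 'i.
        a i (\<lambda>k. card {q \<in> {1..p}. d q = k}) \<noteq> 0 \<longrightarrow>
        (\<forall>n :: nat \<Rightarrow> nat. (\<forall>l\<in>{1..p}. n l \<ge> 1) \<longrightarrow>
          lam i j ((\<Sum>l=1..p. n l) + 1) - lin_coeff (a i) j =
            lam i j (p + 1) - lin_coeff (a i) j +
            (\<Sum>l=1..p. lam (d l) j (n l) - lin_coeff (a (d l)) j)))" (is "_ \<longleftrightarrow> ?R") for lam
  proof -
    let ?M = "\<lambda>p d n. image_mset (\<lambda>q. (d q, n q)) (mset_set {1..p :: nat}) :: ('i \<times> nat) multiset"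
    define C where "C i j M \<longleftrightarrow> (?b i (image_mset fst M) \<noteq> 0 \<longrightarrow> (\<forall>q\<in>#M. snd q \<ge> 1) \<longrightarrow>
        lam i j (Suc (\<Sum>q\<in>#M. snd q)) =
          lam i j (Suc (size M)) + (\<Sum>q\<in>#M. lam (fst q) j (snd q) - ?b (fst q) {#j#}))"
      for i j and M :: "('i \<times> nat) multiset"
    have C: "C i j (?M p d n) \<longleftrightarrow>
        (a i (\<lambda>k. card {q \<in> {1..p}. d q = k}) \<noteq> 0 \<longrightarrow> (\<forall>l\<in>{1..p}. n l \<ge> 1) \<longrightarrow>
          lam i j ((\<Sum>l=1..p. n l) + 1) - lin_coeff (a i) j =
            lam i j (p + 1) - lin_coeff (a i) j +
            (\<Sum>l=1..p. lam (d l) j (n l) - lin_coeff (a (d l)) j))" for i j p d n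
    proof -
      have "count (image_mset fst (?M p d n)) k = card {q \<in> {1..p}. d q = k}" for k
      proof -
        have "count (image_mset fst (?M p d n)) k = (\<Sum>q | q \<in> {1..p} \<and> k = d q. 1)"
          unfolding image_mset.compositionality o_def fst_conv count_image_mset'
          by (intro sum.cong) auto
        also have "{q. q \<in> {1..p} \<and> k = d q} = {q \<in> {1..p}. d q = k}" by auto
        finally show ?thesis by simp
      qed
      then have "count (image_mset fst (?M p d n)) = (\<lambda>k. card {q \<in> {1..p}. d q = k})"
        by (rule ext)
      moreover have "(\<Sum>q\<in>#?M p d n. snd q) = (\<Sum>l=1..p. n l)"
        "(\<Sum>q\<in>#?M p d n. lam (fst q) j (snd q) - ?b (fst q) {#j#}) =
          (\<Sum>l=1..p. lam (d l) j (n l) - lin_coeff (a (d l)) j)"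
        by (simp_all add: image_mset.compositionality o_def sum_unfold_sum_mset lin_coeff_eq)
      moreover have "x - z = y - z + u \<longleftrightarrow> x = y + u" for x y z u :: 'k
        by (auto simp: algebra_simps)
      moreover have "(\<forall>q\<in>#?M p d n. snd q \<ge> 1) \<longleftrightarrow> (\<forall>l\<in>{1..p}. n l \<ge> 1)" "size (?M p d n) = p"
        by auto
      ultimately show ?thesis
        by (simp only: C_def derivative_at_0_eq_0_iff Suc_eq_plus1 simp_thms)
    qed
    have "additive lam \<longleftrightarrow> (\<forall>i j M. C i j M)"
      by (simp only: additive_def C_def)
    also have "\<dots> \<longleftrightarrow> (\<forall>p\<ge>1. \<forall>i j d n. C i j (?M p d n))"
    proof (intro iffI allI impI)
      fix i j and M :: "('i \<times> nat) multiset"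
      assume R: "\<forall>p\<ge>1. \<forall>i j d n. C i j (?M p d n)"
      show "C i j M"
      \<comment> \<open>The range \<open>p \<ge> 1\<close> omits the empty \<open>M\<close>, for
        which both sides are \<open>lam i j 1\<close>.\<close>
      proof (cases "M = {#}")
        case False
        then have "size M \<ge> 1" by (simp add: Suc_le_eq nonempty_has_size)
        then have "C i j (?M (size M) d n)" for d n using R by blast
        moreover obtain d n where M: "M = ?M (size M) d n" using enumerate_multiset[of M] by blast
        ultimately show ?thesis by (subst M)
      qed (simp add: C_def)
    qed simp
    also have "\<dots> \<longleftrightarrow> ?R"
      unfolding C by (simp only: all_simps)
    finally show ?thesis .
  qed
  moreover have "hopf_sdse a \<longleftrightarrow> hopf_subalgebra A"
    by (simp add: hopf_sdse_def sdse_subalgebra_def A_def)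
  ultimately show ?thesis by (simp only:)
qed

end
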